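(* Let $\Gamma$ be a virtually polycyclic group such that $H^2(\Gamma;\mathbb{Z})$ is not a torsion group. Then there is a class $x\in H^2(\Gamma;\mathbb{Z})$, represented by a central extension $e\to\mathbb{Z}\xrightarrow{\iota}\tilde\Gamma\to\Gamma\to e$, such that (i) $x$ is not in the kernel of the map $H^2(\Gamma;\mathbb{Z})\to\mathrm{Hom}(H_2(\Gamma;\mathbb{Z}),\mathbb{Z})$ induced by the Kronecker pairing, and (ii) there is a sequence of finite index subgroups $\Gamma_n\le\tilde\Gamma$ with $\iota(\mathbb{Z})\cap\bigcap_n\Gamma_n=\{e\}$. Consequently $\Gamma$ is not matricially stable.
   Context: A group $G$ is polycyclic if there are subgroups $G=G_1\ge G_2\ge\cdots\ge G_{m+1}=\{e\}$ with $G_{i+1}$ normal in $G_i$ and $G_i/G_{i+1}$ cyclic. A group is virtually polycyclic if it has a finite index polycyclic subgroup. A countable discrete group $\Gamma$ is matricially stable if for every sequence of functions $\rho_n:\Gamma\to U(k_n)$ with $\|\rho_n(gh)-\rho_n(g)\rho_n(h)\|\to0$ (operator norm) for all $g,h\in\Gamma$, there are unitary representations $\tilde\rho_n:\Gamma\to U(k_n)$ with $\|\rho_n(g)-\tilde\rho_n(g)\|\to0$ for all $g\in\Gamma$. Group (co)homology is with trivial action. A central extension $e\to\mathbb{Z}\to\tilde\Gamma\to\Gamma\to e$ corresponds to the class in $H^2(\Gamma;\mathbb{Z})$ of the cocycle $\sigma(g,h)=\theta(g)\theta(h)\theta(gh)^{-1}\in\mathbb{Z}$ for any set-theoretic section $\theta$.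 *)

theory Defs
  imports
    "HOL-Algebra.Free_Abelian_Groups"
    "Jordan_Normal_Form.Schur_Decomposition"
begin

section \<open>Virtually polycyclic groups\<close>

definition polycyclic :: "('a, 'm) monoid_scheme \<Rightarrow> bool" where
  "polycyclic G \<longleftrightarrow> group G \<and>
     (\<exists>(m::nat) (S :: nat \<Rightarrow> 'a set).
        S 1 = carrier G \<and> S (m + 1) = {\<one>\<^bsub>G\<^esub>} \<and>
        (\<forall>i\<in>{1..m + 1}. subgroup (S i) G) \<and>
        (\<forall>i\<in>{1..m}. S (i + 1) \<lhd> G\<lparr>carrier := S i\<rparr> \<and>
           cyclic_group (G\<lparr>carrier := S i\<rparr> Mod S (i + 1))))"

definition finite_index_subgroup :: "'a set \<Rightarrow> ('a, 'm) monoid_scheme \<Rightarrow> bool" where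
  "finite_index_subgroup H G \<longleftrightarrow> subgroup H G \<and> finite (rcosets\<^bsub>G\<^esub> H)"

definition virtually_polycyclic :: "('a, 'm) monoid_scheme \<Rightarrow> bool" where
  "virtually_polycyclic G \<longleftrightarrow>
     group G \<and> (\<exists>H. finite_index_subgroup H G \<and> polycyclic (G\<lparr>carrier := H\<rparr>))"

definition torsion_group :: "('a, 'm) monoid_scheme \<Rightarrow> bool" where
  "torsion_group G \<longleftrightarrow> (\<forall>x\<in>carrier G. \<exists>n::nat. n > 0 \<and> x [^]\<^bsub>G\<^esub> n = \<one>\<^bsub>G\<^esub>)"


section \<open>Second (co)homology with trivial integer coefficients\<close>

text \<open>
  Everything is computed from the inhomogeneous (unnormalised) bar complex, whose degree \<open>n\<close>
  chain group is free abelian on \<open>n\<close>-tuples of group elements; \<open>bar_d2\<close> and \<open>bar_d3\<close> give its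
  differentials on basis elements. Cochains are extensional functions on the same tuples.
\<close>

definition bar_d2 :: "('a, 'm) monoid_scheme \<Rightarrow> 'a \<times> 'a \<Rightarrow> 'a \<Rightarrow>\<^sub>0 int" where
  "bar_d2 G = (\<lambda>(g, h). frag_of h - frag_of (g \<otimes>\<^bsub>G\<^esub> h) + frag_of g)"

definition bar_d3 :: "('a, 'm) monoid_scheme \<Rightarrow> 'a \<times> 'a \<times> 'a \<Rightarrow> ('a \<times> 'a) \<Rightarrow>\<^sub>0 int" where
  "bar_d3 G = (\<lambda>(g, h, k). frag_of (h, k) - frag_of (g \<otimes>\<^bsub>G\<^esub> h, k)
                          + frag_of (g, h \<otimes>\<^bsub>G\<^esub> k) - frag_of (g, h))"

definition cycles2 :: "('a, 'm) monoid_scheme \<Rightarrow> (('a \<times> 'a) \<Rightarrow>\<^sub>0 int) set" where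
  "cycles2 G = {z \<in> carrier (free_Abelian_group (carrier G \<times> carrier G)).
                  frag_extend (bar_d2 G) z = 0}"

definition boundaries2 :: "('a, 'm) monoid_scheme \<Rightarrow> (('a \<times> 'a) \<Rightarrow>\<^sub>0 int) set" where
  "boundaries2 G = frag_extend (bar_d3 G) `
     carrier (free_Abelian_group (carrier G \<times> carrier G \<times> carrier G))"

definition homology2 :: "('a, 'm) monoid_scheme \<Rightarrow> (('a \<times> 'a) \<Rightarrow>\<^sub>0 int) set monoid" where
  "homology2 G =
     (free_Abelian_group (carrier G \<times> carrier G))\<lparr>carrier := cycles2 G\<rparr> Mod boundaries2 G"

definition cochain_group2 :: "('a, 'm) monoid_scheme \<Rightarrow> ('a \<times> 'a \<Rightarrow> int) monoid" where
  "cochain_group2 G = product_group (carrier G \<times> carrier G) (\<lambda>_. integer_group)"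

definition cocycles2 :: "('a, 'm) monoid_scheme \<Rightarrow> ('a \<times> 'a \<Rightarrow> int) set" where
  "cocycles2 G = {s \<in> carrier (cochain_group2 G).
     \<forall>g\<in>carrier G. \<forall>h\<in>carrier G. \<forall>k\<in>carrier G.
       s (h, k) - s (g \<otimes>\<^bsub>G\<^esub> h, k) + s (g, h \<otimes>\<^bsub>G\<^esub> k) - s (g, h) = 0}"

definition coboundaries2 :: "('a, 'm) monoid_scheme \<Rightarrow> ('a \<times> 'a \<Rightarrow> int) set" where
  "coboundaries2 G =
     (\<lambda>b. \<lambda>(g, h)\<in>carrier G \<times> carrier G. b h - b (g \<otimes>\<^bsub>G\<^esub> h) + b g) ` (UNIV :: ('a \<Rightarrow> int) set)"

definition cohomology2 :: "('a, 'm) monoid_scheme \<Rightarrow> ('a \<times> 'a \<Rightarrow> int) set monoid" where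
  "cohomology2 G = (cochain_group2 G)\<lparr>carrier := cocycles2 G\<rparr> Mod coboundaries2 G"


section \<open>The Kronecker pairing\<close>

definition hom_group ::
    "('a, 'm) monoid_scheme \<Rightarrow> ('b, 'n) monoid_scheme \<Rightarrow> ('a \<Rightarrow> 'b) monoid" where
  "hom_group A B =
     (product_group (carrier A) (\<lambda>_. B))\<lparr>carrier := hom A B \<inter> extensional (carrier A)\<rparr>"

definition cochain_eval :: "('c \<Rightarrow> int) \<Rightarrow> ('c \<Rightarrow>\<^sub>0 int) \<Rightarrow> int" where
  "cochain_eval s z = (\<Sum>p\<in>Poly_Mapping.keys z. Poly_Mapping.lookup z p * s p)"

text \<open>The value does not depend on the representatives; see \<open>kronecker_map_coset\<close> below.\<close>

definition kronecker_map ::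
    "('a, 'm) monoid_scheme \<Rightarrow> ('a \<times> 'a \<Rightarrow> int) set \<Rightarrow> (('a \<times> 'a) \<Rightarrow>\<^sub>0 int) set \<Rightarrow> int" where
  "kronecker_map G x =
     (\<lambda>c\<in>carrier (homology2 G). THE k. \<exists>s\<in>x. \<exists>z\<in>c. k = cochain_eval s z)"

lemma cochain_eval_add: "cochain_eval s (y + z) = cochain_eval s y + cochain_eval s z"
proof -
  have *: "cochain_eval s w = (\<Sum>p\<in>Poly_Mapping.keys y \<union> Poly_Mapping.keys z \<union> Poly_Mapping.keys (y + z).
             Poly_Mapping.lookup w p * s p)"
    if "Poly_Mapping.keys w \<subseteq> Poly_Mapping.keys y \<union> Poly_Mapping.keys z \<union> Poly_Mapping.keys (y + z)" for w
    unfolding cochain_eval_def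
    by (rule sum.mono_neutral_left) (use that in \<open>auto simp: in_keys_iff\<close>)
  show ?thesis
    by (subst (1 2 3) *) (auto simp: lookup_add sum.distrib distrib_right)
qed

lemma cochain_eval_0 [simp]: "cochain_eval s 0 = 0"
  by (simp add: cochain_eval_def)

lemma cochain_eval_minus: "cochain_eval s (- z) = - cochain_eval s z"
  using cochain_eval_add[of s z "- z"] by simp

lemma cochain_eval_diff: "cochain_eval s (y - z) = cochain_eval s y - cochain_eval s z"
  using cochain_eval_add[of s y "- z"] by (simp add: cochain_eval_minus)

lemma cochain_eval_of [simp]: "cochain_eval s (frag_of p) = s p"
  by (simp add: cochain_eval_def)

lemma comm_group_subgroup:
  assumes "comm_group A" "subgroup H A"
  shows "comm_group (A\<lparr>carrier := H\<rparr>)"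
proof -
  interpret comm_group A by fact
  show ?thesis
  proof (rule group.group_comm_groupI)
    show "group (A\<lparr>carrier := H\<rparr>)" by (rule subgroup_imp_group[OF assms(2)])
  qed (use subgroup.mem_carrier[OF assms(2)] m_comm in simp)
qed

lemma comm_group_cochain_group2: "comm_group (cochain_group2 G)"
  unfolding cochain_group2_def
  by (rule group.group_comm_groupI) (auto simp: fun_eq_iff restrict_def)

lemma subgroup_cocycles2:
  assumes "group G"
  shows "subgroup (cocycles2 G) (cochain_group2 G)"
proof -
  interpret group G by fact
  have grp: "group (cochain_group2 G)"
    using comm_group_cochain_group2 by (rule comm_group.axioms)
  show ?thesis
  proof (rule group.subgroupI[OF grp])
    show "cocycles2 G \<subseteq> carrier (cochain_group2 G)"
      by (auto simp: cocycles2_def)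
    have "(\<lambda>p\<in>carrier G \<times> carrier G. 0) \<in> cocycles2 G"
      by (simp add: cocycles2_def cochain_group2_def)
    then show "cocycles2 G \<noteq> {}" by blast
  next
    fix a assume a: "a \<in> cocycles2 G"
    then have "inv\<^bsub>cochain_group2 G\<^esub> a = (\<lambda>p\<in>carrier G \<times> carrier G. - a p)"
      by (simp add: cocycles2_def cochain_group2_def)
    with a show "inv\<^bsub>cochain_group2 G\<^esub> a \<in> cocycles2 G"
      by (force simp: cocycles2_def cochain_group2_def)
  next
    fix a b assume ab: "a \<in> cocycles2 G" "b \<in> cocycles2 G"
    have "a (h, k) + b (h, k) - (a (g \<otimes>\<^bsub>G\<^esub> h, k) + b (g \<otimes>\<^bsub>G\<^esub> h, k))
        + (a (g, h \<otimes>\<^bsub>G\<^esub> k) + b (g, h \<otimes>\<^bsub>G\<^esub> k)) - (a (g, h) + b (g, h)) = 0"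
      if "g \<in> carrier G" "h \<in> carrier G" "k \<in> carrier G" for g h k
    proof -
      have "a (h, k) - a (g \<otimes>\<^bsub>G\<^esub> h, k) + a (g, h \<otimes>\<^bsub>G\<^esub> k) - a (g, h) = 0"
           "b (h, k) - b (g \<otimes>\<^bsub>G\<^esub> h, k) + b (g, h \<otimes>\<^bsub>G\<^esub> k) - b (g, h) = 0"
        using ab that by (simp_all add: cocycles2_def)
      then show ?thesis by linarith
    qed
    then show "a \<otimes>\<^bsub>cochain_group2 G\<^esub> b \<in> cocycles2 G"
      by (simp add: cocycles2_def cochain_group2_def)
  qed
qed

lemma coboundaries2_subset: "group G \<Longrightarrow> coboundaries2 G \<subseteq> cocycles2 G"
  by (auto simp: coboundaries2_def cocycles2_def cochain_group2_def group.is_monoid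
        monoid.m_closed monoid.m_assoc extensional_def split: if_splits)

lemma comm_group_cocycle_group2:
  "group G \<Longrightarrow> comm_group ((cochain_group2 G)\<lparr>carrier := cocycles2 G\<rparr>)"
  by (rule comm_group_subgroup[OF comm_group_cochain_group2 subgroup_cocycles2])

lemma subgroup_coboundaries2:
  assumes G: "group G"
  shows "subgroup (coboundaries2 G) ((cochain_group2 G)\<lparr>carrier := cocycles2 G\<rparr>)"
proof -
  interpret group G by fact
  let ?d = "\<lambda>b. \<lambda>(g, h)\<in>carrier G \<times> carrier G. b h - b (g \<otimes>\<^bsub>G\<^esub> h) + b g :: int"
  have grp: "group (cochain_group2 G)"
    using comm_group_cochain_group2 by (rule comm_group.axioms)
  have "subgroup (coboundaries2 G) (cochain_group2 G)"
  proof (rule group.subgroupI[OF grp])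
    show "coboundaries2 G \<subseteq> carrier (cochain_group2 G)"
      using coboundaries2_subset[OF G] by (auto simp: cocycles2_def)
    show "coboundaries2 G \<noteq> {}" by (simp add: coboundaries2_def)
  next
    fix a assume "a \<in> coboundaries2 G"
    then obtain b where b: "a = ?d b" by (auto simp: coboundaries2_def)
    have "inv\<^bsub>cochain_group2 G\<^esub> a = (\<lambda>p\<in>carrier G \<times> carrier G. - a p)"
      by (simp add: cochain_group2_def b)
    also have "\<dots> = ?d (\<lambda>g. - b g)" by (auto simp: fun_eq_iff b restrict_def)
    finally have "inv\<^bsub>cochain_group2 G\<^esub> a = ?d (\<lambda>g. - b g)" .
    then show "inv\<^bsub>cochain_group2 G\<^esub> a \<in> coboundaries2 G"
      unfolding coboundaries2_def by (rule image_eqI[where x = "\<lambda>g. - b g"]) simp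
  next
    fix a a' assume "a \<in> coboundaries2 G" "a' \<in> coboundaries2 G"
    then obtain b b' where b: "a = ?d b" "a' = ?d b'" by (auto simp: coboundaries2_def)
    have "a \<otimes>\<^bsub>cochain_group2 G\<^esub> a' = ?d (\<lambda>g. b g + b' g)"
      unfolding b cochain_group2_def mult_product_group
      by (rule restrict_ext) auto
    then show "a \<otimes>\<^bsub>cochain_group2 G\<^esub> a' \<in> coboundaries2 G"
      unfolding coboundaries2_def by (rule image_eqI[where x = "\<lambda>g. b g + b' g"]) simp
  qed
  then show ?thesis
    by (rule group.subgroup_incl[OF grp _ subgroup_cocycles2[OF G] coboundaries2_subset[OF G]])
qed

lemma comm_group_cohomology2: "group G \<Longrightarrow> comm_group (cohomology2 G)"
  unfolding cohomology2_def
  by (rule comm_group.abelian_FactGroup[OF comm_group_cocycle_group2 subgroup_coboundaries2])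

lemma subgroup_cycles2:
  "subgroup (cycles2 G) (free_Abelian_group (carrier G \<times> carrier G))"
proof (rule group.subgroupI[OF group_free_Abelian_group])
  have "0 \<in> cycles2 G" by (simp add: cycles2_def)
  then show "cycles2 G \<noteq> {}" by blast
qed (auto simp: cycles2_def frag_extend_minus frag_extend_add dest: subsetD[OF keys_add])

lemma comm_group_cycle_group2:
  "comm_group ((free_Abelian_group (carrier G \<times> carrier G))\<lparr>carrier := cycles2 G\<rparr>)"
  by (rule comm_group_subgroup[OF abelian_free_Abelian_group subgroup_cycles2])

lemma bar_d3_in_cycles2:
  assumes "group G" "g \<in> carrier G" "h \<in> carrier G" "k \<in> carrier G"
  shows "bar_d3 G (g, h, k) \<in> cycles2 G"
proof -
  interpret group G by fact
  have "frag_extend (bar_d2 G) (bar_d3 G (g, h, k)) = 0"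
    using assms by (simp add: bar_d3_def bar_d2_def frag_extend_add frag_extend_diff m_assoc)
  moreover have "bar_d3 G (g, h, k) \<in> carrier (free_Abelian_group (carrier G \<times> carrier G))"
  proof -
    let ?F = "{c. Poly_Mapping.keys c \<subseteq> carrier G \<times> carrier G} :: (('a \<times> 'a) \<Rightarrow>\<^sub>0 int) set"
    have add: "x + y \<in> ?F" and diff: "x - y \<in> ?F" if "x \<in> ?F" "y \<in> ?F" for x y
      using that keys_add[of x y] keys_diff[of x y] by auto
    have "bar_d3 G (g, h, k) \<in> ?F"
      unfolding bar_d3_def prod.case by (intro add diff) (use assms in auto)
    then show ?thesis by simp
  qed
  ultimately show ?thesis by (simp add: cycles2_def)
qed

lemma boundaries2_subset:
  assumes "group G"
  shows "boundaries2 G \<subseteq> cycles2 G"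
proof -
  have "frag_extend (bar_d3 G) c \<in> cycles2 G"
    if "Poly_Mapping.keys c \<subseteq> carrier G \<times> carrier G \<times> carrier G" for c
    using that
  proof (induction c rule: frag_induction)
    case zero
    then show ?case by (simp add: cycles2_def)
  next
    case (one x)
    then show ?case using bar_d3_in_cycles2[OF assms] by (cases x) auto
  next
    case (diff a b)
    then show ?case
      by (auto simp: cycles2_def frag_extend_diff dest: subsetD[OF keys_diff])
  qed
  then show ?thesis by (auto simp: boundaries2_def)
qed

lemma subgroup_boundaries2:
  assumes "group G"
  shows "subgroup (boundaries2 G) ((free_Abelian_group (carrier G \<times> carrier G))\<lparr>carrier := cycles2 G\<rparr>)"
proof (rule group.subgroup_incl[OF group_free_Abelian_group _ subgroup_cycles2 boundaries2_subset[OF assms]])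
  let ?F = "carrier (free_Abelian_group (carrier G \<times> carrier G \<times> carrier G))"
  show "subgroup (boundaries2 G) (free_Abelian_group (carrier G \<times> carrier G))"
  proof (rule group.subgroupI[OF group_free_Abelian_group])
    show sub: "boundaries2 G \<subseteq> carrier (free_Abelian_group (carrier G \<times> carrier G))"
      using boundaries2_subset[OF assms] by (auto simp: cycles2_def)
    have "0 \<in> ?F" by simp
    then show "boundaries2 G \<noteq> {}" unfolding boundaries2_def by blast
    fix a assume a: "a \<in> boundaries2 G"
    then obtain c where c: "c \<in> ?F" "a = frag_extend (bar_d3 G) c"
      by (auto simp: boundaries2_def)
    have "- c \<in> ?F" "- a = frag_extend (bar_d3 G) (- c)"
      using c by (auto simp: frag_extend_minus)
    then have "- a \<in> boundaries2 G" unfolding boundaries2_def by blast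
    moreover have "inv\<^bsub>free_Abelian_group (carrier G \<times> carrier G)\<^esub> a = - a"
      using a sub by auto
    ultimately show "inv\<^bsub>free_Abelian_group (carrier G \<times> carrier G)\<^esub> a \<in> boundaries2 G" by simp
    fix b assume "b \<in> boundaries2 G"
    then obtain d where d: "d \<in> ?F" "b = frag_extend (bar_d3 G) d"
      by (auto simp: boundaries2_def)
    have "c + d \<in> ?F" using c d keys_add[of c d] by auto
    moreover have "a + b = frag_extend (bar_d3 G) (c + d)"
      using c d by (simp add: frag_extend_add)
    ultimately show "a \<otimes>\<^bsub>free_Abelian_group (carrier G \<times> carrier G)\<^esub> b \<in> boundaries2 G"
      unfolding boundaries2_def by auto
  qed
qed

lemma comm_group_homology2: "group G \<Longrightarrow> comm_group (homology2 G)"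
  unfolding homology2_def
  by (rule comm_group.abelian_FactGroup[OF comm_group_cycle_group2 subgroup_boundaries2])

lemma cochain_eval_boundary:
  assumes s: "s \<in> cocycles2 G" and b: "b \<in> boundaries2 G"
  shows "cochain_eval s b = 0"
proof -
  have "cochain_eval s (frag_extend (bar_d3 G) c) = 0"
    if "Poly_Mapping.keys c \<subseteq> carrier G \<times> carrier G \<times> carrier G" for c
    using that
  proof (induction c rule: frag_induction)
    case (one x)
    then show ?case using s
      by (cases x) (auto simp: cocycles2_def bar_d3_def cochain_eval_add cochain_eval_diff)
  qed (auto simp: frag_extend_diff cochain_eval_diff)
  with b show ?thesis by (auto simp: boundaries2_def)
qed

lemma cochain_eval_coboundary:
  assumes s: "s \<in> coboundaries2 G" and z: "z \<in> cycles2 G"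
  shows "cochain_eval s z = 0"
proof -
  obtain b where b: "s = (\<lambda>(g, h)\<in>carrier G \<times> carrier G. b h - b (g \<otimes>\<^bsub>G\<^esub> h) + b g)"
    using s by (auto simp: coboundaries2_def)
  have "cochain_eval s c = cochain_eval b (frag_extend (bar_d2 G) c)"
    if "Poly_Mapping.keys c \<subseteq> carrier G \<times> carrier G" for c
    using that
  proof (induction c rule: frag_induction)
    case (one x)
    then show ?case
      by (cases x) (auto simp: b bar_d2_def cochain_eval_add cochain_eval_diff)
  qed (auto simp: frag_extend_diff cochain_eval_diff)
  with z show ?thesis by (simp add: cycles2_def)
qed

lemma kronecker_map_coset:
  assumes G: "group G" and x: "x \<in> carrier (cohomology2 G)" and c: "c \<in> carrier (homology2 G)"
    and s: "s \<in> x" and z: "z \<in> c"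
  shows "kronecker_map G x c = cochain_eval s z"
proof -
  obtain s0 where s0: "s0 \<in> cocycles2 G" "x = coboundaries2 G #>\<^bsub>cochain_group2 G\<^esub> s0"
    using x by (auto simp: cohomology2_def FactGroup_def RCOSETS_def r_coset_def)
  obtain z0 where z0: "z0 \<in> cycles2 G"
      "c = boundaries2 G #>\<^bsub>free_Abelian_group (carrier G \<times> carrier G)\<^esub> z0"
    using c by (auto simp: homology2_def FactGroup_def RCOSETS_def r_coset_def)
  have *: "cochain_eval s' z' = cochain_eval s0 z0" if s': "s' \<in> x" and z': "z' \<in> c" for s' z'
  proof -
    obtain d where d: "d \<in> coboundaries2 G" "s' = d \<otimes>\<^bsub>cochain_group2 G\<^esub> s0"
      using s' s0 by (auto simp: r_coset_def)
    obtain b where b: "b \<in> boundaries2 G" "z' = b + z0"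
      using z' z0 by (auto simp: r_coset_def)
    have bc: "b \<in> cycles2 G" using boundaries2_subset[OF G] b by auto
    have z'c: "z' \<in> cycles2 G"
      using b bc z0 keys_add[of b z0] by (auto simp: cycles2_def frag_extend_add)
    have "cochain_eval s' z' = (\<Sum>p\<in>Poly_Mapping.keys z'. Poly_Mapping.lookup z' p * (d p + s0 p))"
      unfolding cochain_eval_def
      by (rule sum.cong) (use z'c in \<open>auto simp: d cochain_group2_def cycles2_def\<close>)
    also have "\<dots> = cochain_eval d z' + cochain_eval s0 z'"
      by (simp add: cochain_eval_def distrib_left sum.distrib)
    also have "\<dots> = cochain_eval s0 z0"
      using cochain_eval_coboundary[OF d(1) z'c] cochain_eval_boundary[OF s0(1) b(1)]
      by (simp add: b cochain_eval_add)
    finally show ?thesis .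
  qed
  have "(THE k. \<exists>s\<in>x. \<exists>z\<in>c. k = cochain_eval s z) = cochain_eval s z"
    by (rule the_equality) (use s z * in auto)
  with c show ?thesis by (simp add: kronecker_map_def)
qed


section \<open>Central extensions by the integers\<close>

text \<open>
  Choosing a section identifies the underlying set of any such extension of \<open>G\<close> with
  \<open>carrier G \<times> UNIV\<close>, so for \<open>G :: 'a monoid\<close> every extension has an isomorphic copy of type
  \<open>('a \<times> int) monoid\<close>.
\<close>

definition central_extension ::
    "('a, 'm) monoid_scheme \<Rightarrow> ('e, 'n) monoid_scheme \<Rightarrow> (int \<Rightarrow> 'e) \<Rightarrow> ('e \<Rightarrow> 'a) \<Rightarrow> bool" where
  "central_extension G E i q \<longleftrightarrow>
     group G \<and> group E \<and> i \<in> mon integer_group E \<and> q \<in> epi E G \<and> kernel E G q = range i \<and>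
     (\<forall>n. \<forall>e\<in>carrier E. i n \<otimes>\<^bsub>E\<^esub> e = e \<otimes>\<^bsub>E\<^esub> i n)"

definition set_section ::
    "('a, 'm) monoid_scheme \<Rightarrow> ('e, 'n) monoid_scheme \<Rightarrow> ('e \<Rightarrow> 'a) \<Rightarrow> ('a \<Rightarrow> 'e) \<Rightarrow> bool" where
  "set_section G E q t \<longleftrightarrow> (\<forall>g\<in>carrier G. t g \<in> carrier E \<and> q (t g) = g)"

definition extension_cocycle ::
    "('a, 'm) monoid_scheme \<Rightarrow> ('e, 'n) monoid_scheme \<Rightarrow> (int \<Rightarrow> 'e) \<Rightarrow> ('a \<Rightarrow> 'e) \<Rightarrow> 'a \<times> 'a \<Rightarrow> int" where
  "extension_cocycle G E i t =
     (\<lambda>(g, h)\<in>carrier G \<times> carrier G.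
        the_inv i (t g \<otimes>\<^bsub>E\<^esub> t h \<otimes>\<^bsub>E\<^esub> inv\<^bsub>E\<^esub> (t (g \<otimes>\<^bsub>G\<^esub> h))))"

text \<open>
  For a central extension, quantifying over all sections is not vacuous, since \<open>q\<close> is onto. Elements of \<open>cohomology2 G\<close> are
  sets of cocycles, so membership says that the cocycle represents the class.
\<close>

definition extension_represents ::
    "('a, 'm) monoid_scheme \<Rightarrow> ('e, 'n) monoid_scheme \<Rightarrow> (int \<Rightarrow> 'e) \<Rightarrow> ('e \<Rightarrow> 'a) \<Rightarrow>
     ('a \<times> 'a \<Rightarrow> int) set \<Rightarrow> bool" where
  "extension_represents G E i q x \<longleftrightarrow>
     (\<forall>t. set_section G E q t \<longrightarrow> extension_cocycle G E i t \<in> x)"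


section \<open>Matricial stability\<close>

definition l2_norm_vec :: "complex vec \<Rightarrow> real" where
  "l2_norm_vec v = sqrt (\<Sum>j<dim_vec v. (cmod (v $ j))\<^sup>2)"

definition op_norm_mat :: "complex mat \<Rightarrow> real" where
  "op_norm_mat A = (SUP v\<in>{v \<in> carrier_vec (dim_col A). l2_norm_vec v \<le> 1}. l2_norm_vec (A *\<^sub>v v))"

definition unitary_group :: "nat \<Rightarrow> complex mat monoid" where
  "unitary_group k =
     \<lparr>carrier = {A \<in> carrier_mat k k. mat_adjoint A * A = 1\<^sub>m k \<and> A * mat_adjoint A = 1\<^sub>m k},
      monoid.mult = (*), one = 1\<^sub>m k\<rparr>"

text \<open>
  Countability of the group is a standing assumption on the groups this is applied to (it is
  automatic for virtually polycyclic groups) rather than part of the condition.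
\<close>

definition matricially_stable :: "('a, 'm) monoid_scheme \<Rightarrow> bool" where
  "matricially_stable G \<longleftrightarrow>
     (\<forall>(k :: nat \<Rightarrow> nat) (r :: nat \<Rightarrow> 'a \<Rightarrow> complex mat).
        (\<forall>n. k n \<ge> 1) \<longrightarrow>
        (\<forall>n. r n \<in> carrier G \<rightarrow> carrier (unitary_group (k n))) \<longrightarrow>
        (\<forall>g\<in>carrier G. \<forall>h\<in>carrier G.
           (\<lambda>n. op_norm_mat (r n (g \<otimes>\<^bsub>G\<^esub> h) - r n g * r n h)) \<longlonglongrightarrow> 0) \<longrightarrow>
        (\<exists>r' :: nat \<Rightarrow> 'a \<Rightarrow> complex mat.
           (\<forall>n. r' n \<in> hom G (unitary_group (k n))) \<and>
           (\<forall>g\<in>carrier G. (\<lambda>n. op_norm_mat (r n g - r' n g)) \<longlonglongrightarrow> 0)))"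

end

(*
  Realise a non-torsion class by a cocycle s and let E be the extension G x Z twisted by s.

  Since G is finitely generated, a cocycle annihilating every 2-cycle extends rationally, with
  bounded denominators, to a cobounding 1-cochain and is torsion; so s pairs nontrivially with
  some cycle z.

  A finite index subgroup of E is polycyclic. In a polycyclic group K the subgroup generated by the
  n-th powers has finite index, is characteristic, and lies in any given finite index subgroup for a
  suitable n. As it is characteristic, these subgroups have trivial intersection by induction along
  the polycyclic series, which separates the central copy of Z.

  If k is the least positive integer whose image in E lies in such a subgroup N, the character of
  Z N sending 1 to exp(2 pi i / k) and N to 1 induces a unitary representation of E in which 1 acts
  as the scalar exp(2 pi i / k). Composing with the section of E -> G gives maps that are
  asymptotically multiplicative as k grows. If they were close to representations R, then
  b(g) = tr log (r(g) R(g)^-1) would satisfy b(g) + b(h) - b(gh) = 2 pi i d s(g, h) / k with d the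
  dimension. Evaluating on z gives 0 on the left and a nonzero number on the right.
*)
theory Submission
  imports "HOL-Analysis.Further_Topology" Defs
begin

text \<open>The dimension \<open>d n\<close> of the induced representation is a number of cosets
  over which the proof has no control. An approximate identity between traces, with an error
  multiplied by the dimension, would therefore be of no use: the relation between the numbers
  \<open>b g\<close> has to be exact. It is exact because both sides are endpoints of continuous
  logarithms of the same determinants. The only smallness required is that certain matrices have
  operator norm at most 1/4, a condition that does not involve the dimension. The cycle
  \<open>z\<close> has finite support, so closeness is required only at finitely many group
  elements. One sufficiently large \<open>n\<close> satisfies all these requirements, and the
  contradiction is reached at this single \<open>n\<close>: the factor
  \<open>d n * 2 pi i / k n\<close> may be arbitrarily small, but it is not zero. On the side of the
  group, centrality of the copy of the integers makes its product with a subgroup N a subgroup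
  again, and the choice of k as a least exponent makes the character on this product well
  defined.\<close>

no_notation Finite_Cartesian_Product.vec_nth (infixl \<open>$\<close> 90)

section \<open>Operator bounds\<close>

lemma l2_norm_vec_L2_set: "l2_norm_vec v = L2_set (\<lambda>j. cmod (v $ j)) {..<dim_vec v}"
  by (simp add: l2_norm_vec_def L2_set_def)

lemma l2_norm_vec_nonneg [simp]: "0 \<le> l2_norm_vec v"
  by (simp add: l2_norm_vec_L2_set)

lemma l2_norm_vec_add_le:
  assumes "v \<in> carrier_vec d" "w \<in> carrier_vec d"
  shows "l2_norm_vec (v + w) \<le> l2_norm_vec v + l2_norm_vec w"
proof -
  have "L2_set (\<lambda>j. cmod ((v + w) $ j)) {..<d} \<le> L2_set (\<lambda>j. cmod (v $ j) + cmod (w $ j)) {..<d}"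
    using assms by (intro L2_set_mono) (auto simp: norm_triangle_ineq)
  also have "\<dots> \<le> L2_set (\<lambda>j. cmod (v $ j)) {..<d} + L2_set (\<lambda>j. cmod (w $ j)) {..<d}"
    by (rule L2_set_triangle_ineq)
  finally show ?thesis using assms by (simp add: l2_norm_vec_L2_set)
qed

lemma l2_norm_vec_smult: "l2_norm_vec (c \<cdot>\<^sub>v v) = cmod c * l2_norm_vec v"
proof -
  have "L2_set (\<lambda>j. cmod ((c \<cdot>\<^sub>v v) $ j)) {..<dim_vec v} = L2_set (\<lambda>j. cmod c * cmod (v $ j)) {..<dim_vec v}"
    by (rule L2_set_cong) (auto simp: norm_mult)
  then show ?thesis by (simp add: l2_norm_vec_L2_set L2_set_right_distrib)
qed

lemma l2_norm_vec_eq_0_iff: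
  assumes "v \<in> carrier_vec d"
  shows "l2_norm_vec v = 0 \<longleftrightarrow> v = 0\<^sub>v d"
  using assms by (auto simp: l2_norm_vec_L2_set L2_set_eq_0_iff)

text \<open>A predicate on upper bounds in place of the norm itself: bounds add and multiply
  directly, while the supremum in \<open>op_norm_mat\<close> would ask for boundedness at each step.
  The index \<open>d\<close> also records the size of the matrix.\<close>

definition op_bound :: "nat \<Rightarrow> real \<Rightarrow> complex mat \<Rightarrow> bool" where
  "op_bound d c A \<longleftrightarrow> A \<in> carrier_mat d d \<and>
     (\<forall>v\<in>carrier_vec d. l2_norm_vec (A *\<^sub>v v) \<le> c * l2_norm_vec v)"

lemma op_boundD:
  "op_bound d c A \<Longrightarrow> A \<in> carrier_mat d d"
  "op_bound d c A \<Longrightarrow> v \<in> carrier_vec d \<Longrightarrow> l2_norm_vec (A *\<^sub>v v) \<le> c * l2_norm_vec v"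
  by (auto simp: op_bound_def)

lemma op_bound_mono: "op_bound d a A \<Longrightarrow> a \<le> b \<Longrightarrow> op_bound d b A"
  unfolding op_bound_def by (meson l2_norm_vec_nonneg mult_right_mono order_trans)

lemma op_bound_add:
  assumes "op_bound d a A" "op_bound d b B"
  shows "op_bound d (a + b) (A + B)"
  unfolding op_bound_def
proof safe
  show "A + B \<in> carrier_mat d d" using op_boundD(1)[OF assms(1)] op_boundD(1)[OF assms(2)] by simp
  fix v :: "complex vec" assume v: "v \<in> carrier_vec d"
  have "(A + B) *\<^sub>v v = A *\<^sub>v v + B *\<^sub>v v"
    using op_boundD(1)[OF assms(1)] op_boundD(1)[OF assms(2)] v by (rule add_mult_distrib_mat_vec)
  then have "l2_norm_vec ((A + B) *\<^sub>v v) \<le> l2_norm_vec (A *\<^sub>v v) + l2_norm_vec (B *\<^sub>v v)"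
    using l2_norm_vec_add_le[of "A *\<^sub>v v" d "B *\<^sub>v v"] op_boundD(1)[OF assms(1)] op_boundD(1)[OF assms(2)] v
    by simp
  also have "\<dots> \<le> a * l2_norm_vec v + b * l2_norm_vec v"
    using op_boundD(2)[OF assms(1) v] op_boundD(2)[OF assms(2) v] by simp
  finally show "l2_norm_vec ((A + B) *\<^sub>v v) \<le> (a + b) * l2_norm_vec v" by (simp add: distrib_right)
qed

lemma op_bound_mult:
  assumes "op_bound d a A" "op_bound d b B" "0 \<le> a"
  shows "op_bound d (a * b) (A * B)"
  unfolding op_bound_def
proof safe
  note AB = op_boundD(1)[OF assms(1)] op_boundD(1)[OF assms(2)]
  show "A * B \<in> carrier_mat d d" using AB by simp
  fix v :: "complex vec" assume v: "v \<in> carrier_vec d"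
  have "l2_norm_vec ((A * B) *\<^sub>v v) = l2_norm_vec (A *\<^sub>v (B *\<^sub>v v))"
    using AB v by (simp add: assoc_mult_mat_vec[of _ d d _ d])
  also have "\<dots> \<le> a * l2_norm_vec (B *\<^sub>v v)"
    using AB v by (intro op_boundD(2)[OF assms(1)]) simp
  also have "\<dots> \<le> a * (b * l2_norm_vec v)"
    using op_boundD(2)[OF assms(2) v] assms(3) by (rule mult_left_mono)
  finally show "l2_norm_vec ((A * B) *\<^sub>v v) \<le> a * b * l2_norm_vec v" by (simp add: mult.assoc)
qed

lemma op_bound_smult:
  assumes "op_bound d a A"
  shows "op_bound d (cmod c * a) (c \<cdot>\<^sub>m A)"
  unfolding op_bound_def
proof safe
  note A = op_boundD(1)[OF assms(1)]
  show "c \<cdot>\<^sub>m A \<in> carrier_mat d d" using A by simp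
  fix v :: "complex vec" assume v: "v \<in> carrier_vec d"
  have "(c \<cdot>\<^sub>m A) *\<^sub>v v = c \<cdot>\<^sub>v (A *\<^sub>v v)"
    using A v by (auto intro!: eq_vecI)
  then show "l2_norm_vec ((c \<cdot>\<^sub>m A) *\<^sub>v v) \<le> cmod c * a * l2_norm_vec v"
    using op_boundD(2)[OF assms v] by (simp add: l2_norm_vec_smult mult.assoc mult_left_mono)
qed

lemma op_bound_one: "op_bound d 1 (1\<^sub>m d)"
  by (auto simp: op_bound_def)

text \<open>The sum of the moduli of all entries is a crude bound, but any finite one shows that the
  supremum in \<open>op_norm_mat\<close> is taken over a bounded set.\<close>

lemma op_bound_exists:
  assumes A: "A \<in> carrier_mat d d"
  obtains c where "0 \<le> c" "op_bound d c A"
proof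
  let ?c = "\<Sum>i<d. \<Sum>j<d. cmod (A $$ (i,j))"
  show "0 \<le> ?c" by (intro sum_nonneg) auto
  have "l2_norm_vec (A *\<^sub>v v) \<le> ?c * l2_norm_vec v" if v: "v \<in> carrier_vec d" for v
  proof -
    have vj: "cmod (v $ j) \<le> l2_norm_vec v" if "j < d" for j
      using member_le_L2_set[of "{..<d}" j "\<lambda>j. cmod (v $ j)"] that v by (simp add: l2_norm_vec_L2_set)
    have "l2_norm_vec (A *\<^sub>v v) \<le> (\<Sum>i<d. cmod ((A *\<^sub>v v) $ i))"
      using A L2_set_le_sum[of "{..<d}" "\<lambda>i. cmod ((A *\<^sub>v v) $ i)"] by (simp add: l2_norm_vec_L2_set)
    also have "\<dots> \<le> (\<Sum>i<d. (\<Sum>j<d. cmod (A $$ (i,j))) * l2_norm_vec v)"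
    proof (rule sum_mono)
      fix i assume i: "i \<in> {..<d}"
      have "(A *\<^sub>v v) $ i = (\<Sum>j<d. A $$ (i,j) * v $ j)"
        using i A v by (simp add: scalar_prod_def lessThan_atLeast0)
      also have "cmod \<dots> \<le> (\<Sum>j<d. cmod (A $$ (i,j)) * cmod (v $ j))"
        by (rule order_trans[OF norm_sum]) (simp add: norm_mult)
      also have "\<dots> \<le> (\<Sum>j<d. cmod (A $$ (i,j)) * l2_norm_vec v)"
        by (intro sum_mono mult_left_mono vj) auto
      finally show "cmod ((A *\<^sub>v v) $ i) \<le> (\<Sum>j<d. cmod (A $$ (i,j))) * l2_norm_vec v"
        by (simp add: sum_distrib_right)
    qed
    finally show ?thesis by (simp add: sum_distrib_right)
  qed
  with A show "op_bound d ?c A" by (simp add: op_bound_def)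
qed

lemma op_norm_mat_le:
  assumes "op_bound d c A" "0 \<le> c"
  shows "op_norm_mat A \<le> c"
  unfolding op_norm_mat_def
proof (rule cSUP_least)
  have A: "A \<in> carrier_mat d d" using assms(1) by (rule op_boundD)
  have "0\<^sub>v (dim_col A) \<in> {v \<in> carrier_vec (dim_col A). l2_norm_vec v \<le> 1}"
    by (simp add: l2_norm_vec_def)
  then show "{v \<in> carrier_vec (dim_col A). l2_norm_vec v \<le> 1} \<noteq> {}" by blast
  fix v assume "v \<in> {v \<in> carrier_vec (dim_col A). l2_norm_vec v \<le> 1}"
  then have v: "v \<in> carrier_vec d" "l2_norm_vec v \<le> 1" using A by auto
  show "l2_norm_vec (A *\<^sub>v v) \<le> c"
    using op_boundD(2)[OF assms(1) v(1)] mult_left_mono[OF v(2) assms(2)] by simp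
qed

lemma l2_norm_vec_le_op_norm_mat:
  assumes A: "A \<in> carrier_mat d d" and v: "v \<in> carrier_vec d" "l2_norm_vec v \<le> 1"
  shows "l2_norm_vec (A *\<^sub>v v) \<le> op_norm_mat A"
  unfolding op_norm_mat_def
proof (rule cSUP_upper)
  show "v \<in> {v \<in> carrier_vec (dim_col A). l2_norm_vec v \<le> 1}" using A v by simp
  obtain c where c: "0 \<le> c" "op_bound d c A" using op_bound_exists[OF A] .
  show "bdd_above ((\<lambda>v. l2_norm_vec (A *\<^sub>v v)) ` {v \<in> carrier_vec (dim_col A). l2_norm_vec v \<le> 1})"
  proof (rule bdd_aboveI2)
    fix u assume "u \<in> {v \<in> carrier_vec (dim_col A). l2_norm_vec v \<le> 1}"
    then have u: "u \<in> carrier_vec d" "l2_norm_vec u \<le> 1" using A by auto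
    show "l2_norm_vec (A *\<^sub>v u) \<le> c"
      using op_boundD(2)[OF c(2) u(1)] mult_left_mono[OF u(2) c(1)] by simp
  qed
qed

lemma op_norm_mat_nonneg:
  assumes "A \<in> carrier_mat d d"
  shows "0 \<le> op_norm_mat A"
proof (rule order_trans[OF l2_norm_vec_nonneg l2_norm_vec_le_op_norm_mat[OF assms]])
  show "0\<^sub>v d \<in> carrier_vec d" "l2_norm_vec (0\<^sub>v d) \<le> 1"
    by (simp_all add: l2_norm_vec_def)
qed

text \<open>The supremum sees only the unit ball; normalising a nonzero vector carries its bound to
  all vectors.\<close>

lemma op_bound_op_norm_mat:
  assumes A: "A \<in> carrier_mat d d"
  shows "op_bound d (op_norm_mat A) A"
  unfolding op_bound_def
proof safe
  show "A \<in> carrier_mat d d" by fact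
  fix v :: "complex vec" assume v: "v \<in> carrier_vec d"
  show "l2_norm_vec (A *\<^sub>v v) \<le> op_norm_mat A * l2_norm_vec v"
  proof (cases "l2_norm_vec v = 0")
    case True
    then have "v = 0\<^sub>v d" using v l2_norm_vec_eq_0_iff by blast
    then have "A *\<^sub>v v = 0\<^sub>v d" using A by auto
    then show ?thesis using True by (simp add: l2_norm_vec_def)
  next
    case False
    define r where "r = l2_norm_vec v"
    have r: "r > 0" using False l2_norm_vec_nonneg[of v] unfolding r_def by linarith
    let ?u = "complex_of_real (1 / r) \<cdot>\<^sub>v v"
    have "l2_norm_vec (A *\<^sub>v ?u) \<le> op_norm_mat A"
    proof (rule l2_norm_vec_le_op_norm_mat[OF A])
      show "?u \<in> carrier_vec d" using v by simp
      show "l2_norm_vec ?u \<le> 1" using r by (simp add: l2_norm_vec_smult norm_divide flip: r_def)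
    qed
    moreover have "l2_norm_vec (A *\<^sub>v ?u) = l2_norm_vec (A *\<^sub>v v) / r"
      using A v r by (simp add: mult_mat_vec[OF A v] l2_norm_vec_smult norm_divide)
    ultimately have "l2_norm_vec (A *\<^sub>v v) / r \<le> op_norm_mat A" by simp
    then show ?thesis using r by (simp add: pos_divide_le_eq flip: r_def)
  qed
qed

section \<open>Adjoints and unitary matrices\<close>

lemma mat_adjoint_carrier [simp]: "A \<in> carrier_mat m n \<Longrightarrow> mat_adjoint A \<in> carrier_mat n m"
  by (auto simp: mat_adjoint_def)

lemma mat_adjoint_index:
  assumes "A \<in> carrier_mat m n" "i < n" "j < m"
  shows "mat_adjoint A $$ (i, j) = conjugate (A $$ (j, i))"
  using assms by (simp add: mat_adjoint_def mat_of_rows_def)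

lemma unitary_groupD:
  assumes "U \<in> carrier (unitary_group d)"
  shows "U \<in> carrier_mat d d" "mat_adjoint U * U = 1\<^sub>m d" "U * mat_adjoint U = 1\<^sub>m d"
  using assms by (auto simp: unitary_group_def)

text \<open>Expanding the squared norm of \<open>U *\<^sub>v v\<close> in entries and summing over
  the row index first produces the entries of \<open>mat_adjoint U * U\<close>, which are those of
  the identity.\<close>

lemma l2_norm_vec_unitary:
  assumes "U \<in> carrier_mat d d" "mat_adjoint U * U = 1\<^sub>m d" and v: "v \<in> carrier_vec d"
  shows "l2_norm_vec (U *\<^sub>v v) = l2_norm_vec v"
proof -
  have sq: "complex_of_real (\<Sum>j<dim_vec w. (cmod (w $ j))\<^sup>2) = (\<Sum>j<dim_vec w. w $ j * cnj (w $ j))" for w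
    unfolding of_real_sum by (rule sum.cong[OF refl]) (rule complex_norm_square)
  have "(\<Sum>i<d. (U *\<^sub>v v) $ i * cnj ((U *\<^sub>v v) $ i))
      = (\<Sum>i<d. \<Sum>j<d. \<Sum>k<d. cnj (U $$ (i,j)) * U $$ (i,k) * (v $ k * cnj (v $ j)))"
  proof (rule sum.cong[OF refl])
    fix i assume i: "i \<in> {..<d}"
    have Uv: "(U *\<^sub>v v) $ i = (\<Sum>k<d. U $$ (i,k) * v $ k)"
      using i assms by (simp add: scalar_prod_def lessThan_atLeast0)
    have "(U *\<^sub>v v) $ i * cnj ((U *\<^sub>v v) $ i)
        = (\<Sum>k<d. \<Sum>j<d. U $$ (i,k) * v $ k * cnj (U $$ (i,j) * v $ j))"
      unfolding Uv cnj_sum by (rule sum_product)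
    also have "\<dots> = (\<Sum>j<d. \<Sum>k<d. U $$ (i,k) * v $ k * cnj (U $$ (i,j) * v $ j))"
      by (rule sum.swap)
    finally show "(U *\<^sub>v v) $ i * cnj ((U *\<^sub>v v) $ i)
      = (\<Sum>j<d. \<Sum>k<d. cnj (U $$ (i,j)) * U $$ (i,k) * (v $ k * cnj (v $ j)))"
      by (simp add: mult_ac)
  qed
  also have "\<dots> = (\<Sum>j<d. \<Sum>k<d. \<Sum>i<d. cnj (U $$ (i,j)) * U $$ (i,k) * (v $ k * cnj (v $ j)))"
    by (subst sum.swap, rule sum.cong[OF refl], rule sum.swap)
  also have "\<dots> = (\<Sum>j<d. \<Sum>k<d. (mat_adjoint U * U) $$ (j,k) * (v $ k * cnj (v $ j)))"
  proof (intro sum.cong refl)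
    fix j k assume "j \<in> {..<d}" "k \<in> {..<d}"
    then have "(mat_adjoint U * U) $$ (j,k) = (\<Sum>i<d. cnj (U $$ (i,j)) * U $$ (i,k))"
      using assms(1) carrier_matD[OF mat_adjoint_carrier[OF assms(1)]]
      by (simp add: scalar_prod_def lessThan_atLeast0 mat_adjoint_index[of U d d])
    then show "(\<Sum>i<d. cnj (U $$ (i,j)) * U $$ (i,k) * (v $ k * cnj (v $ j)))
        = (mat_adjoint U * U) $$ (j,k) * (v $ k * cnj (v $ j))"
      by (simp add: sum_distrib_right)
  qed
  also have "\<dots> = (\<Sum>j<d. \<Sum>k<d. if k = j then v $ k * cnj (v $ j) else 0)"
    by (intro sum.cong refl) (auto simp: assms(2))
  also have "\<dots> = (\<Sum>j<d. v $ j * cnj (v $ j))"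
    by simp
  finally have "complex_of_real (\<Sum>j<d. (cmod ((U *\<^sub>v v) $ j))\<^sup>2) = complex_of_real (\<Sum>j<d. (cmod (v $ j))\<^sup>2)"
    using sq[of "U *\<^sub>v v"] sq[of v] assms(1) v by simp
  then have "(\<Sum>j<d. (cmod ((U *\<^sub>v v) $ j))\<^sup>2) = (\<Sum>j<d. (cmod (v $ j))\<^sup>2)"
    using of_real_eq_iff by blast
  then show ?thesis using assms(1) v by (simp add: l2_norm_vec_def)
qed

lemma op_bound_unitary: "U \<in> carrier (unitary_group d) \<Longrightarrow> op_bound d 1 U"
  using unitary_groupD(1,2)[of U d] l2_norm_vec_unitary[of U d] by (simp add: op_bound_def)

lemma mat_adjoint_mat_adjoint: "A \<in> carrier_mat m n \<Longrightarrow> mat_adjoint (mat_adjoint A) = (A :: complex mat)"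
  by (rule eq_matI) (auto simp: mat_adjoint_index[of _ m n] mat_adjoint_index[of _ n m] dest: carrier_matD mat_adjoint_carrier)

lemma mat_adjoint_unitary:
  assumes "U \<in> carrier (unitary_group d)"
  shows "mat_adjoint U \<in> carrier (unitary_group d)"
  using unitary_groupD[OF assms] by (simp add: unitary_group_def mat_adjoint_mat_adjoint[of _ d d])

section \<open>The trace of the logarithm near the identity\<close>

text \<open>
  \<open>det_log d M z\<close> encodes \<open>z = tr (log (1 + M))\<close> without functional calculus, as the endpoint of a
  continuous logarithm of the determinant along the segment from \<open>1\<close> to \<open>1 + M\<close>.
\<close>

definition det_log :: "nat \<Rightarrow> complex mat \<Rightarrow> complex \<Rightarrow> bool" where
  "det_log d M z \<longleftrightarrow> (\<exists>h. continuous_on {0..1::real} h \<and> h 0 = 0 \<and> h 1 = z \<and>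
     (\<forall>t\<in>{0..1}. exp (h t) = det (1\<^sub>m d + complex_of_real t \<cdot>\<^sub>m M)))"

lemma zero_smult_mat: "A \<in> carrier_mat m n \<Longrightarrow> (0 :: complex) \<cdot>\<^sub>m A = 0\<^sub>m m n"
  by (rule eq_matI) auto

lemma continuous_on_det:
  fixes A :: "'b::topological_space \<Rightarrow> complex mat"
  assumes "\<And>x. A x \<in> carrier_mat d d"
    and "\<And>i j. i < d \<Longrightarrow> j < d \<Longrightarrow> continuous_on S (\<lambda>x. A x $$ (i, j))"
  shows "continuous_on S (\<lambda>x. det (A x))"
  unfolding det_def'[OF assms(1)]
proof (intro continuous_intros)
  fix p i assume "p \<in> {p. p permutes {0..<d}}" "i \<in> {0..<d}"
  then have "i < d" "p i < d" by (auto dest: permutes_in_image)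
  then show "continuous_on S (\<lambda>x. A x $$ (i, p i))" by (rule assms(2))
qed

text \<open>A nonzero vector in the kernel of 1 + M would satisfy M v = - v, so M would preserve its
  norm.\<close>

lemma det_one_add_nonzero:
  assumes M: "op_bound d c M" and c: "c < 1"
  shows "det (1\<^sub>m d + M) \<noteq> 0"
proof
  have Mc: "M \<in> carrier_mat d d" by (rule op_boundD[OF M])
  assume "det (1\<^sub>m d + M) = 0"
  then obtain v where v: "v \<in> carrier_vec d" "v \<noteq> 0\<^sub>v d" "(1\<^sub>m d + M) *\<^sub>v v = 0\<^sub>v d"
    using det_0_iff_vec_prod_zero[of "1\<^sub>m d + M" d] Mc by auto
  have *: "(1\<^sub>m d + M) *\<^sub>v v = v + M *\<^sub>v v"
    using add_mult_distrib_mat_vec[OF one_carrier_mat Mc v(1)] v(1) by simp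
  have "M *\<^sub>v v = (-1) \<cdot>\<^sub>v v"
  proof (rule eq_vecI)
    fix i assume "i < dim_vec ((-1) \<cdot>\<^sub>v v)"
    then have i: "i < d" using v by simp
    have "(v + M *\<^sub>v v) $ i = 0" using v(3) i unfolding * by simp
    then show "(M *\<^sub>v v) $ i = ((-1) \<cdot>\<^sub>v v) $ i"
      using i v Mc by (simp add: add_eq_0_iff)
  qed (use Mc v in auto)
  then have "l2_norm_vec (M *\<^sub>v v) = l2_norm_vec v" by (simp add: l2_norm_vec_smult)
  with op_boundD(2)[OF M v(1)] have "l2_norm_vec v \<le> c * l2_norm_vec v" by simp
  moreover have "l2_norm_vec v > 0"
    using l2_norm_vec_eq_0_iff[OF v(1)] v(2) l2_norm_vec_nonneg[of v] by linarith
  ultimately show False using c by simp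
qed

text \<open>The difference of the two logarithms is continuous with values in the integer multiples
  of 2 pi i, hence constant on an interval. Distinct values are 2 pi apart; the weaker gap 1 is
  enough for the discreteness criterion.\<close>

lemma continuous_log_endpoint_unique:
  fixes h h' :: "real \<Rightarrow> complex"
  assumes "continuous_on {0..1} h" "continuous_on {0..1} h'" "h 0 = h' 0"
    and "\<And>t. t \<in> {0..1} \<Longrightarrow> exp (h t) = exp (h' t)"
  shows "h 1 = h' 1"
proof -
  have "(\<lambda>t. h t - h' t) constant_on {0..1}"
  proof (rule continuous_discrete_range_constant)
    show "connected {0..1::real}" by simp
    show "continuous_on {0..1} (\<lambda>t. h t - h' t)" by (intro continuous_intros assms)
    fix x :: real assume x: "x \<in> {0..1}"
    have "1 \<le> cmod ((h y - h' y) - (h x - h' x))"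
      if y: "y \<in> {0..1}" and ne: "h y - h' y \<noteq> h x - h' x" for y
    proof -
      have "exp ((h y - h' y) - (h x - h' x)) = 1"
        using assms(4)[OF x] assms(4)[OF y] by (simp add: exp_diff)
      then obtain n :: int where n: "Re ((h y - h' y) - (h x - h' x)) = 0"
          "Im ((h y - h' y) - (h x - h' x)) = of_int (2 * n) * pi"
        unfolding exp_eq_1 by blast
      have "n \<noteq> 0" using n ne by (auto simp: complex_eq_iff)
      then have "1 \<le> \<bar>real_of_int n\<bar>" by linarith
      then have "1 * 1 \<le> \<bar>real_of_int n\<bar> * (2 * pi)"
        using pi_gt3 by (intro mult_mono) linarith+
      also have "\<dots> = \<bar>Im ((h y - h' y) - (h x - h' x))\<bar>" unfolding n by (simp add: abs_mult)
      also have "\<dots> \<le> cmod ((h y - h' y) - (h x - h' x))" by (rule abs_Im_le_cmod)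
      finally show ?thesis by simp
    qed
    then show "\<exists>e>0. \<forall>y. y \<in> {0..1} \<and> h y - h' y \<noteq> h x - h' x \<longrightarrow> e \<le> cmod (h y - h' y - (h x - h' x))"
      by (intro exI[of _ 1]) auto
  qed
  then obtain c where c: "\<And>t. t \<in> {0..1} \<Longrightarrow> h t - h' t = c" unfolding constant_on_def by blast
  have "h 1 - h' 1 = h 0 - h' 0" using c[of 0] c[of 1] by simp
  with assms(3) show ?thesis by simp
qed

lemma det_log_unique:
  assumes "det_log d M z" "det_log d M z'"
  shows "z = z'"
proof -
  obtain h where h: "continuous_on {0..1::real} h" "h 0 = 0" "h 1 = z"
     "\<And>t. t \<in> {0..1} \<Longrightarrow> exp (h t) = det (1\<^sub>m d + complex_of_real t \<cdot>\<^sub>m M)"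
    using assms(1) unfolding det_log_def by blast
  obtain h' where h': "continuous_on {0..1::real} h'" "h' 0 = 0" "h' 1 = z'"
     "\<And>t. t \<in> {0..1} \<Longrightarrow> exp (h' t) = det (1\<^sub>m d + complex_of_real t \<cdot>\<^sub>m M)"
    using assms(2) unfolding det_log_def by blast
  show ?thesis
    using continuous_log_endpoint_unique[of h h'] h h' by simp
qed

text \<open>The segment from 1 to 1 + M consists of invertible matrices, and a nowhere vanishing
  continuous function on a contractible set lifts through \<open>exp\<close>.\<close>

lemma det_log_exists:
  assumes M: "op_bound d c M" and c: "0 \<le> c" "c < 1"
  obtains z where "det_log d M z"
proof -
  have Mc: "M \<in> carrier_mat d d" by (rule op_boundD[OF M])
  let ?F = "\<lambda>t::real. det (1\<^sub>m d + complex_of_real t \<cdot>\<^sub>m M)"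
  have cont: "continuous_on {0..1} ?F"
    using Mc by (intro continuous_on_det[where d = d]) (auto intro!: continuous_intros)
  have nz: "?F t \<noteq> 0" if "t \<in> {0..1}" for t
  proof (rule det_one_add_nonzero)
    show "op_bound d (cmod (complex_of_real t) * c) (complex_of_real t \<cdot>\<^sub>m M)"
      by (rule op_bound_smult[OF M])
    show "cmod (complex_of_real t) * c < 1"
      using that c mult_left_le_one_le[of c t] by simp
  qed
  obtain g where g: "continuous_on {0..1} g" "\<And>t. t \<in> {0..1} \<Longrightarrow> ?F t = exp (g t)"
    using continuous_logarithm_on_contractible[OF cont convex_imp_contractible nz] by auto
  have g0: "exp (g 0) = 1" using g(2)[of 0] Mc by (simp add: zero_smult_mat[of _ d d])
  \<comment> \<open>The lift starts at some logarithm of 1, not necessarily at 0; subtracting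
    \<open>g 0\<close> normalises it.\<close>
  have "det_log d M (g 1 - g 0)"
    unfolding det_log_def
    by (rule exI[of _ "\<lambda>t. g t - g 0"]) (auto intro!: continuous_intros g simp: exp_diff g0 g(2))
  then show ?thesis by (rule that)
qed

text \<open>Conjugation maps the segment of M to that of U M V, and det U det V = det (U V) = 1
  leaves every determinant on it unchanged.\<close>

lemma det_log_conj:
  assumes M: "M \<in> carrier_mat d d" and U: "U \<in> carrier_mat d d" and V: "V \<in> carrier_mat d d"
    and UV: "U * V = 1\<^sub>m d" and z: "det_log d M z"
  shows "det_log d (U * M * V) z"
proof -
  have "det (1\<^sub>m d + c \<cdot>\<^sub>m (U * M * V)) = det (1\<^sub>m d + c \<cdot>\<^sub>m M)" for c
  proof -
    have "1\<^sub>m d + c \<cdot>\<^sub>m (U * M * V) = U * (1\<^sub>m d + c \<cdot>\<^sub>m M) * V"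
    proof -
      have "U * (1\<^sub>m d + c \<cdot>\<^sub>m M) * V = (U + c \<cdot>\<^sub>m (U * M)) * V"
        using M U by (simp add: mult_add_distrib_mat[of _ d d _ d] mult_smult_distrib[of _ d d _ d])
      also have "\<dots> = 1\<^sub>m d + c \<cdot>\<^sub>m (U * M * V)"
        using M U V UV by (simp add: add_mult_distrib_mat[of _ d d _ _ d] mult_smult_assoc_mat[of _ d d _ d])
      finally show ?thesis by simp
    qed
    moreover have "det (U * (1\<^sub>m d + c \<cdot>\<^sub>m M) * V) = det (U * V) * det (1\<^sub>m d + c \<cdot>\<^sub>m M)"
      using M U V by (simp add: det_mult[of _ d])
    ultimately show ?thesis by (simp add: UV)
  qed
  with z show ?thesis unfolding det_log_def by simp
qed

text \<open>The segment from 1 to c stays in the open unit disc about 1, where the real part is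
  positive and \<open>Ln\<close> is continuous; the determinant of a scalar matrix is the d-th power
  of the scalar.\<close>

lemma det_log_scalar:
  assumes c: "cmod (c - 1) < 1"
  shows "det_log d ((c - 1) \<cdot>\<^sub>m 1\<^sub>m d) (of_nat d * Ln c)"
  unfolding det_log_def
proof (intro exI conjI ballI)
  let ?f = "\<lambda>t. 1 + complex_of_real t * (c - 1)"
  have pos: "?f t \<notin> \<real>\<^sub>\<le>\<^sub>0" if "t \<in> {0..1}" for t
  proof -
    have "\<bar>Re (complex_of_real t * (c - 1))\<bar> \<le> cmod (complex_of_real t * (c - 1))" by (rule abs_Re_le_cmod)
    also have "\<dots> \<le> cmod (c - 1)" using that by (simp add: norm_mult mult_left_le_one_le)
    finally have "Re (?f t) > 0" using c by simp
    then show ?thesis using complex_nonpos_Reals_iff by force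
  qed
  show "continuous_on {0..1} (\<lambda>t. of_nat d * Ln (?f t))"
    by (intro continuous_intros pos)
  show "of_nat d * Ln (?f 0) = 0" "of_nat d * Ln (?f 1) = of_nat d * Ln c" by simp_all
  fix t :: real assume t: "t \<in> {0..1}"
  have "?f t \<noteq> 0" using pos[OF t] by (metis nonpos_Reals_zero_I)
  moreover have "1\<^sub>m d + complex_of_real t \<cdot>\<^sub>m ((c - 1) \<cdot>\<^sub>m 1\<^sub>m d) = ?f t \<cdot>\<^sub>m 1\<^sub>m d"
    by (rule eq_matI) auto
  ultimately show "exp (of_nat d * Ln (?f t)) = det (1\<^sub>m d + complex_of_real t \<cdot>\<^sub>m ((c - 1) \<cdot>\<^sub>m 1\<^sub>m d))"
    by (simp add: exp_of_nat_mult)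
qed

lemma one_smult_mat: "(1 :: complex) \<cdot>\<^sub>m A = A"
  by (rule eq_matI) auto

text \<open>This is additivity over products, since M + (N + M N) = (1 + M)(1 + N) - 1. The unit
  square is contractible, so one logarithm \<open>g\<close> serves three sides of a triangle, and
  increments along two of them add up to the increment along the diagonal. The bounds 1/4 keep the
  perturbation of 1 on the whole square at norm at most 1/4 + 5/16 < 1.\<close>

lemma det_log_mult:
  assumes M: "op_bound d (1/4) M" and N: "op_bound d (1/4) N"
    and x: "det_log d M x" and y: "det_log d N y"
  shows "det_log d (M + (N + M * N)) (x + y)"
proof -
  have Mc: "M \<in> carrier_mat d d" and Nc: "N \<in> carrier_mat d d"
    using op_boundD(1)[OF M] op_boundD(1)[OF N] .
  let ?P = "N + M * N"
  have P: "op_bound d (1/4 + 1/4 * (1/4)) ?P"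
    by (intro op_bound_add op_bound_mult M N) auto
  have Pc: "?P \<in> carrier_mat d d" using Mc Nc by simp
  \<comment> \<open>The edges \<open>(s, 0)\<close>, \<open>(1, t)\<close> and the diagonal \<open>(t, t)\<close> of this family give \<open>M\<close>, \<open>N\<close> and \<open>M + N + M N\<close>.\<close>
  let ?A = "\<lambda>(s, t). 1\<^sub>m d + (complex_of_real s \<cdot>\<^sub>m M + complex_of_real t \<cdot>\<^sub>m ?P)"
  let ?S = "{0..1::real} \<times> {0..1::real}"
  have cont: "continuous_on ?S (\<lambda>p. det (?A p))"
    using Mc Pc by (intro continuous_on_det[where d = d]) (auto simp: case_prod_unfold intro!: continuous_intros)
  have nz: "det (?A p) \<noteq> 0" if p: "p \<in> ?S" for p
  proof -
    obtain s t where st: "p = (s, t)" "0 \<le> s" "s \<le> 1" "0 \<le> t" "t \<le> 1" using p by auto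
    have "op_bound d (cmod (complex_of_real s) * (1/4) + cmod (complex_of_real t) * (1/4 + 1/4 * (1/4)))
        (complex_of_real s \<cdot>\<^sub>m M + complex_of_real t \<cdot>\<^sub>m ?P)"
      by (intro op_bound_add[of _ _ "complex_of_real s \<cdot>\<^sub>m M"] op_bound_smult M P)
    then have "det (1\<^sub>m d + (complex_of_real s \<cdot>\<^sub>m M + complex_of_real t \<cdot>\<^sub>m ?P)) \<noteq> 0"
      by (rule det_one_add_nonzero) (use st in simp)
    then show ?thesis by (simp add: st)
  qed
  obtain g where g: "continuous_on ?S g" "\<And>p. p \<in> ?S \<Longrightarrow> det (?A p) = exp (g p)"
    using continuous_logarithm_on_contractible[OF cont convex_imp_contractible nz]
    by (auto intro: convex_Times)
  have g0: "exp (g (0, 0)) = 1"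
    using g(2)[of "(0,0)"] Mc Pc by (simp add: zero_smult_mat[of _ d d])
  have cont_path: "continuous_on {0..1} (\<lambda>t::real. g (a t, b t))"
    if "continuous_on {0..1} a" "continuous_on {0..1} b" "\<And>t. t \<in> {0..1} \<Longrightarrow> (a t, b t) \<in> ?S" for a b
    using continuous_on_compose2[OF g(1) continuous_on_Pair[OF that(1,2)]] that(3) by blast
  have "det_log d M (g (1, 0) - g (0, 0))"
    unfolding det_log_def
  proof (rule exI[of _ "\<lambda>t. g (t, 0) - g (0, 0)"], intro conjI ballI)
    show "continuous_on {0..1} (\<lambda>t. g (t, 0) - g (0, 0))"
      by (intro continuous_intros cont_path) auto
    fix t :: real assume t: "t \<in> {0..1}"
    show "exp (g (t, 0) - g (0, 0)) = det (1\<^sub>m d + complex_of_real t \<cdot>\<^sub>m M)"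
      using g(2)[of "(t, 0)"] t Mc Pc by (simp add: exp_diff g0 zero_smult_mat[of _ d d])
  qed simp_all
  then have gx: "g (1, 0) - g (0, 0) = x" using x by (rule det_log_unique)
  have "det_log d N (g (1, 1) - g (1, 0))"
    unfolding det_log_def
  proof (rule exI[of _ "\<lambda>t. g (1, t) - g (1, 0)"], intro conjI ballI)
    show "continuous_on {0..1} (\<lambda>t. g (1, t) - g (1, 0))"
      by (intro continuous_intros cont_path) auto
    fix t :: real assume t: "t \<in> {0..1}"
    let ?t = "complex_of_real t"
    \<comment> \<open>On this edge the family is a product with the fixed left factor 1 + M.
      Dividing by its determinant, the value at the start of the edge, leaves the determinant on the
      segment of N.\<close>
    have "(1\<^sub>m d + M) * (1\<^sub>m d + ?t \<cdot>\<^sub>m N) = (1\<^sub>m d + M) + (?t \<cdot>\<^sub>m N + ?t \<cdot>\<^sub>m (M * N))"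
      using Mc Nc
      by (simp add: mult_add_distrib_mat[of _ d d _ d] add_mult_distrib_mat[of _ d d _ _ d] mult_smult_distrib[of _ d d _ d]
          add_smult_distrib_left_mat[of _ d d])
    also have "\<dots> = 1\<^sub>m d + (1 \<cdot>\<^sub>m M + ?t \<cdot>\<^sub>m ?P)"
      using Mc Nc by (intro eq_matI) (auto simp: distrib_left)
    finally have "det (1\<^sub>m d + M) * det (1\<^sub>m d + ?t \<cdot>\<^sub>m N) = exp (g (1, t))"
      using g(2)[of "(1, t)"] t Mc Nc by (simp add: det_mult[of _ d, symmetric])
    moreover have "det (1\<^sub>m d + M) = exp (g (1, 0))"
      using g(2)[of "(1, 0)"] Mc Pc by (simp add: zero_smult_mat[of _ d d] one_smult_mat)
    ultimately show "exp (g (1, t) - g (1, 0)) = det (1\<^sub>m d + ?t \<cdot>\<^sub>m N)"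
      by (simp add: exp_diff field_simps)
  qed simp_all
  then have gy: "g (1, 1) - g (1, 0) = y" using y by (rule det_log_unique)
  show ?thesis
    unfolding det_log_def
  proof (rule exI[of _ "\<lambda>t. g (t, t) - g (0, 0)"], intro conjI ballI)
    show "continuous_on {0..1} (\<lambda>t. g (t, t) - g (0, 0))"
      by (intro continuous_intros cont_path) auto
    show "g (1, 1) - g (0, 0) = x + y" by (simp flip: gx gy)
    fix t :: real assume t: "t \<in> {0..1}"
    show "exp (g (t, t) - g (0, 0)) = det (1\<^sub>m d + complex_of_real t \<cdot>\<^sub>m (M + ?P))"
      using g(2)[of "(t, t)"] t Mc Pc by (simp add: exp_diff g0 add_smult_distrib_left_mat[of _ d d])
  qed simp
qed

section \<open>Logarithmic defects of an approximate representation\<close>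

lemma op_bound_unitary_quotient:
  assumes A: "A \<in> carrier (unitary_group d)" and R: "R \<in> carrier (unitary_group d)"
    and AR: "op_bound d e (A - R)" and e: "0 \<le> e"
  shows "op_bound d e (A * mat_adjoint R - 1\<^sub>m d)"
proof -
  note [simp] = unitary_groupD[OF A] unitary_groupD[OF R] mat_adjoint_carrier[OF unitary_groupD(1)[OF R]]
  have "op_bound d (e * 1) ((A - R) * mat_adjoint R)"
    by (intro op_bound_mult AR op_bound_unitary mat_adjoint_unitary R e)
  moreover have "(A - R) * mat_adjoint R = A * mat_adjoint R - 1\<^sub>m d"
    by (simp add: minus_mult_distrib_mat[of _ d d _ _ d])
  ultimately show ?thesis by simp
qed

lemma one_add_diff_mat: "A \<in> carrier_mat d d \<Longrightarrow> 1\<^sub>m d + (A - 1\<^sub>m d) = (A :: complex mat)"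
  by (rule eq_matI) auto

text \<open>Translates an equality of products near the identity into the additive shape in which
  \<open>det_log_mult\<close> is stated.\<close>

lemma add_mult_eq_of_one_add:
  fixes M N P Q :: "complex mat"
  assumes c: "M \<in> carrier_mat d d" "N \<in> carrier_mat d d" "P \<in> carrier_mat d d" "Q \<in> carrier_mat d d"
    and eq: "(1\<^sub>m d + M) * (1\<^sub>m d + N) = (1\<^sub>m d + P) * (1\<^sub>m d + Q)"
  shows "M + (N + M * N) = P + (Q + P * Q)"
proof -
  have *: "X + (Y + X * Y) = (1\<^sub>m d + X) * (1\<^sub>m d + Y) - 1\<^sub>m d"
    if "X \<in> carrier_mat d d" "Y \<in> carrier_mat d d" for X Y :: "complex mat"
  proof -
    have "(1\<^sub>m d + X) * (1\<^sub>m d + Y) = 1\<^sub>m d + X + (Y + X * Y)"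
      using that by (simp add: mult_add_distrib_mat[of _ d d _ d] add_mult_distrib_mat[of _ d d _ _ d])
    then show ?thesis using that by (intro eq_matI) auto
  qed
  show ?thesis using *[OF c(1,2)] *[OF c(3,4)] eq by simp
qed

text \<open>
  Applying \<open>det_log\<close> to the multiplicative defects of an approximating representation turns a
  projective multiplier into an additive identity; the determinant alone would only determine it
  modulo \<open>2 * pi * \<i>\<close>.
\<close>

lemma det_log_projective:
  assumes A: "A \<in> carrier (unitary_group d)" "A' \<in> carrier (unitary_group d)" "A'' \<in> carrier (unitary_group d)"
    and R: "R \<in> carrier (unitary_group d)" "R' \<in> carrier (unitary_group d)" "R * R' \<in> carrier (unitary_group d)"
    and close: "op_bound d (1/4) (A - R)" "op_bound d (1/4) (A' - R')" "op_bound d (1/4) (A'' - R * R')"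
    and AA: "A * A' = exp (\<i> * of_real \<theta>) \<cdot>\<^sub>m A''"
    and th: "\<bar>\<theta>\<bar> < pi" "cmod (exp (\<i> * of_real \<theta>) - 1) \<le> 1/4"
    and x: "det_log d (A * mat_adjoint R - 1\<^sub>m d) x"
    and y: "det_log d (A' * mat_adjoint R' - 1\<^sub>m d) y"
    and z: "det_log d (A'' * mat_adjoint (R * R') - 1\<^sub>m d) z"
  shows "x + y = of_nat d * (\<i> * of_real \<theta>) + z"
proof -
  note Ac = unitary_groupD(1)[OF A(1)] unitary_groupD(1)[OF A(2)] unitary_groupD(1)[OF A(3)]
  note Rc = unitary_groupD(1)[OF R(1)] unitary_groupD(1)[OF R(2)] unitary_groupD(1)[OF R(3)]
  note Rs = mat_adjoint_carrier[OF Rc(1)] mat_adjoint_carrier[OF Rc(2)] mat_adjoint_carrier[OF Rc(3)]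
  let ?M = "A * mat_adjoint R - 1\<^sub>m d"
  let ?N' = "A' * mat_adjoint R' - 1\<^sub>m d"
  \<comment> \<open>The second defect is conjugated by R so that the inner factors cancel: the
    product of 1 + \<open>?M\<close> and 1 + \<open>?N\<close> becomes A A' times the adjoint of R
    R'. By \<open>det_log_conj\<close> the conjugation does not change the logarithm
    \<open>y\<close>.\<close>
  let ?N = "R * ?N' * mat_adjoint R"
  let ?c = "exp (\<i> * of_real \<theta>) :: complex"
  let ?P = "(?c - 1) \<cdot>\<^sub>m 1\<^sub>m d :: complex mat"
  let ?Q = "A'' * mat_adjoint (R * R') - 1\<^sub>m d"
  have M: "op_bound d (1/4) ?M" by (rule op_bound_unitary_quotient[OF A(1) R(1) close(1)]) simp
  have N': "op_bound d (1/4) ?N'" by (rule op_bound_unitary_quotient[OF A(2) R(2) close(2)]) simp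
  have Q: "op_bound d (1/4) ?Q" by (rule op_bound_unitary_quotient[OF A(3) R(3) close(3)]) simp
  have "op_bound d (1 * (1/4) * 1) ?N"
    by (intro op_bound_mult op_bound_unitary mat_adjoint_unitary N' R) auto
  then have N: "op_bound d (1/4) ?N" by simp
  have P: "op_bound d (1/4) ?P"
    using op_bound_mono[OF op_bound_smult[OF op_bound_one[of d], of "?c - 1"], of "1/4"] th(2) by simp
  \<comment> \<open>Both sides are inverses of R R', so the rule for the adjoint of a product comes
    from unitarity rather than from a computation with entries.\<close>
  have adj: "mat_adjoint R' * mat_adjoint R = mat_adjoint (R * R')"
  proof -
    have "mat_adjoint R' * mat_adjoint R = mat_adjoint R' * mat_adjoint R * ((R * R') * mat_adjoint (R * R'))"
      using unitary_groupD(3)[OF R(3)] mult_carrier_mat[OF Rs(2) Rs(1)]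
      by (simp add: right_mult_one_mat[of _ d d])
    also have "\<dots> = mat_adjoint R' * ((mat_adjoint R * R) * R') * mat_adjoint (R * R')"
      using Rs Rc by (simp add: assoc_mult_mat[of _ d d _ d _ d] mult_carrier_mat[of _ d d _ d])
    also have "\<dots> = mat_adjoint (R * R')"
      using Rs Rc unitary_groupD(2)[OF R(1)] unitary_groupD(2)[OF R(2)]
      by (simp add: left_mult_one_mat[OF Rs(3)])
    finally show ?thesis .
  qed
  have R1: "1\<^sub>m d + ?N = R * (A' * mat_adjoint R') * mat_adjoint R"
  proof -
    have "?N = R * (A' * mat_adjoint R') * mat_adjoint R - R * mat_adjoint R"
      using Ac Rc Rs by (simp add: mult_minus_distrib_mat[of _ d d _ d] minus_mult_distrib_mat[of _ d d _ _ d])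
    moreover have "R * (A' * mat_adjoint R') * mat_adjoint R \<in> carrier_mat d d"
      using Ac Rc Rs by (intro mult_carrier_mat)
    ultimately show ?thesis using unitary_groupD(3)[OF R(1)] by (simp add: one_add_diff_mat)
  qed
  have "(1\<^sub>m d + ?M) * (1\<^sub>m d + ?N) = A * mat_adjoint R * (R * (A' * mat_adjoint R') * mat_adjoint R)"
    using Ac Rs by (simp add: R1 one_add_diff_mat)
  also have "\<dots> = A * (mat_adjoint R * R) * (A' * (mat_adjoint R' * mat_adjoint R))"
    using Ac Rc Rs by (simp add: assoc_mult_mat[of _ d d _ d _ d] mult_carrier_mat[of _ d d _ d])
  also have "\<dots> = A * A' * mat_adjoint (R * R')"
    using Ac Rc Rs unitary_groupD(2)[OF R(1)] adj by (simp add: assoc_mult_mat[of _ d d _ d _ d] mult_carrier_mat[of _ d d _ d])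
  also have "\<dots> = ?c \<cdot>\<^sub>m (A'' * mat_adjoint (R * R'))"
    using Ac Rc Rs by (simp add: AA mult_smult_assoc_mat[of _ d d _ d])
  also have "\<dots> = (?c \<cdot>\<^sub>m 1\<^sub>m d) * (A'' * mat_adjoint (R * R'))"
    using Ac Rc Rs by (simp add: mult_smult_assoc_mat[of _ d d _ d])
  also have "?c \<cdot>\<^sub>m 1\<^sub>m d = 1\<^sub>m d + ?P"
    by (rule eq_matI) auto
  also have "A'' * mat_adjoint (R * R') = 1\<^sub>m d + ?Q"
    using Ac Rs by (simp add: one_add_diff_mat)
  finally have eq: "?M + (?N + ?M * ?N) = ?P + (?Q + ?P * ?Q)"
    by (rule add_mult_eq_of_one_add[OF op_boundD(1)[OF M] op_boundD(1)[OF N] op_boundD(1)[OF P] op_boundD(1)[OF Q]])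
  have "det_log d ?N y"
    by (rule det_log_conj[OF op_boundD(1)[OF N'] Rc(1) Rs(1) unitary_groupD(3)[OF R(1)] y])
  with x have 1: "det_log d (?M + (?N + ?M * ?N)) (x + y)"
    by (intro det_log_mult M N)
  have "cmod (?c - 1) < 1" using th(2) by linarith
  then have "det_log d ?P (of_nat d * Ln ?c)" by (rule det_log_scalar)
  \<comment> \<open>The bound pi on the angle places it in the range of the principal branch, so no
    multiple of 2 pi i appears.\<close>
  moreover have "Ln ?c = \<i> * of_real \<theta>" using th(1) by (intro Ln_exp) auto
  ultimately have "det_log d ?P (of_nat d * (\<i> * of_real \<theta>))" by simp
  with z have "det_log d (?P + (?Q + ?P * ?Q)) (of_nat d * (\<i> * of_real \<theta>) + z)"
    by (intro det_log_mult P Q)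
  then show ?thesis using 1 unfolding eq by (rule det_log_unique[rotated])
qed

section \<open>The kernel of the Kronecker map\<close>

text \<open>A homomorphism to the integers defined on a subgroup B only: containing 0 and being
  closed under differences makes B a subgroup. The values of f off B are arbitrary.\<close>

definition additive_on :: "('c \<Rightarrow>\<^sub>0 int) set \<Rightarrow> (('c \<Rightarrow>\<^sub>0 int) \<Rightarrow> int) \<Rightarrow> bool" where
  "additive_on B f \<longleftrightarrow> 0 \<in> B \<and> (\<forall>x\<in>B. \<forall>y\<in>B. x - y \<in> B \<and> f (x - y) = f x - f y)"

lemma additive_onD:
  assumes "additive_on B f"
  shows "0 \<in> B" "f 0 = 0"
    and "x \<in> B \<Longrightarrow> y \<in> B \<Longrightarrow> x - y \<in> B" "x \<in> B \<Longrightarrow> y \<in> B \<Longrightarrow> f (x - y) = f x - f y"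
    and "x \<in> B \<Longrightarrow> - x \<in> B" "x \<in> B \<Longrightarrow> f (- x) = - f x"
    and "x \<in> B \<Longrightarrow> y \<in> B \<Longrightarrow> x + y \<in> B" "x \<in> B \<Longrightarrow> y \<in> B \<Longrightarrow> f (x + y) = f x + f y"
proof -
  note D = assms[unfolded additive_on_def]
  show z: "0 \<in> B" and f0: "f 0 = 0" using D by force+
  show d: "x \<in> B \<Longrightarrow> y \<in> B \<Longrightarrow> x - y \<in> B" "x \<in> B \<Longrightarrow> y \<in> B \<Longrightarrow> f (x - y) = f x - f y" for x y
    using D by auto
  show m: "x \<in> B \<Longrightarrow> - x \<in> B" "x \<in> B \<Longrightarrow> f (- x) = - f x" for x
    using d(1)[OF z, of x] d(2)[OF z, of x] f0 by auto
  show "x \<in> B \<Longrightarrow> y \<in> B \<Longrightarrow> x + y \<in> B" "x \<in> B \<Longrightarrow> y \<in> B \<Longrightarrow> f (x + y) = f x + f y"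
    using d(1)[of x "- y"] d(2)[of x "- y"] m(1)[of y] m(2)[of y] by auto
qed

lemma additive_on_cmul:
  assumes f: "additive_on B f" and x: "x \<in> B"
  shows "frag_cmul k x \<in> B \<and> f (frag_cmul k x) = k * f x"
proof (induction k rule: int_induct[where k = 0])
  case base
  then show ?case using additive_onD(1,2)[OF f] by simp
next
  case (step1 i)
  then show ?case
    using additive_onD(7,8)[OF f _ x] by (simp add: frag_cmul_distrib distrib_right)
next
  case (step2 i)
  then show ?case
    using additive_onD(3,4)[OF f _ x] by (simp add: frag_cmul_diff_distrib left_diff_distrib)
qed

lemma frag_cmul_diff_distrib2: "frag_cmul k (x - y) = frag_cmul k x - frag_cmul k y"
  using frag_cmul_distrib2[of k "x - y" y] by simp

text \<open>B' is B + Z y. If k y lies in B for some k > 0, then k maps B' into B, and x -> f (k x)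
  is an extension of k f, so N = k. Otherwise the sum is direct; f is extended by 0 on y, and N =
  1.\<close>

lemma additive_on_extend:
  assumes f: "additive_on B f"
  obtains B' f' N where "N > (0::int)" "additive_on B' f'" "B \<subseteq> B'" "y \<in> B'"
    "\<And>x. x \<in> B \<Longrightarrow> f' x = N * f x"
proof -
  define B' where "B' = {b + frag_cmul j y | b j. b \<in> B}"
  note fD = additive_onD[OF f]
  note cm = additive_on_cmul[OF f]
  have B'I: "b + frag_cmul j y \<in> B'" if "b \<in> B" for b j using that unfolding B'_def by blast
  have zero: "0 \<in> B'" using B'I[OF fD(1), of 0] by simp
  have sub: "B \<subseteq> B'"
  proof
    fix b assume "b \<in> B" then show "b \<in> B'" using B'I[of b 0] by simp
  qed
  have y: "y \<in> B'" using B'I[OF fD(1), of 1] by simp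
  have diff: "x - x' \<in> B'" if "x \<in> B'" "x' \<in> B'" for x x'
  proof -
    obtain b j b' j' where *: "b \<in> B" "b' \<in> B" "x = b + frag_cmul j y" "x' = b' + frag_cmul j' y"
      using \<open>x \<in> B'\<close> \<open>x' \<in> B'\<close> unfolding B'_def by blast
    then have **: "x - x' = (b - b') + frag_cmul (j - j') y" by (simp add: frag_cmul_diff_distrib)
    show ?thesis unfolding ** by (rule B'I[OF fD(3)[OF *(1,2)]])
  qed
  show ?thesis
  proof (cases "\<exists>k>0. frag_cmul k y \<in> B")
    case True
    then obtain k where k: "k > 0" "frag_cmul k y \<in> B" by blast
    have kB: "frag_cmul k x \<in> B" if x: "x \<in> B'" for x
    proof -
      obtain b j where *: "b \<in> B" "x = b + frag_cmul j y" using x unfolding B'_def by blast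
      have "frag_cmul k x = frag_cmul k b + frag_cmul j (frag_cmul k y)"
        by (simp add: * frag_cmul_distrib2 mult.commute)
      then show ?thesis using cm[OF *(1)] cm[OF k(2)] fD(7) by simp
    qed
    have "additive_on B' (\<lambda>x. f (frag_cmul k x))"
      unfolding additive_on_def using zero diff kB fD(4)
      by (auto simp: frag_cmul_diff_distrib2)
    then show ?thesis using k(1) sub y cm by (intro that[of k B' "\<lambda>x. f (frag_cmul k x)"]) auto
  next
    case False
    have none: "k = 0" if "frag_cmul k y \<in> B" for k
    proof (rule ccontr)
      assume "k \<noteq> 0"
      have "frag_cmul \<bar>k\<bar> y \<in> B"
        using that fD(5)[OF that] frag_cmul_diff_distrib[of 0 k y] by (simp add: abs_if)
      with False \<open>k \<noteq> 0\<close> show False by (metis zero_less_abs_iff)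
    qed
    define c where "c x = (THE j. x - frag_cmul j y \<in> B)" for x
    have c_eq: "c (b + frag_cmul j y) = j" if "b \<in> B" for b j
      unfolding c_def
    proof (rule the_equality)
      show "b + frag_cmul j y - frag_cmul j y \<in> B" using that by simp
      fix j' assume "b + frag_cmul j y - frag_cmul j' y \<in> B"
      from fD(3)[OF this that] have "frag_cmul (j - j') y \<in> B" by (simp add: frag_cmul_diff_distrib)
      from none[OF this] show "j' = j" by simp
    qed
    define f' where "f' x = f (x - frag_cmul (c x) y)" for x
    have f'_eq: "f' (b + frag_cmul j y) = f b" if "b \<in> B" for b j
      unfolding f'_def c_eq[OF that] by simp
    have "f' (x - x') = f' x - f' x'" if "x \<in> B'" "x' \<in> B'" for x x'
    proof -
      obtain b j b' j' where *: "b \<in> B" "b' \<in> B" "x = b + frag_cmul j y" "x' = b' + frag_cmul j' y"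
        using \<open>x \<in> B'\<close> \<open>x' \<in> B'\<close> unfolding B'_def by blast
      then have **: "x - x' = (b - b') + frag_cmul (j - j') y" by (simp add: frag_cmul_diff_distrib)
      show ?thesis unfolding ** unfolding * using f'_eq fD(3,4) *(1,2) by simp
    qed
    then have "additive_on B' f'" unfolding additive_on_def using zero diff by auto
    moreover have "f' x = 1 * f x" if "x \<in> B" for x using f'_eq[OF that, of 0] by simp
    ultimately show ?thesis using sub y that[of 1 B' f'] by simp
  qed
qed

lemma additive_on_extend_finite:
  assumes "finite Y" "additive_on B f"
  shows "\<exists>B' f' N. N > (0::int) \<and> additive_on B' f' \<and> B \<subseteq> B' \<and> Y \<subseteq> B' \<and> (\<forall>x\<in>B. f' x = N * f x)"
  using assms
proof (induction Y)
  case empty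
  then show ?case by (intro exI[of _ B] exI[of _ f] exI[of _ 1]) auto
next
  case (insert y Y)
  then obtain B1 f1 N1 where 1: "N1 > (0::int)" "additive_on B1 f1" "B \<subseteq> B1" "Y \<subseteq> B1"
      "\<forall>x\<in>B. f1 x = N1 * f x" by blast
  obtain B2 f2 N2 where 2: "N2 > (0::int)" "additive_on B2 f2" "B1 \<subseteq> B2" "y \<in> B2"
      "\<And>x. x \<in> B1 \<Longrightarrow> f2 x = N2 * f1 x" by (rule additive_on_extend[OF 1(2), of y]) (rule that)
  show ?case
  proof (intro exI conjI ballI)
    show "N2 * N1 > 0" "additive_on B2 f2" "B \<subseteq> B2" "insert y Y \<subseteq> B2" using 1 2 by auto
    show "f2 x = N2 * N1 * f x" if "x \<in> B" for x using 1 2(5)[of x] that by auto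
  qed
qed

text \<open>
  The functional induced by \<open>s\<close> on 1-boundaries extends, up to a positive factor, over one generator
  of the group at a time. This replaces the finiteness of \<open>Ext(H\<^sub>1, \<int>)\<close>.
\<close>

lemma annihilates_cycles_imp_torsion:
  fixes G :: "('a, 'm) monoid_scheme" (structure)
  assumes G: "group G" and X: "finite X" "X \<subseteq> carrier G" "generate G X = carrier G"
    and s: "\<And>z. z \<in> cycles2 G \<Longrightarrow> cochain_eval s z = 0"
  shows "\<exists>N>0. \<exists>b. \<forall>g\<in>carrier G. \<forall>h\<in>carrier G. int N * s (g, h) = b h - b (g \<otimes>\<^bsub>G\<^esub> h) + b g"
proof -
  interpret group G by fact
  let ?C = "{c. Poly_Mapping.keys c \<subseteq> carrier G \<times> carrier G} :: (('a \<times> 'a) \<Rightarrow>\<^sub>0 int) set"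
  let ?d = "frag_extend (bar_d2 G)"
  define B where "B = ?d ` ?C"
  \<comment> \<open>The value at a boundary is the value of \<open>s\<close> on any chain with that
    boundary. Two such chains differ by a cycle, on which \<open>s\<close> vanishes, so the choice
    does not matter.\<close>
  define f where "f x = cochain_eval s (SOME c. c \<in> ?C \<and> ?d c = x)" for x
  have Cdiff: "c - c' \<in> ?C" if "c \<in> ?C" "c' \<in> ?C" for c c'
    using that keys_diff[of c c'] by auto
  have f_eq: "f (?d c) = cochain_eval s c" if c: "c \<in> ?C" for c
  proof -
    define c' where "c' = (SOME c'. c' \<in> ?C \<and> ?d c' = ?d c)"
    have c': "c' \<in> ?C \<and> ?d c' = ?d c"
      unfolding c'_def by (rule someI[of _ c]) (use c in simp)
    then have "c' - c \<in> cycles2 G"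
      using Cdiff[of c' c] c by (simp add: cycles2_def frag_extend_diff)
    from s[OF this] show ?thesis unfolding f_def c'_def[symmetric] by (simp add: cochain_eval_diff)
  qed
  have "additive_on B f"
    unfolding additive_on_def
  proof (intro conjI ballI)
    have "0 \<in> ?C" by simp
    then show "0 \<in> B" unfolding B_def by (metis frag_extend_0 imageI)
    fix x y assume "x \<in> B" "y \<in> B"
    then obtain c e where ce: "c \<in> ?C" "e \<in> ?C" "x = ?d c" "y = ?d e" unfolding B_def by blast
    have xy: "x - y = ?d (c - e)" unfolding ce by (simp add: frag_extend_diff)
    show "x - y \<in> B" unfolding xy B_def using Cdiff[OF ce(1,2)] by blast
    show "f (x - y) = f x - f y"
      unfolding xy f_eq[OF Cdiff[OF ce(1,2)]] unfolding ce using f_eq ce(1,2) by (simp add: cochain_eval_diff)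
  qed
  then have "\<exists>B' f' N. N > (0::int) \<and> additive_on B' f' \<and> B \<subseteq> B' \<and> frag_of ` X \<subseteq> B' \<and>
      (\<forall>x\<in>B. f' x = N * f x)"
    by (intro additive_on_extend_finite finite_imageI X(1))
  then obtain B' f' N where N: "N > (0::int)" "additive_on B' f'" "B \<subseteq> B'" "frag_of ` X \<subseteq> B'"
      "\<forall>x\<in>B. f' x = N * f x"
    by (elim exE conjE) (rule that)
  note D = additive_onD[OF N(2)]
  have d_of: "?d (frag_of (g, h)) = frag_of h - frag_of (g \<otimes> h) + frag_of g" for g h
    by (simp add: bar_d2_def)
  have of_C: "frag_of (g, h) \<in> ?C" if "g \<in> carrier G" "h \<in> carrier G" for g h using that by simp
  have dB: "frag_of h - frag_of (g \<otimes> h) + frag_of g \<in> B" if "g \<in> carrier G" "h \<in> carrier G" for g h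
    unfolding B_def using imageI[OF of_C[OF that], of ?d] by (simp add: d_of del: frag_extend_of)
  \<comment> \<open>Modulo B, sending g to \<open>frag_of g\<close> is a homomorphism. Hence B',
    which contains B and the generators, contains every \<open>frag_of g\<close>; its values there
    are the cochain that bounds N s.\<close>
  have one: "frag_of \<one> \<in> B'" using dB[of \<one> \<one>] N(3) by auto
  have mult: "frag_of (g \<otimes> h) \<in> B'"
    if "g \<in> carrier G" "h \<in> carrier G" "frag_of g \<in> B'" "frag_of h \<in> B'" for g h
  proof -
    have "frag_of (g \<otimes> h) = frag_of h + frag_of g - (frag_of h - frag_of (g \<otimes> h) + frag_of g)" by simp
    then show ?thesis using D(3)[OF D(7)[OF that(4,3)], of "frag_of h - frag_of (g \<otimes> h) + frag_of g"]
        dB[OF that(1,2)] N(3) by auto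
  qed
  have inv: "frag_of (inv g) \<in> B'" if "g \<in> carrier G" "frag_of g \<in> B'" for g
  proof -
    have "frag_of (inv g) = (frag_of (inv g) - frag_of (g \<otimes> inv g) + frag_of g) + frag_of \<one> - frag_of g"
      using that by simp
    moreover have "frag_of (inv g) - frag_of (g \<otimes> inv g) + frag_of g \<in> B'"
      using dB[of g "inv g"] that N(3) by auto
    ultimately show ?thesis using D(3)[OF D(7)[OF _ one] that(2)] by metis
  qed
  have all: "frag_of g \<in> B'" if "g \<in> carrier G" for g
  proof -
    have "g \<in> generate G X" using that X(3) by simp
    then show ?thesis
    proof induction
      case one then show ?case by (rule \<open>frag_of \<one> \<in> B'\<close>)
    next
      case (incl h) then show ?case using N(4) by blast
    next
      case (inv h) then show ?case using \<open>\<And>g. g \<in> carrier G \<Longrightarrow> frag_of g \<in> B' \<Longrightarrow> frag_of (inv g) \<in> B'\<close> N(4) X(2) by blast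
    next
      case (eng h1 h2) then show ?case using mult generate_in_carrier[OF X(2)] by blast
    qed
  qed
  have "N * s (g, h) = f' (frag_of h) - f' (frag_of (g \<otimes> h)) + f' (frag_of g)"
    if g: "g \<in> carrier G" and h: "h \<in> carrier G" for g h
  proof -
    have "f' (frag_of h - frag_of (g \<otimes> h) + frag_of g) = N * f (?d (frag_of (g, h)))"
      unfolding d_of using N(5) dB[OF g h] by blast
    also have "\<dots> = N * s (g, h)" using f_eq[OF of_C[OF g h]] by simp
    finally show ?thesis
      using D(4)[OF all[OF h] all[OF m_closed[OF g h]]]
        D(8)[OF D(3)[OF all[OF h] all[OF m_closed[OF g h]]] all[OF g]] by simp
  qed
  then show ?thesis
    using N(1) by (intro exI[of _ "nat N"] conjI exI[of _ "\<lambda>g. f' (frag_of g)"]) simp_all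
qed

lemma cocycle_group2_nat_pow:
  fixes n :: nat
  assumes s: "s \<in> cocycles2 G"
  shows "s [^]\<^bsub>(cochain_group2 G)\<lparr>carrier := cocycles2 G\<rparr>\<^esub> n = (\<lambda>p\<in>carrier G \<times> carrier G. int n * s p)"
proof (induction n)
  case 0
  then show ?case by (simp add: cochain_group2_def)
next
  case (Suc n)
  show ?case
    unfolding nat_pow_Suc Suc by (auto simp: cochain_group2_def distrib_right add.commute intro!: restrict_ext)
qed

text \<open>Removes the quotient: an equation that makes n s a coboundary would annihilate the n-th
  multiple of the class of s. The result is the exact negation of what
  \<open>annihilates_cycles_imp_torsion\<close> provides.\<close>

lemma non_torsion_cohomology2_cocycle:
  assumes G: "group G" and nt: "\<not> torsion_group (cohomology2 G)"
  shows "\<exists>s\<in>cocycles2 G. \<forall>n>0. \<forall>b. \<exists>g\<in>carrier G. \<exists>h\<in>carrier G.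
    int n * s (g, h) \<noteq> b h - b (g \<otimes>\<^bsub>G\<^esub> h) + b g"
proof -
  let ?Z = "(cochain_group2 G)\<lparr>carrier := cocycles2 G\<rparr>"
  interpret Z: comm_group ?Z by (rule comm_group_cocycle_group2[OF G])
  interpret N: normal "coboundaries2 G" ?Z
    by (rule Z.subgroup_imp_normal[OF subgroup_coboundaries2[OF G]])
  obtain x where x: "x \<in> carrier (cohomology2 G)" "\<And>n::nat. n > 0 \<Longrightarrow> x [^]\<^bsub>cohomology2 G\<^esub> n \<noteq> \<one>\<^bsub>cohomology2 G\<^esub>"
    using nt unfolding torsion_group_def by blast
  obtain s where s: "s \<in> cocycles2 G" "x = coboundaries2 G #>\<^bsub>?Z\<^esub> s"
    using x(1) unfolding cohomology2_def FactGroup_def RCOSETS_def by auto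
  have "\<exists>g\<in>carrier G. \<exists>h\<in>carrier G. int n * s (g, h) \<noteq> b h - b (g \<otimes>\<^bsub>G\<^esub> h) + b g" if n: "n > 0" for n :: nat and b
  proof (rule ccontr)
    assume "\<not> ?thesis"
    then have "s [^]\<^bsub>?Z\<^esub> n = (\<lambda>(g, h)\<in>carrier G \<times> carrier G. b h - b (g \<otimes>\<^bsub>G\<^esub> h) + b g)"
      unfolding cocycle_group2_nat_pow[OF s(1)] by (intro restrict_ext) auto
    then have "s [^]\<^bsub>?Z\<^esub> n \<in> coboundaries2 G" unfolding coboundaries2_def by blast
    then have "coboundaries2 G #>\<^bsub>?Z\<^esub> (s [^]\<^bsub>?Z\<^esub> n) = coboundaries2 G"
      using s(1) by (intro Z.coset_join2 N.subgroup_axioms Z.nat_pow_closed) simp_all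
    moreover have "x [^]\<^bsub>cohomology2 G\<^esub> n = coboundaries2 G #>\<^bsub>?Z\<^esub> (s [^]\<^bsub>?Z\<^esub> n)"
      unfolding s(2) cohomology2_def by (rule N.FactGroup_pow) (use s(1) in simp)
    ultimately show False using x(2)[OF n] by (simp add: cohomology2_def)
  qed
  with s(1) show ?thesis by blast
qed

section \<open>Complex cochains, for pairing logarithms with integral cycles\<close>

definition complex_eval :: "('c \<Rightarrow> complex) \<Rightarrow> ('c \<Rightarrow>\<^sub>0 int) \<Rightarrow> complex" where
  "complex_eval u c = (\<Sum>p\<in>Poly_Mapping.keys c. of_int (Poly_Mapping.lookup c p) * u p)"

lemma complex_eval_of [simp]: "complex_eval u (frag_of p) = u p"
  by (simp add: complex_eval_def)

lemma complex_eval_diff: "complex_eval u (x - y) = complex_eval u x - complex_eval u y"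
proof -
  let ?S = "Poly_Mapping.keys x \<union> Poly_Mapping.keys y"
  have "complex_eval u w = (\<Sum>p\<in>?S. of_int (Poly_Mapping.lookup w p) * u p)" if "Poly_Mapping.keys w \<subseteq> ?S" for w
    unfolding complex_eval_def by (rule sum.mono_neutral_left) (use that in \<open>auto simp: in_keys_iff\<close>)
  from this[of x] this[of y] this[of "x - y"] show ?thesis
    using keys_diff[of x y] by (simp add: lookup_minus sum_subtractf left_diff_distrib)
qed

lemma complex_eval_add: "complex_eval u (x + y) = complex_eval u x + complex_eval u y"
  using complex_eval_diff[of u "x + y" y] by simp

lemma complex_eval_bar_d2:
  "complex_eval b (frag_extend (bar_d2 G) c) = complex_eval (\<lambda>(g, h). b h - b (g \<otimes>\<^bsub>G\<^esub> h) + b g) c"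
proof -
  have "Poly_Mapping.keys c \<subseteq> UNIV" by simp
  then show ?thesis
  proof (induction c rule: frag_induction)
    case zero
    then show ?case by (simp add: complex_eval_def)
  next
    case (one p)
    then show ?case by (cases p rule: prod.exhaust) (simp add: bar_d2_def complex_eval_diff complex_eval_add)
  next
    case (diff x y)
    then show ?case by (simp add: frag_extend_diff complex_eval_diff)
  qed
qed

text \<open>On the support of z the multiple of s agrees with the coboundary of b, and a coboundary
  pairs to zero with a cycle. Asking for the equation on the support only leaves finitely many group
  elements to control.\<close>

lemma cycle_pairing_zero:
  fixes b :: "'a \<Rightarrow> complex"
  assumes z: "z \<in> cycles2 G"
    and eq: "\<And>g h. (g, h) \<in> Poly_Mapping.keys z \<Longrightarrow> \<kappa> * of_int (s (g, h)) = b h - b (g \<otimes>\<^bsub>G\<^esub> h) + b g"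
  shows "\<kappa> * of_int (cochain_eval s z) = 0"
proof -
  have "\<kappa> * of_int (cochain_eval s z)
      = (\<Sum>p\<in>Poly_Mapping.keys z. of_int (Poly_Mapping.lookup z p) * (\<kappa> * of_int (s p)))"
    by (simp add: cochain_eval_def sum_distrib_left mult_ac)
  also have "\<dots> = complex_eval (\<lambda>(g, h). b h - b (g \<otimes>\<^bsub>G\<^esub> h) + b g) z"
    unfolding complex_eval_def by (rule sum.cong) (auto simp: eq)
  also have "\<dots> = complex_eval b (frag_extend (bar_d2 G) z)"
    by (rule complex_eval_bar_d2[symmetric])
  also have "\<dots> = 0" using z by (simp add: cycles2_def complex_eval_def)
  finally show ?thesis .
qed

section \<open>Residual finiteness of polycyclic groups\<close>

context group
begin

definition cyclic_extension :: "'a set \<Rightarrow> 'a \<Rightarrow> 'a set" where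
  "cyclic_extension K t = {a \<otimes> t [^] j | a (j::int). a \<in> K}"

text \<open>Both directions are demanded because conjugation by t can map an infinite K properly
  into itself.\<close>

definition normalizes :: "'a \<Rightarrow> 'a set \<Rightarrow> bool" where
  "normalizes t K \<longleftrightarrow> t \<in> carrier G \<and> (\<forall>a\<in>K. t \<otimes> a \<otimes> inv t \<in> K \<and> inv t \<otimes> a \<otimes> t \<in> K)"

text \<open>A polycyclic series read upwards from the trivial subgroup.\<close>

inductive polyc :: "'a set \<Rightarrow> bool" where
  polyc_one: "polyc {\<one>}"
| polyc_extend: "polyc K \<Longrightarrow> normalizes t K \<Longrightarrow> polyc (cyclic_extension K t)"

text \<open>Finite index expressed through finitely many right representatives. In this form it
  composes, and it passes to larger M, without mention of coset spaces;
  \<open>finite_rcosets_iff_covered_by\<close> recovers the usual notion.\<close>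

definition covered_by :: "'a set \<Rightarrow> 'a set \<Rightarrow> bool" where
  "covered_by K M \<longleftrightarrow> (\<exists>F. finite F \<and> F \<subseteq> carrier G \<and> (\<forall>x\<in>K. \<exists>m\<in>M. \<exists>f\<in>F. x = m \<otimes> f))"

definition powers_subgroup :: "nat \<Rightarrow> 'a set \<Rightarrow> 'a set" where
  "powers_subgroup n K = generate G ((\<lambda>x. x [^] n) ` K)"

section \<open>Normalising elements and cyclic extensions\<close>

lemma inv_cancel_left:
  assumes "x \<in> carrier G" "y \<in> carrier G"
  shows "inv x \<otimes> (x \<otimes> y) = y" "x \<otimes> (inv x \<otimes> y) = y"
  using assms by (simp_all flip: m_assoc)

lemma normalizesD:
  assumes "normalizes t K"
  shows "t \<in> carrier G" "a \<in> K \<Longrightarrow> t \<otimes> a \<otimes> inv t \<in> K" "a \<in> K \<Longrightarrow> inv t \<otimes> a \<otimes> t \<in> K"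
  using assms by (auto simp: normalizes_def)

lemma normalizes_inv: "normalizes t K \<Longrightarrow> normalizes (inv t) K"
  by (auto simp: normalizes_def)

lemma conj_mult:
  assumes "x \<in> carrier G" "y \<in> carrier G" "a \<in> carrier G"
  shows "(x \<otimes> y) \<otimes> a \<otimes> inv (x \<otimes> y) = x \<otimes> (y \<otimes> a \<otimes> inv y) \<otimes> inv x"
  using assms by (simp add: inv_mult_group m_assoc)

lemma normalizes_mult:
  assumes "normalizes x K" "normalizes y K" and K: "K \<subseteq> carrier G"
  shows "normalizes (x \<otimes> y) K"
proof -
  have xy: "x \<in> carrier G" "y \<in> carrier G" using assms normalizesD(1) by blast+
  have "(x \<otimes> y) \<otimes> a \<otimes> inv (x \<otimes> y) \<in> K" if "a \<in> K" for a
    using conj_mult[OF xy, of a] that K normalizesD(2)[OF assms(1)] normalizesD(2)[OF assms(2)] by auto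
  moreover have "inv (x \<otimes> y) \<otimes> a \<otimes> (x \<otimes> y) \<in> K" if "a \<in> K" for a
  proof -
    have "inv (x \<otimes> y) \<otimes> a \<otimes> (x \<otimes> y) = inv y \<otimes> (inv x \<otimes> a \<otimes> x) \<otimes> y"
      using xy that K by (auto simp: inv_mult_group m_assoc)
    then show ?thesis using that normalizesD(3)[OF assms(1)] normalizesD(3)[OF assms(2)] by auto
  qed
  ultimately show ?thesis using xy by (simp add: normalizes_def)
qed

lemma normalizes_one: "K \<subseteq> carrier G \<Longrightarrow> normalizes \<one> K"
  by (auto simp: normalizes_def)

lemma normalizes_int_pow:
  assumes t: "normalizes t K" and K: "K \<subseteq> carrier G"
  shows "normalizes (t [^] (j::int)) K"
proof -
  have nat: "normalizes (t [^] (n::nat)) K" for n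
    by (induction n) (simp_all add: normalizes_one[OF K] normalizes_mult[OF _ t K])
  show ?thesis
    unfolding int_pow_def2 using nat normalizes_inv[OF nat] by presburger
qed

lemma normalizes_subgroup:
  assumes "subgroup K G" "x \<in> K"
  shows "normalizes x K"
  using assms subgroup.m_closed[OF assms(1)] subgroup.m_inv_closed[OF assms(1)] subgroup.mem_carrier[OF assms(1)]
  by (auto simp: normalizes_def)

lemma subgroup_int_pow:
  assumes "subgroup K G" "x \<in> K"
  shows "x [^] (j::int) \<in> K"
proof -
  have "x [^] (n::nat) \<in> K" for n
    by (induction n) (auto intro: subgroup.m_closed[OF assms(1)] subgroup.one_closed[OF assms(1)] assms(2))
  then show ?thesis unfolding int_pow_def2 using subgroup.m_inv_closed[OF assms(1)] by presburger
qed

lemma cyclic_extensionI: "a \<in> K \<Longrightarrow> a \<otimes> t [^] (j::int) \<in> cyclic_extension K t"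
  by (auto simp: cyclic_extension_def)

lemma cyclic_extensionE:
  assumes "x \<in> cyclic_extension K t"
  obtains a j where "a \<in> K" "x = a \<otimes> t [^] (j::int)"
  using assms by (auto simp: cyclic_extension_def)

lemma subgroup_cyclic_extension:
  assumes K: "subgroup K G" and t: "normalizes t K"
  shows "subgroup (cyclic_extension K t) G"
proof -
  have Kc: "K \<subseteq> carrier G" by (rule subgroup.subset[OF K])
  have tc: "t \<in> carrier G" by (rule normalizesD[OF t])
  note np = normalizesD[OF normalizes_int_pow[OF t Kc]]
  show ?thesis
  proof (rule subgroupI)
    show "cyclic_extension K t \<subseteq> carrier G" using Kc tc by (auto simp: cyclic_extension_def)
    show "cyclic_extension K t \<noteq> {}" using cyclic_extensionI[OF subgroup.one_closed[OF K]] by blast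
  next
    fix x assume "x \<in> cyclic_extension K t"
    then obtain a j where x: "a \<in> K" "x = a \<otimes> t [^] (j::int)" by (rule cyclic_extensionE)
    have "inv x = (inv (t [^] j) \<otimes> inv a \<otimes> t [^] j) \<otimes> t [^] (- j)"
      using x Kc tc by (auto simp: inv_mult_group m_assoc int_pow_neg)
    also have "\<dots> \<in> cyclic_extension K t"
      by (rule cyclic_extensionI[OF np(3)[OF subgroup.m_inv_closed[OF K x(1)]]])
    finally show "inv x \<in> cyclic_extension K t" .
  next
    fix x y assume "x \<in> cyclic_extension K t" "y \<in> cyclic_extension K t"
    then obtain a j b k where x: "a \<in> K" "x = a \<otimes> t [^] (j::int)" and y: "b \<in> K" "y = b \<otimes> t [^] (k::int)"
      by (metis cyclic_extensionE)
    have "x \<otimes> y = a \<otimes> (t [^] j \<otimes> b \<otimes> inv (t [^] j)) \<otimes> t [^] (j + k)"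
      using x(2) y(2) tc subsetD[OF Kc x(1)] subsetD[OF Kc y(1)]
      by (simp add: m_assoc int_pow_mult inv_cancel_left)
    also have "\<dots> \<in> cyclic_extension K t"
      by (intro cyclic_extensionI subgroup.m_closed[OF K] x(1) np(2) y(1))
    finally show "x \<otimes> y \<in> cyclic_extension K t" .
  qed
qed

lemma polyc_subgroup: "polyc K \<Longrightarrow> subgroup K G"
  by (induction rule: polyc.induct) (auto intro: triv_subgroup subgroup_cyclic_extension)

lemma subset_cyclic_extension: "K \<subseteq> carrier G \<Longrightarrow> t \<in> carrier G \<Longrightarrow> K \<subseteq> cyclic_extension K t"
  using cyclic_extensionI[of _ K t 0] by force

lemma generator_in_cyclic_extension: "subgroup K G \<Longrightarrow> t \<in> carrier G \<Longrightarrow> t \<in> cyclic_extension K t"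
  using cyclic_extensionI[where a = \<one> and K = K and t = t and j = 1] subgroup.one_closed[of K G]
  by (simp add: int_pow_1)

lemma polyc_finitely_generated:
  assumes "polyc K"
  shows "\<exists>X. finite X \<and> X \<subseteq> carrier G \<and> generate G X = K"
  using assms
proof induction
  case polyc_one
  then show ?case by (intro exI[of _ "{}"]) (simp add: generate_empty)
next
  case (polyc_extend K t)
  then obtain X where X: "finite X" "X \<subseteq> carrier G" "generate G X = K" by blast
  have t: "t \<in> carrier G" by (rule normalizesD[OF polyc_extend(2)])
  have K: "subgroup K G" by (rule polyc_subgroup[OF polyc_extend(1)])
  have Xt: "insert t X \<subseteq> carrier G" using X t by blast
  have sub: "subgroup (generate G (insert t X)) G" by (rule generate_is_subgroup[OF Xt])
  have "generate G (insert t X) = cyclic_extension K t"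
  proof
    have "insert t X \<subseteq> cyclic_extension K t"
      using generator_in_cyclic_extension[OF K t] subset_cyclic_extension[OF subgroup.subset[OF K] t]
        generate.incl[of _ X G] X(3) by blast
    then show "generate G (insert t X) \<subseteq> cyclic_extension K t"
      by (rule generate_subgroup_incl[OF _ subgroup_cyclic_extension[OF K polyc_extend(2)]])
    have "K \<subseteq> generate G (insert t X)" using X(3) mono_generate[of X "insert t X"] by blast
    moreover have "t \<in> generate G (insert t X)" by (rule generate.incl) simp
    ultimately show "cyclic_extension K t \<subseteq> generate G (insert t X)"
      by (auto elim!: cyclic_extensionE intro!: subgroup.m_closed[OF sub] subgroup_int_pow[OF sub])
  qed
  then show ?case using X(1) Xt by (intro exI[of _ "insert t X"]) auto
qed

section \<open>Finite covers and subgroups generated by powers\<close>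

lemma covered_by_refl: "K \<subseteq> carrier G \<Longrightarrow> covered_by K K"
  unfolding covered_by_def by (intro exI[of _ "{\<one>}"]) (auto simp: subset_iff)

lemma covered_by_trans:
  assumes "covered_by L K" "covered_by K M" "M \<subseteq> carrier G"
  shows "covered_by L M"
proof -
  obtain F where F: "finite F" "F \<subseteq> carrier G" "\<And>x. x \<in> L \<Longrightarrow> \<exists>m\<in>K. \<exists>f\<in>F. x = m \<otimes> f"
    using assms(1) unfolding covered_by_def by blast
  obtain E where E: "finite E" "E \<subseteq> carrier G" "\<And>x. x \<in> K \<Longrightarrow> \<exists>m\<in>M. \<exists>f\<in>E. x = m \<otimes> f"
    using assms(2) unfolding covered_by_def by blast
  let ?H = "(\<lambda>(e, f). e \<otimes> f) ` (E \<times> F)"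
  have "\<exists>m\<in>M. \<exists>h\<in>?H. x = m \<otimes> h" if x: "x \<in> L" for x
  proof -
    obtain k f where kf: "k \<in> K" "f \<in> F" "x = k \<otimes> f" using F(3)[OF x] by blast
    obtain m e where me: "m \<in> M" "e \<in> E" "k = m \<otimes> e" using E(3)[OF kf(1)] by blast
    have "x = m \<otimes> (e \<otimes> f)" using kf me E(2) F(2) assms(3) by (auto simp: m_assoc subset_iff)
    then show ?thesis using me kf by force
  qed
  moreover have "finite ?H" "?H \<subseteq> carrier G" using E F by auto
  ultimately show ?thesis unfolding covered_by_def by blast
qed

lemma covered_by_mono: "covered_by K M \<Longrightarrow> M \<subseteq> M' \<Longrightarrow> covered_by K M'"
  unfolding covered_by_def by (elim exE) (metis subsetD)

lemma subgroup_powers: "K \<subseteq> carrier G \<Longrightarrow> subgroup (powers_subgroup n K) G"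
  unfolding powers_subgroup_def by (rule generate_is_subgroup) auto

lemma powers_subgroup_mono: "K \<subseteq> L \<Longrightarrow> powers_subgroup n K \<subseteq> powers_subgroup n L"
  unfolding powers_subgroup_def by (rule mono_generate) auto

lemma pow_in_powers_subgroup: "x \<in> K \<Longrightarrow> x [^] n \<in> powers_subgroup n K"
  unfolding powers_subgroup_def by (rule generate.incl) blast

lemma powers_subgroup_least:
  assumes "subgroup M G" "\<And>x. x \<in> K \<Longrightarrow> x [^] n \<in> M"
  shows "powers_subgroup n K \<subseteq> M"
  unfolding powers_subgroup_def using assms by (intro generate_subgroup_incl) auto

lemma subgroup_nat_pow:
  assumes "subgroup K G" "x \<in> K"
  shows "x [^] (n::nat) \<in> K"
  using subgroup_int_pow[OF assms, of "int n"] by (simp add: int_pow_int)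

lemma powers_subgroup_subset: "subgroup K G \<Longrightarrow> powers_subgroup n K \<subseteq> K"
  by (intro powers_subgroup_least subgroup_nat_pow)

lemma conj_nat_pow:
  assumes "t \<in> carrier G" "x \<in> carrier G"
  shows "t \<otimes> x [^] (n::nat) \<otimes> inv t = (t \<otimes> x \<otimes> inv t) [^] n"
proof (induction n)
  case 0
  then show ?case using assms by simp
next
  case (Suc n)
  have "(t \<otimes> x \<otimes> inv t) [^] Suc n = (t \<otimes> x [^] n \<otimes> inv t) \<otimes> (t \<otimes> x \<otimes> inv t)"
    by (simp add: Suc)
  also have "\<dots> = t \<otimes> x [^] n \<otimes> (inv t \<otimes> t) \<otimes> x \<otimes> inv t"
    using assms by (simp only: m_assoc m_closed inv_closed nat_pow_closed)
  also have "\<dots> = t \<otimes> x [^] Suc n \<otimes> inv t"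
    using assms by (simp add: m_assoc)
  finally show ?case by simp
qed

lemma subgroup_conj_vimage:
  assumes M: "subgroup M G" and t: "t \<in> carrier G"
  shows "subgroup {x \<in> carrier G. t \<otimes> x \<otimes> inv t \<in> M} G"
proof (rule subgroupI)
  have "\<one> \<in> {x \<in> carrier G. t \<otimes> x \<otimes> inv t \<in> M}" using t subgroup.one_closed[OF M] by simp
  then show "{x \<in> carrier G. t \<otimes> x \<otimes> inv t \<in> M} \<noteq> {}" by blast
next
  fix x assume "x \<in> {x \<in> carrier G. t \<otimes> x \<otimes> inv t \<in> M}"
  then show "inv x \<in> {x \<in> carrier G. t \<otimes> x \<otimes> inv t \<in> M}"
    using subgroup.m_inv_closed[OF M, of "t \<otimes> x \<otimes> inv t"] t by (auto simp: inv_mult_group m_assoc)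
next
  fix x y assume xy: "x \<in> {x \<in> carrier G. t \<otimes> x \<otimes> inv t \<in> M}" "y \<in> {x \<in> carrier G. t \<otimes> x \<otimes> inv t \<in> M}"
  have "(t \<otimes> x \<otimes> inv t) \<otimes> (t \<otimes> y \<otimes> inv t) = t \<otimes> x \<otimes> (inv t \<otimes> t) \<otimes> y \<otimes> inv t"
    using xy t by (simp only: m_assoc m_closed inv_closed mem_Collect_eq)
  also have "\<dots> = t \<otimes> (x \<otimes> y) \<otimes> inv t" using xy t by (simp add: m_assoc)
  finally show "x \<otimes> y \<in> {x \<in> carrier G. t \<otimes> x \<otimes> inv t \<in> M}"
    using xy subgroup.m_closed[OF M, of "t \<otimes> x \<otimes> inv t" "t \<otimes> y \<otimes> inv t"] by simp
qed auto

text \<open>Conjugation commutes with taking powers, so the elements that t conjugates into the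
  power subgroup form a subgroup containing every n-th power from K.\<close>

lemma conj_powers_subgroup:
  assumes t: "t \<in> carrier G" and K: "K \<subseteq> carrier G" and conj: "\<And>a. a \<in> K \<Longrightarrow> t \<otimes> a \<otimes> inv t \<in> K"
    and x: "x \<in> powers_subgroup n K"
  shows "t \<otimes> x \<otimes> inv t \<in> powers_subgroup n K"
proof -
  have "powers_subgroup n K \<subseteq> {x \<in> carrier G. t \<otimes> x \<otimes> inv t \<in> powers_subgroup n K}"
  proof (rule powers_subgroup_least[OF subgroup_conj_vimage[OF subgroup_powers[OF K] t]])
    fix a assume a: "a \<in> K"
    then have "t \<otimes> a [^] n \<otimes> inv t = (t \<otimes> a \<otimes> inv t) [^] n" using t K conj_nat_pow by blast
    also have "\<dots> \<in> powers_subgroup n K" by (rule pow_in_powers_subgroup[OF conj[OF a]])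
    finally show "a [^] n \<in> {x \<in> carrier G. t \<otimes> x \<otimes> inv t \<in> powers_subgroup n K}" using a K by auto
  qed
  with x show ?thesis by blast
qed

lemma normalizes_powers_subgroup:
  assumes t: "normalizes t K" and K: "K \<subseteq> carrier G"
  shows "normalizes t (powers_subgroup n K)"
  using conj_powers_subgroup[OF normalizesD(1)[OF t] K normalizesD(2)[OF t]]
    conj_powers_subgroup[OF normalizesD(1)[OF normalizes_inv[OF t]] K normalizesD(2)[OF normalizes_inv[OF t]]]
    normalizesD(1)[OF t]
  by (auto simp: normalizes_def)

lemma int_pow_div_mod:
  assumes "t \<in> carrier G"
  shows "t [^] (j::int) = t [^] (j mod int n) \<otimes> (t [^] (j div int n)) [^] n"
proof -
  have "(t [^] (j div int n)) [^] n = t [^] (j div int n * int n)"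
    using assms int_pow_pow[of t "j div int n" "int n"] by (simp add: int_pow_int)
  then show ?thesis using assms by (simp flip: int_pow_mult)
qed

text \<open>Division with remainder writes an element of K <t> as m f t^r (t^q)^n, with m in the
  power subgroup of K, f from a finite set and 0 <= r < n. Conjugating the n-th power by y = f t^r
  moves it to the left of y and keeps it in the power subgroup of K <t>. The finitely many elements
  f t^r then serve as representatives.\<close>

lemma polyc_powers_finite_index:
  assumes "polyc K" "n > 0"
  shows "covered_by K (powers_subgroup n K)"
  using assms(1)
proof induction
  case polyc_one
  have "covered_by {\<one>} {\<one>}" by (rule covered_by_refl) simp
  then show ?case using subgroup.one_closed[OF subgroup_powers[of "{\<one>}" n]] by (auto elim: covered_by_mono)
next
  case (polyc_extend K t)
  let ?L = "cyclic_extension K t"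
  let ?W = "powers_subgroup n ?L"
  have K: "subgroup K G" by (rule polyc_subgroup[OF polyc_extend(1)])
  have t: "t \<in> carrier G" by (rule normalizesD[OF polyc_extend(2)])
  have L: "subgroup ?L G" by (rule subgroup_cyclic_extension[OF K polyc_extend(2)])
  have Lc: "?L \<subseteq> carrier G" by (rule subgroup.subset[OF L])
  have KL: "K \<subseteq> ?L" by (rule subset_cyclic_extension[OF subgroup.subset[OF K] t])
  have W: "subgroup ?W G" by (rule subgroup_powers[OF Lc])
  have tL: "t \<in> ?L" by (rule generator_in_cyclic_extension[OF K t])
  obtain F where F: "finite F" "F \<subseteq> carrier G" "\<And>x. x \<in> K \<Longrightarrow> \<exists>m\<in>powers_subgroup n K. \<exists>f\<in>F. x = m \<otimes> f"
    using polyc_extend(3) unfolding covered_by_def by blast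
  let ?F = "(\<lambda>(f, r). f \<otimes> t [^] (r::int)) ` (F \<times> {0..<int n})"
  have "\<exists>m\<in>?W. \<exists>f\<in>?F. x = m \<otimes> f" if x: "x \<in> ?L" for x
  proof -
    obtain a j where a: "a \<in> K" "x = a \<otimes> t [^] (j::int)" using x by (rule cyclic_extensionE)
    obtain m f where m: "m \<in> powers_subgroup n K" "f \<in> F" "a = m \<otimes> f" using F(3)[OF a(1)] by blast
    have mW: "m \<in> ?W" using powers_subgroup_mono[OF KL] m(1) by blast
    have mK: "m \<in> K" using powers_subgroup_subset[OF K] m(1) by blast
    have mc: "m \<in> carrier G" and fc: "f \<in> carrier G" using mK subgroup.mem_carrier[OF K] F(2) m(2) by auto
    \<comment> \<open>The cover permits representatives outside K; this one lies in K, so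
      \<open>?y\<close> lies in \<open>?L\<close> and normalises \<open>?W\<close>.\<close>
    have "f = inv m \<otimes> a" using m(3) mc fc by (simp add: inv_cancel_left)
    then have fK: "f \<in> K" using subgroup.m_closed[OF K subgroup.m_inv_closed[OF K mK] a(1)] by simp
    let ?r = "t [^] (j mod int n)" and ?q = "t [^] (j div int n)"
    let ?y = "f \<otimes> ?r"
    have yL: "?y \<in> ?L" using fK KL subgroup_int_pow[OF L tL] subgroup.m_closed[OF L] by blast
    have yc: "?y \<in> carrier G" using yL Lc by blast
    have qL: "?q \<in> ?L" by (rule subgroup_int_pow[OF L tL])
    have qn: "?q [^] n \<in> ?W" by (rule pow_in_powers_subgroup[OF qL])
    have qc: "?q [^] n \<in> carrier G" using subgroup.mem_carrier[OF W qn] .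
    have "?y \<otimes> ?q [^] n \<otimes> inv ?y \<in> ?W"
      by (rule normalizesD(2)[OF normalizes_powers_subgroup[OF normalizes_subgroup[OF L yL] Lc] qn])
    then have "m \<otimes> (?y \<otimes> ?q [^] n \<otimes> inv ?y) \<in> ?W" using mW subgroup.m_closed[OF W] by blast
    moreover have "x = m \<otimes> (?y \<otimes> ?q [^] n \<otimes> inv ?y) \<otimes> ?y"
    proof -
      have "x = m \<otimes> f \<otimes> (?r \<otimes> ?q [^] n)" using a m int_pow_div_mod[OF t, of j n] by simp
      also have "\<dots> = m \<otimes> (?y \<otimes> ?q [^] n)" using mc fc t qc by (simp add: m_assoc)
      also have "\<dots> = m \<otimes> (?y \<otimes> ?q [^] n \<otimes> inv ?y) \<otimes> ?y" using mc yc qc by (simp add: m_assoc)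
      finally show ?thesis .
    qed
    moreover have "?y \<in> ?F" using m(2) assms(2) by (intro image_eqI[of _ _ "(f, j mod int n)"]) auto
    ultimately show ?thesis by blast
  qed
  moreover have "finite ?F" "?F \<subseteq> carrier G" using F t by auto
  ultimately show ?case unfolding covered_by_def by blast
qed

text \<open>Among the powers of x with exponents 0, ..., card F two share a representative, so some
  power of x with positive exponent at most card F lies in M. The factorial is a common multiple of
  all such exponents, which makes n independent of x.\<close>

lemma covered_by_power_mem:
  assumes M: "subgroup M G" and K: "subgroup K G" and cov: "covered_by K M"
  shows "\<exists>n::nat>0. \<forall>x\<in>K. x [^] n \<in> M"
proof -
  obtain F where F: "finite F" "F \<subseteq> carrier G" "\<And>x. x \<in> K \<Longrightarrow> \<exists>m\<in>M. \<exists>f\<in>F. x = m \<otimes> f"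
    using cov unfolding covered_by_def by blast
  let ?N = "card F"
  have "x [^] (fact ?N :: nat) \<in> M" if x: "x \<in> K" for x
  proof -
    have xc: "x \<in> carrier G" using x subgroup.mem_carrier[OF K] by blast
    have "\<forall>i. \<exists>f. f \<in> F \<and> (\<exists>m\<in>M. x [^] (i::nat) = m \<otimes> f)"
      using F(3)[OF subgroup_nat_pow[OF K x]] by blast
    then obtain h where h: "\<And>i. h i \<in> F" "\<And>i. \<exists>m\<in>M. x [^] (i::nat) = m \<otimes> h i" by metis
    have "\<not> inj_on h {0..?N}"
    proof
      assume "inj_on h {0..?N}"
      from card_inj_on_le[OF this _ F(1)] h(1) show False by auto
    qed
    then obtain i j where ij: "i < j" "j \<le> ?N" "h i = h j"
      unfolding inj_on_def by (metis atLeastAtMost_iff linorder_neqE_nat)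
    obtain m m' where m: "m \<in> M" "x [^] i = m \<otimes> h i" "m' \<in> M" "x [^] j = m' \<otimes> h i" using h(2) ij(3) by metis
    have mc: "m \<in> carrier G" "m' \<in> carrier G" using m subgroup.mem_carrier[OF M] by auto
    have hc: "h i \<in> carrier G" using h(1) F(2) by blast
    have "x [^] (j - i) \<otimes> x [^] i = x [^] j" using xc ij by (simp add: nat_pow_mult)
    then have "x [^] (j - i) = x [^] j \<otimes> inv (x [^] i)" using xc by (simp add: inv_solve_right)
    also have "\<dots> = m' \<otimes> inv m" using m mc hc by (simp add: inv_mult_group m_assoc inv_cancel_left)
    finally have "x [^] (j - i) \<in> M"
      using m subgroup.m_closed[OF M _ subgroup.m_inv_closed[OF M]] by simp
    moreover have "(j - i) dvd fact ?N" using ij by (intro dvd_fact) auto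
    then obtain c where "fact ?N = (j - i) * c" by blast
    then have "x [^] (fact ?N :: nat) = (x [^] (j - i)) [^] c" using xc by (simp add: nat_pow_pow)
    ultimately show ?thesis using subgroup_nat_pow[OF M] by simp
  qed
  then show ?thesis by (intro exI[of _ "fact ?N"]) simp
qed

section \<open>Separating an element by a subgroup of finite index\<close>

lemma int_pow_in_zero:
  assumes K: "subgroup K G" and t: "t \<in> carrier G" and none: "\<And>k::nat. k > 0 \<Longrightarrow> t [^] k \<notin> K"
    and mem: "t [^] (i::int) \<in> K"
  shows "i = 0"
proof (rule ccontr)
  assume "i \<noteq> 0"
  have "t [^] (- i) \<in> K" using subgroup.m_inv_closed[OF K mem] t by (simp add: int_pow_neg)
  with mem have "t [^] (int (nat \<bar>i\<bar>)) \<in> K" by (cases "i \<ge> 0") auto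
  then show False using none[of "nat \<bar>i\<bar>"] \<open>i \<noteq> 0\<close> by (simp add: int_pow_int)
qed

lemma covered_by_cyclic_extension_torsion:
  assumes K: "subgroup K G" and t: "t \<in> carrier G" and k: "k > 0" "t [^] (k::nat) \<in> K"
  shows "covered_by (cyclic_extension K t) K"
  unfolding covered_by_def
proof (intro exI conjI ballI)
  let ?F = "(\<lambda>r. t [^] (r::int)) ` {0..<int k}"
  show "finite ?F" "?F \<subseteq> carrier G" using t by auto
  fix x assume "x \<in> cyclic_extension K t"
  then obtain a j where a: "a \<in> K" "x = a \<otimes> t [^] (j::int)" by (rule cyclic_extensionE)
  have q: "t [^] (int k * (j div int k)) \<in> K"
    using subgroup_int_pow[OF K k(2), of "j div int k"] t int_pow_pow[of t "int k" "j div int k"] by (simp add: int_pow_int)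
  have "x = (a \<otimes> t [^] (int k * (j div int k))) \<otimes> t [^] (j mod int k)"
    using a t subgroup.mem_carrier[OF K a(1)] by (simp add: m_assoc flip: int_pow_mult)
  then show "\<exists>m\<in>K. \<exists>f\<in>?F. x = m \<otimes> f"
    using subgroup.m_closed[OF K a(1) q] k(1) by (metis atLeastLessThan_iff imageI pos_mod_bound pos_mod_sign of_nat_0_less_iff)
qed

text \<open>It suffices to find M of finite index in L = K <t> that misses g, since some uniform
  power of L lies in M. If a positive power of t lies in K, then K has finite index in L, and M is K
  itself or a power subgroup of K. Otherwise the exponent of t in an element of L is unique. For g
  in K the power subgroup P of K from the induction hypothesis is enlarged to P <t>, which meets K
  only in P. For g outside K, M is K <t^e> with e not dividing the exponent of t in g.\<close>

lemma polyc_residually_finite: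
  assumes "polyc K" "g \<in> K" "g \<noteq> \<one>"
  shows "\<exists>n>0. g \<notin> powers_subgroup n K"
  using assms
proof (induction arbitrary: g)
  case polyc_one
  then show ?case by simp
next
  case (polyc_extend K t)
  let ?L = "cyclic_extension K t"
  have K: "subgroup K G" by (rule polyc_subgroup[OF polyc_extend(1)])
  have Kc: "K \<subseteq> carrier G" by (rule subgroup.subset[OF K])
  have t: "t \<in> carrier G" by (rule normalizesD[OF polyc_extend(2)])
  have L: "subgroup ?L G" by (rule subgroup_cyclic_extension[OF K polyc_extend(2)])
  have "\<exists>M. subgroup M G \<and> covered_by ?L M \<and> g \<notin> M"
  proof (cases "\<exists>k>0. t [^] (k::nat) \<in> K")
    case True
    then obtain k :: nat where k: "k > 0" "t [^] k \<in> K" by blast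
    have cov: "covered_by ?L K" by (rule covered_by_cyclic_extension_torsion[OF K t k])
    show ?thesis
    proof (cases "g \<in> K")
      case True
      then obtain n where n: "n > 0" "g \<notin> powers_subgroup n K" using polyc_extend(3,5) by blast
      have M: "subgroup (powers_subgroup n K) G" by (rule subgroup_powers[OF Kc])
      show ?thesis
        using covered_by_trans[OF cov polyc_powers_finite_index[OF polyc_extend(1) n(1)] subgroup.subset[OF M]] M n(2)
        by blast
    next
      case False
      then show ?thesis using cov K by blast
    qed
  next
    case False
    then have zero: "i = 0" if "t [^] (i::int) \<in> K" for i using int_pow_in_zero[OF K t _ that] by blast
    show ?thesis
    proof (cases "g \<in> K")
      case True
      then obtain n where n: "n > 0" "g \<notin> powers_subgroup n K" using polyc_extend(3,5) by blast
      let ?P = "powers_subgroup n K"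
      let ?M = "cyclic_extension ?P t"
      have M0: "subgroup ?P G" by (rule subgroup_powers[OF Kc])
      have M0K: "?P \<subseteq> K" by (rule powers_subgroup_subset[OF K])
      have nt: "normalizes t ?P" by (rule normalizes_powers_subgroup[OF polyc_extend(2) Kc])
      have M: "subgroup ?M G" by (rule subgroup_cyclic_extension[OF M0 nt])
      have "g \<notin> ?M"
      proof
        assume "g \<in> ?M"
        then obtain b i where b: "b \<in> ?P" "g = b \<otimes> t [^] (i::int)" by (rule cyclic_extensionE)
        have bK: "b \<in> K" using b M0K by blast
        have "t [^] i = inv b \<otimes> g" using b(2) subsetD[OF Kc bK] t by (simp add: inv_cancel_left)
        then have "t [^] i \<in> K" using subgroup.m_closed[OF K subgroup.m_inv_closed[OF K bK] True] by simp
        from zero[OF this] have "g = b" using b(2) subsetD[OF Kc bK] by simp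
        with b(1) n(2) show False by simp
      qed
      moreover have "covered_by ?L ?M"
      proof -
        obtain F where F: "finite F" "F \<subseteq> carrier G" "\<And>x. x \<in> K \<Longrightarrow> \<exists>m\<in>?P. \<exists>f\<in>F. x = m \<otimes> f"
          using polyc_powers_finite_index[OF polyc_extend(1) n(1)] unfolding covered_by_def by blast
        have "\<exists>m\<in>?M. \<exists>f\<in>F. x = m \<otimes> f" if x: "x \<in> ?L" for x
        proof -
          obtain a j where a: "a \<in> K" "x = a \<otimes> t [^] (j::int)" using x by (rule cyclic_extensionE)
          let ?u = "t [^] j"
          have u: "?u \<in> carrier G" using t by simp
          have ac: "a \<in> carrier G" using a Kc by blast
          \<comment> \<open>The element a t^j is rewritten with t^j in front, so that the
            representative f obtained from K ends up on the far right, and m, conjugated by t^j,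
            stays in \<open>?P\<close>.\<close>
          have "inv ?u \<otimes> a \<otimes> ?u \<in> K" by (rule normalizesD(3)[OF normalizes_int_pow[OF polyc_extend(2) Kc] a(1)])
          then obtain m f where m: "m \<in> ?P" "f \<in> F" "inv ?u \<otimes> a \<otimes> ?u = m \<otimes> f" using F(3) by blast
          have mc: "m \<in> carrier G" and fc: "f \<in> carrier G" using m M0K Kc F(2) by auto
          have "x = ?u \<otimes> (inv ?u \<otimes> a \<otimes> ?u)" using a(2) u ac by (simp add: m_assoc[symmetric])
          also have "\<dots> = ((?u \<otimes> m \<otimes> inv ?u) \<otimes> ?u) \<otimes> f" unfolding m(3) using u mc fc by (simp add: m_assoc)
          finally have "x = ((?u \<otimes> m \<otimes> inv ?u) \<otimes> ?u) \<otimes> f" .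
          moreover have "(?u \<otimes> m \<otimes> inv ?u) \<otimes> ?u \<in> ?M"
            by (rule cyclic_extensionI[OF normalizesD(2)[OF normalizes_int_pow[OF nt subgroup.subset[OF M0]] m(1)]])
          ultimately show ?thesis using m(2) by blast
        qed
        then show ?thesis using F(1,2) unfolding covered_by_def by blast
      qed
      ultimately show ?thesis using M by blast
    next
      case False
      obtain a j where a: "a \<in> K" "g = a \<otimes> t [^] (j::int)" using polyc_extend(4) by (rule cyclic_extensionE)
      have j: "j \<noteq> 0" using a False Kc by auto
      \<comment> \<open>Any positive number that does not divide j would do; 2 |j| is one, because j
        is nonzero.\<close>
      define e where "e = 2 * nat \<bar>j\<bar>"
      have e: "e > 0" "int e = 2 * \<bar>j\<bar>" using j by (auto simp: e_def)
      let ?u = "t [^] e"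
      let ?M = "cyclic_extension K ?u"
      have nu: "normalizes ?u K" using normalizes_int_pow[OF polyc_extend(2) Kc, of "int e"] by (simp add: int_pow_int)
      have M: "subgroup ?M G" by (rule subgroup_cyclic_extension[OF K nu])
      have upow: "?u [^] (q::int) = t [^] (int e * q)" for q
        using int_pow_pow[OF t, of "int e" q] by (simp add: int_pow_int)
      have "g \<notin> ?M"
      proof
        assume "g \<in> ?M"
        then obtain b q where b: "b \<in> K" "g = b \<otimes> ?u [^] (q::int)" by (rule cyclic_extensionE)
        have bc: "b \<in> carrier G" and ac: "a \<in> carrier G" using a b Kc by auto
        have "a \<otimes> t [^] j = b \<otimes> t [^] (int e * q)" using a(2) b(2) upow by simp
        then have "t [^] j = inv a \<otimes> b \<otimes> t [^] (int e * q)" using ac bc t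
          by (metis inv_cancel_left(1) int_pow_closed inv_closed m_assoc)
        then have "t [^] j \<otimes> inv (t [^] (int e * q)) = inv a \<otimes> b" using ac bc t by (simp add: m_assoc)
        then have "t [^] (j - int e * q) = inv a \<otimes> b" using t by (simp add: int_pow_diff)
        then have "t [^] (j - int e * q) \<in> K"
          using subgroup.m_closed[OF K subgroup.m_inv_closed[OF K a(1)] b(1)] by simp
        from zero[OF this] have "j = 2 * \<bar>j\<bar> * q" using e by simp
        then have "\<bar>j\<bar> * 1 = \<bar>j\<bar> * (2 * \<bar>q\<bar>)" by (metis abs_abs abs_mult abs_numeral mult.assoc mult.commute mult.right_neutral)
        then have "1 = 2 * \<bar>q\<bar>" using j unfolding mult_cancel_left by simp
        then show False by presburger
      qed
      moreover have "covered_by ?L ?M"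
        unfolding covered_by_def
      proof (intro exI conjI ballI)
        let ?F = "(\<lambda>r. t [^] (r::int)) ` {0..<int e}"
        show "finite ?F" "?F \<subseteq> carrier G" using t by auto
        fix x assume "x \<in> ?L"
        then obtain b i where b: "b \<in> K" "x = b \<otimes> t [^] (i::int)" by (rule cyclic_extensionE)
        have "x = (b \<otimes> ?u [^] (i div int e)) \<otimes> t [^] (i mod int e)"
          using b t Kc upow by (auto simp: m_assoc subset_iff simp flip: int_pow_mult)
        moreover have "t [^] (i mod int e) \<in> ?F" using e(1) by simp
        ultimately show "\<exists>m\<in>?M. \<exists>f\<in>?F. x = m \<otimes> f" using cyclic_extensionI[OF b(1)] by blast
      qed
      ultimately show ?thesis using M by blast
    qed
  qed
  then obtain M where M: "subgroup M G" "covered_by ?L M" "g \<notin> M" by blast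
  obtain n :: nat where n: "n > 0" "\<forall>x\<in>?L. x [^] n \<in> M"
    using covered_by_power_mem[OF M(1) L M(2)] by blast
  have "powers_subgroup n ?L \<subseteq> M" by (rule powers_subgroup_least[OF M(1)]) (use n(2) in blast)
  then show ?case using n(1) M(3) by blast
qed

lemma powers_subgroup_dvd:
  assumes "K \<subseteq> carrier G" "n dvd m"
  shows "powers_subgroup m K \<subseteq> powers_subgroup n K"
proof (rule powers_subgroup_least[OF subgroup_powers[OF assms(1)]])
  fix x assume x: "x \<in> K"
  obtain c where c: "m = n * c" using assms(2) by blast
  have "x [^] m = (x [^] n) [^] c" using x assms(1) c by (auto simp: nat_pow_pow)
  then show "x [^] m \<in> powers_subgroup n K"
    using subgroup_nat_pow[OF subgroup_powers[OF assms(1)] pow_in_powers_subgroup[OF x]] by simp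
qed

text \<open>Exponents for the single elements are multiplied: the power subgroup for n m lies in
  those for n and for m.\<close>

lemma polyc_powers_avoid_finite:
  assumes K: "polyc K" and A: "finite A" "A \<subseteq> K - {\<one>}"
  shows "\<exists>n>0. powers_subgroup n K \<inter> A = {}"
  using A
proof (induction A)
  case empty
  then show ?case by (intro exI[of _ 1]) auto
next
  case (insert a A)
  then obtain n where n: "n > 0" "powers_subgroup n K \<inter> A = {}" by auto
  obtain m where m: "m > 0" "a \<notin> powers_subgroup m K"
    using polyc_residually_finite[OF K, of a] insert by auto
  note dvd = powers_subgroup_dvd[OF subgroup.subset[OF polyc_subgroup[OF K]]]
  have "powers_subgroup (n * m) K \<inter> insert a A = {}"
    using n(2) m(2) dvd[of n "n * m"] dvd[of m "n * m"] by auto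
  then show ?case using n(1) m(1) by (intro exI[of _ "n * m"]) simp
qed

end

section \<open>Cosets and polycyclic groups in terms of \<open>covered_by\<close> and
  \<open>polyc\<close>\<close>

context group
begin

lemma finite_rcosets_iff_covered_by:
  assumes H: "subgroup H G"
  shows "finite (rcosets H) \<longleftrightarrow> covered_by (carrier G) H"
proof
  assume fin: "finite (rcosets H)"
  have Hc: "H \<subseteq> carrier G" by (rule subgroup.subset[OF H])
  have "\<forall>C\<in>rcosets H. \<exists>x. x \<in> carrier G \<and> C = H #> x" by (auto simp: RCOSETS_def)
  then obtain r where r: "\<And>C. C \<in> rcosets H \<Longrightarrow> r C \<in> carrier G \<and> C = H #> r C" by metis
  have "\<exists>m\<in>H. \<exists>f\<in>r ` (rcosets H). x = m \<otimes> f" if x: "x \<in> carrier G" for x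
  proof -
    have C: "H #> x \<in> rcosets H" using x by (auto simp: RCOSETS_def)
    have "x \<in> H #> x" by (rule rcos_self[OF x H])
    then have "x \<in> H #> r (H #> x)" using r[OF C] by simp
    then show ?thesis using C unfolding r_coset_def by blast
  qed
  moreover have "finite (r ` (rcosets H))" "r ` (rcosets H) \<subseteq> carrier G" using fin r by auto
  ultimately show "covered_by (carrier G) H" unfolding covered_by_def by blast
next
  assume "covered_by (carrier G) H"
  then obtain F where F: "finite F" "F \<subseteq> carrier G" "\<And>x. x \<in> carrier G \<Longrightarrow> \<exists>m\<in>H. \<exists>f\<in>F. x = m \<otimes> f"
    unfolding covered_by_def by blast
  have "rcosets H \<subseteq> (\<lambda>f. H #> f) ` F"
  proof
    fix C assume "C \<in> rcosets H"
    then obtain x where x: "x \<in> carrier G" "C = H #> x" by (auto simp: RCOSETS_def)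
    obtain m f where mf: "m \<in> H" "f \<in> F" "x = m \<otimes> f" using F(3)[OF x(1)] by blast
    have fc: "f \<in> carrier G" using mf F by blast
    have "x \<in> H #> f" using mf unfolding r_coset_def by blast
    then have "H #> f = H #> x" using repr_independence[OF _ fc H] by blast
    then show "C \<in> (\<lambda>f. H #> f) ` F" using mf(2) x(2) by blast
  qed
  then show "finite (rcosets H)" using F(1) finite_surj by blast
qed

text \<open>Generators of H together with coset representatives generate. The finite generating set
  is what lets \<open>annihilates_cycles_imp_torsion\<close> stop after finitely many
  extensions.\<close>

lemma polyc_covered_finitely_generated:
  assumes H: "polyc H" and cov: "covered_by (carrier G) H"
  obtains X where "finite X" "X \<subseteq> carrier G" "generate G X = carrier G"
proof -
  obtain X where X: "finite X" "X \<subseteq> carrier G" "generate G X = H"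
    using polyc_finitely_generated[OF H] by blast
  obtain F where F: "finite F" "F \<subseteq> carrier G" "\<And>x. x \<in> carrier G \<Longrightarrow> \<exists>m\<in>H. \<exists>f\<in>F. x = m \<otimes> f"
    using cov unfolding covered_by_def by blast
  have XF: "X \<union> F \<subseteq> carrier G" using X F by blast
  have sub: "subgroup (generate G (X \<union> F)) G" by (rule generate_is_subgroup[OF XF])
  have "carrier G \<subseteq> generate G (X \<union> F)"
  proof
    fix x assume "x \<in> carrier G"
    then obtain m f where mf: "m \<in> H" "f \<in> F" "x = m \<otimes> f" using F(3) by blast
    have "m \<in> generate G (X \<union> F)" using mf(1) X(3) mono_generate[of X "X \<union> F"] by blast
    moreover have "f \<in> generate G (X \<union> F)" using mf(2) by (intro generate.incl) blast
    ultimately show "x \<in> generate G (X \<union> F)" using mf(3) subgroup.m_closed[OF sub] by blast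
  qed
  then have "generate G (X \<union> F) = carrier G" using subgroup.subset[OF sub] by blast
  then show ?thesis using that[of "X \<union> F"] X F XF by blast
qed

lemma int_pow_restrict_carrier:
  assumes "subgroup H G" "x \<in> H"
  shows "x [^]\<^bsub>G\<lparr>carrier := H\<rparr>\<^esub> (n::int) = x [^] n"
  using int_pow_consistent[OF assms] by simp

text \<open>If t represents a generator of the cyclic quotient T / S, then T = S <t>.\<close>

lemma polyc_cyclic_quotient:
  assumes T: "subgroup T G" and S: "subgroup S G" and ST: "S \<lhd> G\<lparr>carrier := T\<rparr>"
    and cyc: "cyclic_group (G\<lparr>carrier := T\<rparr> Mod S)" and p: "polyc S"
  shows "polyc T"
proof -
  let ?T = "G\<lparr>carrier := T\<rparr>"
  interpret T: group ?T by (rule subgroup_imp_group[OF T])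
  interpret N: normal S ?T by (rule ST)
  interpret Q: group "?T Mod S" by (rule N.factorgroup_is_group)
  obtain C where C: "C \<in> carrier (?T Mod S)" "carrier (?T Mod S) = range (\<lambda>n::int. C [^]\<^bsub>?T Mod S\<^esub> n)"
    using cyc Q.cyclic_group by blast
  obtain t where t: "t \<in> T" "C = S #>\<^bsub>?T\<^esub> t" using C(1) by (auto simp: carrier_FactGroup)
  have Sc: "S \<subseteq> T" using N.subset by simp
  have Tc: "T \<subseteq> carrier G" by (rule subgroup.subset[OF T])
  have tc: "t \<in> carrier G" using t Tc by blast
  have inv_t: "inv\<^bsub>?T\<^esub> t = inv t" using m_inv_consistent[OF T t(1)] by simp
  have nt: "normalizes t S"
    unfolding normalizes_def
  proof (intro conjI ballI tc)
    fix a assume a: "a \<in> S"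
    show "t \<otimes> a \<otimes> inv t \<in> S" using N.inv_op_closed2[of t a] t a inv_t by simp
    show "inv t \<otimes> a \<otimes> t \<in> S" using N.inv_op_closed1[of t a] t a inv_t by simp
  qed
  have "T = cyclic_extension S t"
  proof
    show "cyclic_extension S t \<subseteq> T"
      using Sc subgroup_int_pow[OF T t(1)] subgroup.m_closed[OF T] by (auto elim!: cyclic_extensionE)
    show "T \<subseteq> cyclic_extension S t"
    proof
      fix x assume x: "x \<in> T"
      have "S #>\<^bsub>?T\<^esub> x \<in> carrier (?T Mod S)" using x by (auto simp: carrier_FactGroup)
      then obtain n :: int where "S #>\<^bsub>?T\<^esub> x = C [^]\<^bsub>?T Mod S\<^esub> n" using C(2) by auto
      also have "\<dots> = S #>\<^bsub>?T\<^esub> (t [^]\<^bsub>?T\<^esub> n)" unfolding t(2) by (rule N.FactGroup_int_pow) (use t in simp)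
      finally have "S #>\<^bsub>?T\<^esub> x = S #>\<^bsub>?T\<^esub> (t [^] n)" by (simp add: int_pow_restrict_carrier[OF T t(1)])
      moreover have "x \<in> S #>\<^bsub>?T\<^esub> x" by (rule T.rcos_self[OF _ N.subgroup_axioms]) (use x in simp)
      ultimately have "x \<in> S #>\<^bsub>?T\<^esub> (t [^] n)" by simp
      then obtain a where "a \<in> S" "x = a \<otimes> t [^] n" by (auto simp: r_coset_def)
      then show "x \<in> cyclic_extension S t" using cyclic_extensionI by simp
    qed
  qed
  then show ?thesis using polyc_extend[OF p nt] by simp
qed

lemma polyc_of_polycyclic:
  assumes H: "subgroup H G" and poly: "polycyclic (G\<lparr>carrier := H\<rparr>)"
  shows "polyc H"
proof -
  let ?H = "G\<lparr>carrier := H\<rparr>"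
  obtain m :: nat and S where S: "S 1 = H" "S (m + 1) = {\<one>}"
      "\<And>i. i \<in> {1..m + 1} \<Longrightarrow> subgroup (S i) ?H"
      "\<And>i. i \<in> {1..m} \<Longrightarrow> S (i + 1) \<lhd> ?H\<lparr>carrier := S i\<rparr> \<and> cyclic_group (?H\<lparr>carrier := S i\<rparr> Mod S (i + 1))"
    using poly unfolding polycyclic_def by auto
  have sub: "subgroup (S i) G" if "i \<in> {1..m + 1}" for i
    using incl_subgroup[OF H S(3)[OF that]] .
  \<comment> \<open>The given series descends from index 1 to m + 1, while \<open>polyc\<close>
    builds upwards; k is the distance from the trivial end.\<close>
  have "polyc (S (m + 1 - k))" if "k \<le> m" for k
    using that
  proof (induction k)
    case 0
    then show ?case using S(2) polyc_one by simp
  next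
    case (Suc k)
    define i where "i = m - k"
    have i: "i \<in> {1..m}" "m + 1 - Suc k = i" "m + 1 - k = i + 1" using Suc.prems by (auto simp: i_def)
    have "polyc (S (i + 1))" using Suc i by simp
    moreover have "subgroup (S i) G" "subgroup (S (i + 1)) G" using sub i(1) by auto
    ultimately show ?case unfolding i(2) using polyc_cyclic_quotient S(4)[OF i(1)] by simp
  qed
  from this[of m] S(1) show ?thesis by simp
qed

end

section \<open>Preimages under surjective homomorphisms\<close>

text \<open>The series is pulled back step by step. The trivial subgroup pulls back to the cyclic
  kernel, which becomes a new lowest step generated by c, and each later generator t is replaced by
  a lift.\<close>

lemma polyc_vimage:
  assumes "group E" "group G" and q: "q \<in> hom E G" "q ` carrier E = carrier G"
    and c: "c \<in> carrier E" "kernel E G q = range (\<lambda>j::int. c [^]\<^bsub>E\<^esub> j)"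
    and K: "group.polyc G K"
  shows "group.polyc E {x \<in> carrier E. q x \<in> K}"
proof -
  interpret E: group E by fact
  interpret G: group G by fact
  interpret q: group_hom E G q by unfold_locales (rule q(1))
  show ?thesis
    using K
  proof (induction rule: G.polyc.induct)
    case polyc_one
    have "{x \<in> carrier E. q x \<in> {\<one>\<^bsub>G\<^esub>}} = E.cyclic_extension {\<one>\<^bsub>E\<^esub>} c"
    proof -
      have "{x \<in> carrier E. q x \<in> {\<one>\<^bsub>G\<^esub>}} = range (\<lambda>j::int. c [^]\<^bsub>E\<^esub> j)"
        using c(2) by (auto simp: kernel_def)
      also have "\<dots> = E.cyclic_extension {\<one>\<^bsub>E\<^esub>} c" using c(1) by (auto simp: E.cyclic_extension_def)
      finally show ?thesis .
    qed
    moreover have "E.normalizes c {\<one>\<^bsub>E\<^esub>}" using c(1) by (simp add: E.normalizes_def)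
    ultimately show ?case using E.polyc_extend[OF E.polyc_one] by simp
  next
    case (polyc_extend K t)
    have K: "subgroup K G" by (rule G.polyc_subgroup[OF polyc_extend(1)])
    note t = G.normalizesD[OF polyc_extend(2)]
    obtain t' where t': "t' \<in> carrier E" "q t' = t" using t(1) q(2) by (metis imageE)
    let ?K = "{x \<in> carrier E. q x \<in> K}"
    have "E.normalizes t' ?K" unfolding E.normalizes_def using t' t by auto
    moreover have "{x \<in> carrier E. q x \<in> G.cyclic_extension K t} = E.cyclic_extension ?K t'"
    proof
      show "E.cyclic_extension ?K t' \<subseteq> {x \<in> carrier E. q x \<in> G.cyclic_extension K t}"
        using t' by (auto simp: q.hom_int_pow G.cyclic_extensionI elim!: E.cyclic_extensionE)
      show "{x \<in> carrier E. q x \<in> G.cyclic_extension K t} \<subseteq> E.cyclic_extension ?K t'"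
      proof
        fix x assume x: "x \<in> {x \<in> carrier E. q x \<in> G.cyclic_extension K t}"
        then obtain a j where a: "a \<in> K" "q x = a \<otimes>\<^bsub>G\<^esub> t [^]\<^bsub>G\<^esub> (j::int)" by (auto elim: G.cyclic_extensionE)
        let ?y = "x \<otimes>\<^bsub>E\<^esub> inv\<^bsub>E\<^esub> (t' [^]\<^bsub>E\<^esub> j)"
        have ac: "a \<in> carrier G" using a K subgroup.mem_carrier by metis
        have "q ?y = a" using x a ac t(1) t' by (simp add: q.hom_int_pow G.m_assoc)
        then have "?y \<in> ?K" using x t' a(1) by simp
        moreover have "x = ?y \<otimes>\<^bsub>E\<^esub> t' [^]\<^bsub>E\<^esub> j" using x t' by (simp add: E.m_assoc)
        ultimately show "x \<in> E.cyclic_extension ?K t'" using E.cyclic_extensionI by metis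
      qed
    qed
    ultimately show ?case using E.polyc_extend[OF polyc_extend(3)] by simp
  qed
qed

lemma covered_by_vimage:
  assumes "group E" "group G" and q: "q \<in> hom E G" "q ` carrier E = carrier G"
    and H: "subgroup H G" and cov: "group.covered_by G (carrier G) H"
  shows "group.covered_by E (carrier E) {x \<in> carrier E. q x \<in> H}"
proof -
  interpret E: group E by fact
  interpret G: group G by fact
  interpret q: group_hom E G q by unfold_locales (rule q(1))
  obtain F where F: "finite F" "F \<subseteq> carrier G" "\<And>x. x \<in> carrier G \<Longrightarrow> \<exists>m\<in>H. \<exists>f\<in>F. x = m \<otimes>\<^bsub>G\<^esub> f"
    using cov unfolding G.covered_by_def by blast
  have "\<forall>f\<in>F. \<exists>e. e \<in> carrier E \<and> q e = f" using F(2) unfolding q(2)[symmetric] by auto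
  then obtain l where l: "\<And>f. f \<in> F \<Longrightarrow> l f \<in> carrier E \<and> q (l f) = f" by metis
  have "\<exists>m\<in>{x \<in> carrier E. q x \<in> H}. \<exists>f\<in>l ` F. x = m \<otimes>\<^bsub>E\<^esub> f" if x: "x \<in> carrier E" for x
  proof -
    obtain m f where mf: "m \<in> H" "f \<in> F" "q x = m \<otimes>\<^bsub>G\<^esub> f" using F(3)[of "q x"] x by auto
    have fc: "f \<in> carrier G" using mf F by blast
    have mc: "m \<in> carrier G" using mf(1) H subgroup.mem_carrier by metis
    let ?y = "x \<otimes>\<^bsub>E\<^esub> inv\<^bsub>E\<^esub> (l f)"
    have "q ?y = m" using x mf l[OF mf(2)] fc mc by (simp add: G.m_assoc)
    then have "?y \<in> {x \<in> carrier E. q x \<in> H}" using x l[OF mf(2)] mf(1) by simp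
    moreover have "x = ?y \<otimes>\<^bsub>E\<^esub> l f" using x l[OF mf(2)] by (simp add: E.m_assoc)
    ultimately show ?thesis using mf(2) by blast
  qed
  moreover have "finite (l ` F)" "l ` F \<subseteq> carrier E" using F(1) l by auto
  ultimately show ?thesis unfolding E.covered_by_def by blast
qed

section \<open>The central extension attached to a cocycle\<close>

text \<open>Cocycles are unnormalised here, so (1, 0) is in general not neutral; this is the origin
  of the correction by the value of s at the pair of identities, here and in
  \<open>cocycle_embedding\<close>.\<close>

definition cocycle_extension :: "('a, 'm) monoid_scheme \<Rightarrow> ('a \<times> 'a \<Rightarrow> int) \<Rightarrow> ('a \<times> int) monoid" where
  "cocycle_extension G s =
     \<lparr>carrier = carrier G \<times> UNIV,
      monoid.mult = (\<lambda>(g, a) (h, b). (g \<otimes>\<^bsub>G\<^esub> h, a + b + s (g, h))),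
      one = (\<one>\<^bsub>G\<^esub>, - s (\<one>\<^bsub>G\<^esub>, \<one>\<^bsub>G\<^esub>))\<rparr>"

definition cocycle_embedding :: "('a, 'm) monoid_scheme \<Rightarrow> ('a \<times> 'a \<Rightarrow> int) \<Rightarrow> int \<Rightarrow> 'a \<times> int" where
  "cocycle_embedding G s n = (\<one>\<^bsub>G\<^esub>, n - s (\<one>\<^bsub>G\<^esub>, \<one>\<^bsub>G\<^esub>))"

lemma cocycle_extension_simps [simp]:
  "carrier (cocycle_extension G s) = carrier G \<times> UNIV"
  "(g, a) \<otimes>\<^bsub>cocycle_extension G s\<^esub> (h, b) = (g \<otimes>\<^bsub>G\<^esub> h, a + b + s (g, h))"
  "\<one>\<^bsub>cocycle_extension G s\<^esub> = (\<one>\<^bsub>G\<^esub>, - s (\<one>\<^bsub>G\<^esub>, \<one>\<^bsub>G\<^esub>))"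
  by (simp_all add: cocycle_extension_def)

lemma cocycles2D:
  assumes "s \<in> cocycles2 G" "g \<in> carrier G" "h \<in> carrier G" "k \<in> carrier G"
  shows "s (h, k) + s (g, h \<otimes>\<^bsub>G\<^esub> k) = s (g \<otimes>\<^bsub>G\<^esub> h, k) + s (g, h)"
proof -
  have "s (h, k) - s (g \<otimes>\<^bsub>G\<^esub> h, k) + s (g, h \<otimes>\<^bsub>G\<^esub> k) - s (g, h) = 0"
    using assms unfolding cocycles2_def by blast
  then show ?thesis by linarith
qed

lemma cocycles2_one:
  assumes "group G" "s \<in> cocycles2 G" "g \<in> carrier G"
  shows "s (\<one>\<^bsub>G\<^esub>, g) = s (\<one>\<^bsub>G\<^esub>, \<one>\<^bsub>G\<^esub>)" "s (g, \<one>\<^bsub>G\<^esub>) = s (\<one>\<^bsub>G\<^esub>, \<one>\<^bsub>G\<^esub>)"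
proof -
  interpret group G by fact
  show "s (\<one>\<^bsub>G\<^esub>, g) = s (\<one>\<^bsub>G\<^esub>, \<one>\<^bsub>G\<^esub>)" using cocycles2D[OF assms(2), of "\<one>\<^bsub>G\<^esub>" "\<one>\<^bsub>G\<^esub>" g] assms(3) by simp
  show "s (g, \<one>\<^bsub>G\<^esub>) = s (\<one>\<^bsub>G\<^esub>, \<one>\<^bsub>G\<^esub>)" using cocycles2D[OF assms(2), of g "\<one>\<^bsub>G\<^esub>" "\<one>\<^bsub>G\<^esub>"] assms(3) by simp
qed

lemma group_cocycle_extension:
  assumes G: "group G" and s: "s \<in> cocycles2 G"
  shows "group (cocycle_extension G s)"
proof -
  interpret group G by fact
  show ?thesis
  proof (rule groupI)
    fix x y z
    assume x: "x \<in> carrier (cocycle_extension G s)" "y \<in> carrier (cocycle_extension G s)" "z \<in> carrier (cocycle_extension G s)"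
    show "x \<otimes>\<^bsub>cocycle_extension G s\<^esub> y \<otimes>\<^bsub>cocycle_extension G s\<^esub> z =
          x \<otimes>\<^bsub>cocycle_extension G s\<^esub> (y \<otimes>\<^bsub>cocycle_extension G s\<^esub> z)"
      using x cocycles2D[OF s, of "fst x" "fst y" "fst z"]
      by (cases x rule: prod.exhaust; cases y rule: prod.exhaust; cases z rule: prod.exhaust) (auto simp: m_assoc)
  next
    fix x assume x: "x \<in> carrier (cocycle_extension G s)"
    show "\<one>\<^bsub>cocycle_extension G s\<^esub> \<otimes>\<^bsub>cocycle_extension G s\<^esub> x = x"
      using x cocycles2_one(1)[OF G s, of "fst x"] by (cases x rule: prod.exhaust) auto
    obtain g a where ga: "x = (g, a)" "g \<in> carrier G" using x by (cases x rule: prod.exhaust) auto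
    \<comment> \<open>The second entry b of the witness solves b + a + s (inv g, g) = - s (1, 1),
      the second entry of the neutral element.\<close>
    show "\<exists>y\<in>carrier (cocycle_extension G s). y \<otimes>\<^bsub>cocycle_extension G s\<^esub> x = \<one>\<^bsub>cocycle_extension G s\<^esub>"
      by (rule bexI[of _ "(inv\<^bsub>G\<^esub> g, - a - s (inv\<^bsub>G\<^esub> g, g) - s (\<one>\<^bsub>G\<^esub>, \<one>\<^bsub>G\<^esub>))"]) (use ga in auto)
  qed auto
qed

lemma cocycle_embedding_mult:
  assumes "group G" "s \<in> cocycles2 G" "g \<in> carrier G"
  shows "cocycle_embedding G s n \<otimes>\<^bsub>cocycle_extension G s\<^esub> (g, a) = (g, n + a)"
    "(g, a) \<otimes>\<^bsub>cocycle_extension G s\<^esub> cocycle_embedding G s n = (g, n + a)"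
proof -
  interpret group G by fact
  show "cocycle_embedding G s n \<otimes>\<^bsub>cocycle_extension G s\<^esub> (g, a) = (g, n + a)"
    "(g, a) \<otimes>\<^bsub>cocycle_extension G s\<^esub> cocycle_embedding G s n = (g, n + a)"
    using cocycles2_one[OF assms] assms(3) by (simp_all add: cocycle_embedding_def)
qed

lemma central_extension_cocycle_extension:
  assumes G: "group G" and s: "s \<in> cocycles2 G"
  shows "central_extension G (cocycle_extension G s) (cocycle_embedding G s) fst"
proof -
  interpret group G by fact
  interpret E: group "cocycle_extension G s" by (rule group_cocycle_extension[OF G s])
  show ?thesis
    unfolding central_extension_def
  proof (intro conjI G E.is_group allI ballI)
    show "cocycle_embedding G s \<in> mon integer_group (cocycle_extension G s)"
      by (auto simp: mon_def hom_def inj_on_def cocycle_embedding_def)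
    show "fst \<in> epi (cocycle_extension G s) G"
      by (auto simp: epi_def hom_def)
    show "kernel (cocycle_extension G s) G fst = range (cocycle_embedding G s)"
    proof
      show "kernel (cocycle_extension G s) G fst \<subseteq> range (cocycle_embedding G s)"
      proof
        fix x assume "x \<in> kernel (cocycle_extension G s) G fst"
        then have "x = cocycle_embedding G s (snd x + s (\<one>\<^bsub>G\<^esub>, \<one>\<^bsub>G\<^esub>))"
          by (cases x rule: prod.exhaust) (auto simp: kernel_def cocycle_embedding_def)
        then show "x \<in> range (cocycle_embedding G s)" by blast
      qed
    qed (auto simp: kernel_def cocycle_embedding_def)
    fix n e assume "e \<in> carrier (cocycle_extension G s)"
    then show "cocycle_embedding G s n \<otimes>\<^bsub>cocycle_extension G s\<^esub> e = e \<otimes>\<^bsub>cocycle_extension G s\<^esub> cocycle_embedding G s n"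
      by (cases e rule: prod.exhaust) (auto simp: cocycle_embedding_mult[OF G s])
  qed
qed

lemma cocycle_embedding_int_pow:
  assumes G: "group G" and s: "s \<in> cocycles2 G"
  shows "cocycle_embedding G s 1 [^]\<^bsub>cocycle_extension G s\<^esub> (j::int) = cocycle_embedding G s j"
proof -
  have "cocycle_embedding G s \<in> hom integer_group (cocycle_extension G s)"
    using central_extension_cocycle_extension[OF G s] by (simp add: central_extension_def mon_def)
  then interpret h: group_hom integer_group "cocycle_extension G s" "cocycle_embedding G s"
    by (simp add: group_hom_def group_hom_axioms_def group_cocycle_extension[OF G s])
  show ?thesis using h.hom_int_pow[of 1 j] by simp
qed

text \<open>A section has the form g -> (g, b g), and its cocycle is s plus the coboundary of b.
  Every section therefore yields a cocycle in the coset of s.\<close>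

lemma extension_represents_cocycle_extension:
  assumes G: "group G" and s: "s \<in> cocycles2 G"
  shows "extension_represents G (cocycle_extension G s) (cocycle_embedding G s) fst
    (coboundaries2 G #>\<^bsub>cochain_group2 G\<^esub> s)"
  unfolding extension_represents_def
proof (intro allI impI)
  interpret group G by fact
  let ?E = "cocycle_extension G s"
  interpret E: group ?E by (rule group_cocycle_extension[OF G s])
  fix t assume t: "set_section G ?E fst t"
  define b where "b g = snd (t g)" for g
  have t_eq: "t g = (g, b g)" if "g \<in> carrier G" for g
    using t that unfolding set_section_def b_def by (metis prod.collapse)
  have inj: "inj (cocycle_embedding G s)" by (auto simp: inj_on_def cocycle_embedding_def)
  let ?d = "\<lambda>(g, h)\<in>carrier G \<times> carrier G. b h - b (g \<otimes>\<^bsub>G\<^esub> h) + b g"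
  have ext: "extension_cocycle G ?E (cocycle_embedding G s) t (g, h) = b h - b (g \<otimes>\<^bsub>G\<^esub> h) + b g + s (g, h)"
    if g: "g \<in> carrier G" "h \<in> carrier G" for g h
  proof -
    let ?n = "b h - b (g \<otimes>\<^bsub>G\<^esub> h) + b g + s (g, h)"
    have "t g \<otimes>\<^bsub>?E\<^esub> t h = cocycle_embedding G s ?n \<otimes>\<^bsub>?E\<^esub> t (g \<otimes>\<^bsub>G\<^esub> h)"
      using g by (simp add: t_eq cocycle_embedding_mult[OF G s])
    moreover have "cocycle_embedding G s ?n \<in> carrier ?E" by (simp add: cocycle_embedding_def)
    moreover have "t (g \<otimes>\<^bsub>G\<^esub> h) \<in> carrier ?E" using g t_eq[of "g \<otimes>\<^bsub>G\<^esub> h"] by simp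
    ultimately have "t g \<otimes>\<^bsub>?E\<^esub> t h \<otimes>\<^bsub>?E\<^esub> inv\<^bsub>?E\<^esub> (t (g \<otimes>\<^bsub>G\<^esub> h)) = cocycle_embedding G s ?n"
      by (simp only: E.m_assoc E.inv_closed E.r_inv E.r_one)
    then show ?thesis using g inj by (simp add: extension_cocycle_def the_inv_f_f)
  qed
  have "extension_cocycle G ?E (cocycle_embedding G s) t = ?d \<otimes>\<^bsub>cochain_group2 G\<^esub> s"
    unfolding cochain_group2_def mult_product_group
  proof (rule extensionalityI)
    show "extension_cocycle G ?E (cocycle_embedding G s) t \<in> extensional (carrier G \<times> carrier G)"
      by (simp add: extension_cocycle_def)
  qed (auto simp: ext)
  moreover have "?d \<in> coboundaries2 G" unfolding coboundaries2_def by blast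
  ultimately show "extension_cocycle G ?E (cocycle_embedding G s) t \<in> coboundaries2 G #>\<^bsub>cochain_group2 G\<^esub> s"
    unfolding r_coset_def by blast
qed

section \<open>Representations with scalar central element\<close>

text \<open>The representation induced from a unitary character, in coordinates given by coset
  representatives r: the (a, b) entry at e is
  \<open>\<psi>0 (r a \<otimes> e \<otimes> inv (r b))\<close>, where \<open>\<psi>0\<close> extends
  \<open>\<psi>\<close> by zero. Each row has exactly one nonzero entry. A central p in P can be
  pulled out to the left of this argument, which multiplies all entries by the same scalar.\<close>

lemma induced_representation:
  fixes E :: "('e, 'm) monoid_scheme" (structure) and \<psi> :: "'e \<Rightarrow> complex"
  assumes E: "group E" and P: "subgroup P E" and cov: "group.covered_by E (carrier E) P"
    and mult: "\<And>x y. x \<in> P \<Longrightarrow> y \<in> P \<Longrightarrow> \<psi> (x \<otimes> y) = \<psi> x * \<psi> y"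
    and norm: "\<And>x. x \<in> P \<Longrightarrow> cmod (\<psi> x) = 1"
  shows "\<exists>d \<pi>. d \<ge> 1 \<and> \<pi> \<in> hom E (unitary_group d) \<and>
    (\<forall>p\<in>P. \<forall>e\<in>carrier E. (\<forall>x\<in>carrier E. p \<otimes> x = x \<otimes> p) \<longrightarrow> \<pi> (p \<otimes> e) = \<psi> p \<cdot>\<^sub>m \<pi> e)"
proof -
  interpret group E by fact
  have Pc: "p \<in> carrier E" if "p \<in> P" for p using that by (rule subgroup.mem_carrier[OF P])
  define d where "d = card (rcosets P)"
  have fin: "finite (rcosets P)" using finite_rcosets_iff_covered_by[OF P] cov by blast
  have "P #> \<one> \<in> rcosets P" by (auto simp: RCOSETS_def)
  then have d: "d \<ge> 1" using fin unfolding d_def by (metis One_nat_def Suc_leI card_gt_0_iff empty_iff)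
  obtain h where h: "bij_betw h {0..<d} (rcosets P)"
    using ex_bij_betw_nat_finite[OF fin] unfolding d_def by blast
  have "\<forall>a\<in>{0..<d}. \<exists>x. x \<in> carrier E \<and> h a = P #> x"
  proof
    fix a assume "a \<in> {0..<d}"
    then have "h a \<in> rcosets P" using h by (auto simp: bij_betw_def)
    then show "\<exists>x. x \<in> carrier E \<and> h a = P #> x" by (auto simp: RCOSETS_def)
  qed
  then obtain r where r: "\<And>a. a \<in> {0..<d} \<Longrightarrow> r a \<in> carrier E \<and> h a = P #> r a" by metis
  have rc: "r a \<in> carrier E" if "a < d" for a using r that by simp
  have mem_coset: "x \<otimes> inv y \<in> P \<longleftrightarrow> x \<in> P #> y" if "x \<in> carrier E" "y \<in> carrier E" for x y
  proof
    assume "x \<otimes> inv y \<in> P"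
    moreover have "x = x \<otimes> inv y \<otimes> y" using that by (simp add: m_assoc)
    ultimately show "x \<in> P #> y" unfolding r_coset_def by blast
  next
    assume "x \<in> P #> y"
    then obtain p where "p \<in> P" "x = p \<otimes> y" unfolding r_coset_def by blast
    then show "x \<otimes> inv y \<in> P" using that Pc by (simp add: m_assoc)
  qed
  have ex_index: "\<exists>b<d. x \<otimes> inv (r b) \<in> P" if x: "x \<in> carrier E" for x
  proof -
    have "P #> x \<in> h ` {0..<d}" using h x by (auto simp: bij_betw_def RCOSETS_def)
    then obtain b where b: "b < d" "h b = P #> x" by auto
    have "x \<in> P #> x" by (rule rcos_self[OF x P])
    then show ?thesis using mem_coset[OF x rc[OF b(1)]] b r[of b] by auto
  qed
  have uniq_index: "b = b'"
    if x: "x \<in> carrier E" and b: "b < d" "x \<otimes> inv (r b) \<in> P" "b' < d" "x \<otimes> inv (r b') \<in> P" for x b b'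
  proof -
    have "x \<in> P #> r b" "x \<in> P #> r b'"
      using mem_coset[OF x rc[OF b(1)]] mem_coset[OF x rc[OF b(3)]] b(2,4) by simp_all
    then have "P #> r b = P #> r b'"
      using repr_independence[OF _ rc[OF b(1)] P, of x] repr_independence[OF _ rc[OF b(3)] P, of x] by simp
    then have "h b = h b'" using r[of b] r[of b'] b(1,3) by simp
    then show ?thesis using h b(1,3) unfolding bij_betw_def inj_on_def by simp
  qed
  define \<psi>0 where "\<psi>0 x = (if x \<in> P then \<psi> x else 0)" for x
  have one: "\<psi> \<one> = 1"
  proof -
    have "\<one> \<in> P" by (rule subgroup.one_closed[OF P])
    then have "\<psi> \<one> * \<psi> \<one> = \<psi> \<one>" "\<psi> \<one> \<noteq> 0" using mult[of \<one> \<one>] norm[of \<one>] by auto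
    then show ?thesis by simp
  qed
  have \<psi>0_mult: "\<psi>0 (p \<otimes> x) = \<psi> p * \<psi>0 x" if p: "p \<in> P" and x: "x \<in> carrier E" for p x
  proof -
    have "p \<otimes> x \<in> P \<longleftrightarrow> x \<in> P"
    proof
      assume px: "p \<otimes> x \<in> P"
      have "inv p \<otimes> (p \<otimes> x) \<in> P" by (intro subgroup.m_closed[OF P] subgroup.m_inv_closed[OF P] p px)
      then show "x \<in> P" using inv_cancel_left(1)[OF Pc[OF p] x] by simp
    qed (rule subgroup.m_closed[OF P p])
    then show ?thesis using mult p by (simp add: \<psi>0_def)
  qed
  have \<psi>0_inv: "\<psi>0 (inv x) = cnj (\<psi>0 x)" if x: "x \<in> carrier E" for x
  proof (cases "x \<in> P")
    case True
    then have ix: "inv x \<in> P" by (rule subgroup.m_inv_closed[OF P])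
    have "\<psi> (inv x) * \<psi> x = 1" using mult[OF ix True] one x by simp
    moreover have "cnj (\<psi> x) * \<psi> x = 1"
      using norm[OF True] complex_norm_square[of "\<psi> x"] by (simp add: mult.commute)
    ultimately have "\<psi> (inv x) = cnj (\<psi> x)" by (metis mult_right_cancel mult_zero_right zero_neq_one)
    then show ?thesis using True ix by (simp add: \<psi>0_def)
  next
    case False
    then have "inv x \<notin> P" using subgroup.m_inv_closed[OF P, of "inv x"] x by auto
    then show ?thesis using False by (simp add: \<psi>0_def)
  qed
  define \<pi> where "\<pi> e = Matrix.mat d d (\<lambda>(a, b). \<psi>0 (r a \<otimes> e \<otimes> inv (r b)))" for e
  have \<pi>c [simp]: "\<pi> e \<in> carrier_mat d d" for e by (simp add: \<pi>_def)
  have \<pi>_mult: "\<pi> (e \<otimes> f) = \<pi> e * \<pi> f" if e: "e \<in> carrier E" and f: "f \<in> carrier E" for e f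
  proof (rule eq_matI)
    fix a c assume "a < dim_row (\<pi> e * \<pi> f)" "c < dim_col (\<pi> e * \<pi> f)"
    then have ac: "a < d" "c < d" by (simp_all add: \<pi>_def)
    have ra: "r a \<otimes> e \<in> carrier E" using rc[OF ac(1)] e by simp
    obtain b where b: "b < d" "r a \<otimes> e \<otimes> inv (r b) \<in> P" using ex_index[OF ra] by blast
    have rb: "r b \<in> carrier E" by (rule rc[OF b(1)])
    have "(\<pi> e * \<pi> f) $$ (a, c)
        = (\<Sum>j\<in>{0..<d}. \<psi>0 (r a \<otimes> e \<otimes> inv (r j)) * \<psi>0 (r j \<otimes> f \<otimes> inv (r c)))"
      using ac by (simp add: \<pi>_def scalar_prod_def)
    \<comment> \<open>Here \<open>b\<close> is the index of the coset that contains
      \<open>r a \<otimes> e\<close>; for every other j the first factor is evaluated outside P and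
      vanishes.\<close>
    also have "\<dots> = (\<Sum>j\<in>{b}. \<psi>0 (r a \<otimes> e \<otimes> inv (r j)) * \<psi>0 (r j \<otimes> f \<otimes> inv (r c)))"
    proof (rule sum.mono_neutral_right)
      show "\<forall>j\<in>{0..<d} - {b}. \<psi>0 (r a \<otimes> e \<otimes> inv (r j)) * \<psi>0 (r j \<otimes> f \<otimes> inv (r c)) = 0"
      proof
        fix j assume "j \<in> {0..<d} - {b}"
        then have "r a \<otimes> e \<otimes> inv (r j) \<notin> P" using uniq_index[OF ra b] by auto
        then show "\<psi>0 (r a \<otimes> e \<otimes> inv (r j)) * \<psi>0 (r j \<otimes> f \<otimes> inv (r c)) = 0" by (simp add: \<psi>0_def)
      qed
    qed (use b in auto)
    also have "\<dots> = \<psi> (r a \<otimes> e \<otimes> inv (r b)) * \<psi>0 (r b \<otimes> f \<otimes> inv (r c))"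
      using b(2) by (simp add: \<psi>0_def)
    also have "\<dots> = \<psi>0 ((r a \<otimes> e \<otimes> inv (r b)) \<otimes> (r b \<otimes> f \<otimes> inv (r c)))"
      using rb rc[OF ac(2)] f by (intro \<psi>0_mult[OF b(2), symmetric]) simp
    also have "(r a \<otimes> e \<otimes> inv (r b)) \<otimes> (r b \<otimes> f \<otimes> inv (r c)) = r a \<otimes> (e \<otimes> f) \<otimes> inv (r c)"
      using rb rc[OF ac(1)] rc[OF ac(2)] e f by (simp add: m_assoc inv_cancel_left)
    finally show "\<pi> (e \<otimes> f) $$ (a, c) = (\<pi> e * \<pi> f) $$ (a, c)"
      using ac by (simp add: \<pi>_def)
  qed (simp_all add: \<pi>_def)
  have \<pi>_one: "\<pi> \<one> = 1\<^sub>m d"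
  proof (rule eq_matI)
    fix a b assume "a < dim_row (1\<^sub>m d :: complex mat)" "b < dim_col (1\<^sub>m d :: complex mat)"
    then have ab: "a < d" "b < d" by simp_all
    have "r a \<otimes> inv (r a) \<in> P" using rc[OF ab(1)] subgroup.one_closed[OF P] by simp
    then have "r a \<otimes> inv (r b) \<in> P \<longleftrightarrow> a = b" using uniq_index[OF rc[OF ab(1)] ab(1) _ ab(2)] by auto
    then show "\<pi> \<one> $$ (a, b) = 1\<^sub>m d $$ (a, b)"
      using ab rc one by (auto simp: \<pi>_def \<psi>0_def)
  qed (simp_all add: \<pi>_def)
  \<comment> \<open>Unitarity reduces to multiplicativity once the adjoint is identified with the
    value at the inverse, which holds because \<open>\<psi>\<close> has modulus 1.\<close>
  have \<pi>_adj: "mat_adjoint (\<pi> e) = \<pi> (inv e)" if e: "e \<in> carrier E" for e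
  proof (rule eq_matI)
    fix i j assume "i < dim_row (\<pi> (inv e))" "j < dim_col (\<pi> (inv e))"
    then have ij: "i < d" "j < d" by (simp_all add: \<pi>_def)
    have "inv (r j \<otimes> e \<otimes> inv (r i)) = r i \<otimes> inv e \<otimes> inv (r j)"
      using rc[OF ij(1)] rc[OF ij(2)] e by (simp add: inv_mult_group m_assoc)
    then have "cnj (\<psi>0 (r j \<otimes> e \<otimes> inv (r i))) = \<psi>0 (r i \<otimes> inv e \<otimes> inv (r j))"
      using \<psi>0_inv[of "r j \<otimes> e \<otimes> inv (r i)"] rc[OF ij(1)] rc[OF ij(2)] e by simp
    then show "mat_adjoint (\<pi> e) $$ (i, j) = \<pi> (inv e) $$ (i, j)"
      using ij by (simp add: mat_adjoint_index[OF \<pi>c]) (simp add: \<pi>_def)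
  qed (use carrier_matD[OF mat_adjoint_carrier[OF \<pi>c]] carrier_matD[OF \<pi>c] in simp_all)
  have hom: "\<pi> \<in> hom E (unitary_group d)"
  proof (rule homI)
    fix e assume e: "e \<in> carrier E"
    have "mat_adjoint (\<pi> e) * \<pi> e = 1\<^sub>m d" "\<pi> e * mat_adjoint (\<pi> e) = 1\<^sub>m d"
      using \<pi>_mult[of "inv e" e] \<pi>_mult[of e "inv e"] e by (simp_all add: \<pi>_adj \<pi>_one)
    then show "\<pi> e \<in> carrier (unitary_group d)" by (simp add: unitary_group_def)
  next
    fix e f assume "e \<in> carrier E" "f \<in> carrier E"
    then show "\<pi> (e \<otimes> f) = \<pi> e \<otimes>\<^bsub>unitary_group d\<^esub> \<pi> f" by (simp add: unitary_group_def \<pi>_mult)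
  qed
  have "\<pi> (p \<otimes> e) = \<psi> p \<cdot>\<^sub>m \<pi> e"
    if p: "p \<in> P" and e: "e \<in> carrier E" and central: "\<forall>x\<in>carrier E. p \<otimes> x = x \<otimes> p" for p e
  proof (rule eq_matI)
    fix a b assume "a < dim_row (\<psi> p \<cdot>\<^sub>m \<pi> e)" "b < dim_col (\<psi> p \<cdot>\<^sub>m \<pi> e)"
    then have ab: "a < d" "b < d" by (simp_all add: \<pi>_def)
    have "r a \<otimes> (p \<otimes> e) \<otimes> inv (r b) = (r a \<otimes> p) \<otimes> e \<otimes> inv (r b)"
      using rc[OF ab(1)] rc[OF ab(2)] Pc[OF p] e by (simp add: m_assoc)
    also have "\<dots> = (p \<otimes> r a) \<otimes> e \<otimes> inv (r b)" using central rc[OF ab(1)] by simp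
    also have "\<dots> = p \<otimes> (r a \<otimes> e \<otimes> inv (r b))"
      using rc[OF ab(1)] rc[OF ab(2)] Pc[OF p] e by (simp add: m_assoc)
    finally have "\<psi>0 (r a \<otimes> (p \<otimes> e) \<otimes> inv (r b)) = \<psi> p * \<psi>0 (r a \<otimes> e \<otimes> inv (r b))"
      using \<psi>0_mult[OF p] rc[OF ab(1)] rc[OF ab(2)] e by simp
    then show "\<pi> (p \<otimes> e) $$ (a, b) = (\<psi> p \<cdot>\<^sub>m \<pi> e) $$ (a, b)" using ab by (simp add: \<pi>_def)
  qed (simp_all add: \<pi>_def)
  then show ?thesis using d hom by blast
qed

section \<open>Scalar action of the central generator\<close>

definition root_of_unity :: "nat \<Rightarrow> int \<Rightarrow> complex" where
  "root_of_unity k j = exp (\<i> * of_real (2 * pi * of_int j / of_nat k))"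

lemma root_of_unity_add: "root_of_unity k (i + j) = root_of_unity k i * root_of_unity k j"
  by (simp add: root_of_unity_def add_divide_distrib distrib_left flip: exp_add)

lemma norm_root_of_unity: "cmod (root_of_unity k j) = 1"
  unfolding root_of_unity_def by (rule norm_exp_i_times)

lemma root_of_unity_eq_1: "k > 0 \<Longrightarrow> int k dvd j \<Longrightarrow> root_of_unity k j = 1"
  by (auto simp: root_of_unity_def exp_eq_1 elim!: dvdE)

text \<open>P is <c> N, a subgroup because c is central. The character sends c^j x with x in N to
  \<open>root_of_unity k j\<close>. It is well defined: two exponents i, j for the same element give
  c^(i - j) in N, so k divides i - j. Inducing from P then makes c act as a scalar.\<close>

lemma central_scalar_representation:
  fixes E :: "('e, 'm) monoid_scheme" (structure)
  assumes E: "group E" and N: "subgroup N E" and cov: "group.covered_by E (carrier E) N"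
    and c: "c \<in> carrier E" and central: "\<And>j::int. \<And>x. x \<in> carrier E \<Longrightarrow> c [^] j \<otimes> x = x \<otimes> c [^] j"
    and k: "k > 0" "\<And>j::int. c [^] j \<in> N \<Longrightarrow> int k dvd j"
  shows "\<exists>d \<pi>. d \<ge> 1 \<and> \<pi> \<in> hom E (unitary_group d) \<and>
    (\<forall>j::int. \<forall>e\<in>carrier E. \<pi> (c [^] j \<otimes> e) = root_of_unity k j \<cdot>\<^sub>m \<pi> e)"
proof -
  interpret group E by fact
  note Nc = subgroup.mem_carrier[OF N] and Nm = subgroup.m_closed[OF N] and Ni = subgroup.m_inv_closed[OF N]
  define P where "P = {x \<in> carrier E. \<exists>j::int. c [^] (- j) \<otimes> x \<in> N}"
  define \<psi> where "\<psi> x = root_of_unity k (SOME j::int. c [^] (- j) \<otimes> x \<in> N)" for x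
  have \<psi>_eq: "\<psi> x = root_of_unity k j" if x: "x \<in> carrier E" and j: "c [^] (- j) \<otimes> x \<in> N" for x j
  proof -
    define i where "i = (SOME j::int. c [^] (- j) \<otimes> x \<in> N)"
    have i: "c [^] (- i) \<otimes> x \<in> N"
      unfolding i_def by (rule someI[where P = "\<lambda>j::int. c [^] (- j) \<otimes> x \<in> N", OF j])
    have "(c [^] (- j) \<otimes> x) \<otimes> inv (c [^] (- i) \<otimes> x) = c [^] (- j) \<otimes> inv (c [^] (- i))"
      using x c by (simp add: inv_mult_group m_assoc inv_cancel_left)
    also have "\<dots> = c [^] (- j) \<otimes> c [^] i" using c by (simp add: int_pow_neg)
    also have "\<dots> = c [^] (- j + i)" by (rule int_pow_mult[OF c, symmetric])
    also have "- j + i = i - j" by simp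
    finally have "c [^] (i - j) \<in> N" using Nm[OF j Ni[OF i]] by simp
    then have "root_of_unity k (i - j) = 1" using k root_of_unity_eq_1 by blast
    then show ?thesis using root_of_unity_add[of k "i - j" j] by (simp add: \<psi>_def flip: i_def)
  qed
  have mult: "c [^] (- (i + j)) \<otimes> (x \<otimes> y) = (c [^] (- i) \<otimes> x) \<otimes> (c [^] (- j) \<otimes> y)"
    if "x \<in> carrier E" "y \<in> carrier E" for x y and i j :: int
  proof -
    have "c [^] (- (i + j)) \<otimes> (x \<otimes> y) = c [^] (- i) \<otimes> (c [^] (- j) \<otimes> x) \<otimes> y"
      using that c by (simp add: m_assoc int_pow_mult[of c "- i" "- j", simplified] minus_add_distrib)
    also have "c [^] (- j) \<otimes> x = x \<otimes> c [^] (- j)" by (rule central[OF that(1)])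
    finally show ?thesis using that c by (simp add: m_assoc)
  qed
  have P: "subgroup P E"
  proof (rule subgroupI)
    show "P \<subseteq> carrier E" by (auto simp: P_def)
    have "c [^] (- 0 :: int) \<otimes> \<one> \<in> N" using subgroup.one_closed[OF N] by simp
    then show "P \<noteq> {}" unfolding P_def by blast
  next
    fix x assume "x \<in> P"
    then obtain j :: int where x: "x \<in> carrier E" "c [^] (- j) \<otimes> x \<in> N" by (auto simp: P_def)
    have "inv (c [^] (- j) \<otimes> x) = inv x \<otimes> c [^] j"
      using x(1) c by (simp add: inv_mult_group int_pow_neg)
    also have "\<dots> = c [^] (- (- j)) \<otimes> inv x" using central[of "inv x" j] x(1) by simp
    finally have "c [^] (- (- j)) \<otimes> inv x \<in> N" using Ni[OF x(2)] by simp
    then show "inv x \<in> P" unfolding P_def using x(1) by blast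
  next
    fix x y assume "x \<in> P" "y \<in> P"
    then obtain i j :: int where *: "x \<in> carrier E" "c [^] (- i) \<otimes> x \<in> N" "y \<in> carrier E" "c [^] (- j) \<otimes> y \<in> N"
      by (auto simp: P_def)
    have "c [^] (- (i + j)) \<otimes> (x \<otimes> y) \<in> N" unfolding mult[OF *(1,3)] by (rule Nm[OF *(2,4)])
    then show "x \<otimes> y \<in> P" unfolding P_def using * by blast
  qed
  have NP: "N \<subseteq> P"
  proof
    fix x assume x: "x \<in> N"
    then have "c [^] (- 0 :: int) \<otimes> x \<in> N" using Nc by simp
    then show "x \<in> P" unfolding P_def using Nc[OF x] by blast
  qed
  have "\<psi> (x \<otimes> y) = \<psi> x * \<psi> y" if xy: "x \<in> P" "y \<in> P" for x y
  proof -
    obtain i j :: int where *: "x \<in> carrier E" "c [^] (- i) \<otimes> x \<in> N" "y \<in> carrier E" "c [^] (- j) \<otimes> y \<in> N"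
      using xy unfolding P_def by blast
    have "c [^] (- (i + j)) \<otimes> (x \<otimes> y) \<in> N" unfolding mult[OF *(1,3)] by (rule Nm[OF *(2,4)])
    then have "\<psi> (x \<otimes> y) = root_of_unity k (i + j)" using * by (intro \<psi>_eq) auto
    then show ?thesis using \<psi>_eq[OF *(1,2)] \<psi>_eq[OF *(3,4)] by (simp add: root_of_unity_add)
  qed
  moreover have "cmod (\<psi> x) = 1" for x by (simp add: \<psi>_def norm_root_of_unity)
  moreover have "covered_by (carrier E) P" by (rule covered_by_mono[OF cov NP])
  ultimately obtain d \<pi> where d: "d \<ge> 1" "\<pi> \<in> hom E (unitary_group d)"
    and \<pi>: "\<forall>p\<in>P. \<forall>e\<in>carrier E. (\<forall>x\<in>carrier E. p \<otimes> x = x \<otimes> p) \<longrightarrow> \<pi> (p \<otimes> e) = \<psi> p \<cdot>\<^sub>m \<pi> e"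
    using induced_representation[OF E P, of \<psi>] by auto
  have "\<pi> (c [^] j \<otimes> e) = root_of_unity k j \<cdot>\<^sub>m \<pi> e" if e: "e \<in> carrier E" for e and j :: int
  proof -
    have "c [^] (- j) \<otimes> c [^] j = \<one>" using c by (simp flip: int_pow_mult)
    then have *: "c [^] (- j) \<otimes> c [^] j \<in> N" using subgroup.one_closed[OF N] by simp
    then have "c [^] j \<in> P" unfolding P_def using c by blast
    moreover have "\<psi> (c [^] j) = root_of_unity k j" using c * by (intro \<psi>_eq) auto
    ultimately show ?thesis using \<pi> e central by auto
  qed
  then show ?thesis using d by blast
qed

text \<open>Finite index puts some positive power of c into N, and k is the least such exponent.
  Division with remainder shows that k divides all the others; avoiding the exponents 1, ..., n
  forces k > n.\<close>

lemma least_power_in_subgroup: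
  fixes E :: "('e, 'm) monoid_scheme" (structure)
  assumes E: "group E" and N: "subgroup N E" and cov: "group.covered_by E (carrier E) N"
    and c: "c \<in> carrier E" and avoid: "\<And>j::int. j \<in> {1..int n} \<Longrightarrow> c [^] j \<notin> N"
  obtains k where "k > n" "\<And>j::int. c [^] j \<in> N \<Longrightarrow> int k dvd j"
proof -
  interpret group E by fact
  have "\<exists>k::nat. k > 0 \<and> c [^] int k \<in> N"
    using covered_by_power_mem[OF N subgroup_self cov] c by (auto simp: int_pow_int)
  then obtain k where k: "k > 0" "c [^] int k \<in> N" "\<And>i. i < k \<Longrightarrow> \<not> (i > 0 \<and> c [^] int i \<in> N)"
    using exists_least_iff[of "\<lambda>k::nat. k > 0 \<and> c [^] int k \<in> N"] by blast
  have "k > n"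
  proof (rule ccontr)
    assume "\<not> n < k"
    then have "int k \<in> {1..int n}" using k(1) by auto
    then show False using avoid k(2) by blast
  qed
  moreover have "int k dvd j" if j: "c [^] (j::int) \<in> N" for j
  proof -
    have q: "c [^] (int k * (- (j div int k))) \<in> N"
      using subgroup_int_pow[OF N k(2), of "- (j div int k)"] int_pow_pow[OF c] by simp
    have "j mod int k = j + int k * (- (j div int k))" by (simp add: minus_div_mult_eq_mod[symmetric] mult.commute)
    then have "c [^] (j mod int k) = c [^] j \<otimes> c [^] (int k * (- (j div int k)))" using int_pow_mult[OF c] by metis
    then have "c [^] (j mod int k) \<in> N" using subgroup.m_closed[OF N j q] by simp
    moreover have "j mod int k = int (nat (j mod int k))" "nat (j mod int k) < k"
      using k(1) by (simp_all add: nat_less_iff)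
    ultimately have "\<not> nat (j mod int k) > 0" using k(3)[of "nat (j mod int k)"] by metis
    then have "j mod int k = 0" using k(1) pos_mod_sign[of "int k" j] by linarith
    then show ?thesis by presburger
  qed
  ultimately show ?thesis by (rule that)
qed

section \<open>The asymptotic representation and its obstruction\<close>

lemma root_of_unity_tendsto:
  assumes "\<And>n. k n > n"
  shows "(\<lambda>n. root_of_unity (k n) j) \<longlonglongrightarrow> 1"
    and "(\<lambda>n. 2 * pi * real_of_int j / real (k n)) \<longlonglongrightarrow> 0"
proof -
  have "filterlim (\<lambda>n. real (k n)) at_top sequentially"
    by (rule filterlim_at_top_mono[OF filterlim_real_sequentially]) (use assms in \<open>auto intro!: always_eventually less_imp_le\<close>)
  then show *: "(\<lambda>n. 2 * pi * real_of_int j / real (k n)) \<longlonglongrightarrow> 0"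
    by (rule tendsto_divide_0[OF tendsto_const filterlim_at_top_imp_at_infinity])
  have "(\<lambda>n. exp (\<i> * complex_of_real (2 * pi * real_of_int j / real (k n)))) \<longlonglongrightarrow> exp (\<i> * complex_of_real 0)"
    by (intro tendsto_intros *)
  then show "(\<lambda>n. root_of_unity (k n) j) \<longlonglongrightarrow> 1" by (simp add: root_of_unity_def)
qed

lemma not_matricially_stable_if_separated:
  fixes G :: "('a, 'm) monoid_scheme"
  assumes G: "group G" and s: "s \<in> cocycles2 G" and z: "z \<in> cycles2 G" "cochain_eval s z \<noteq> 0"
    and N: "\<And>n. subgroup (N n) (cocycle_extension G s)"
      "\<And>n. group.covered_by (cocycle_extension G s) (carrier (cocycle_extension G s)) (N n)"
      "\<And>n j. j \<in> {1..int n} \<Longrightarrow> cocycle_embedding G s j \<notin> N n"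
  shows "\<not> matricially_stable G"
proof
  assume stable: "matricially_stable G"
  interpret G: group G by fact
  let ?E = "cocycle_extension G s"
  interpret E: group ?E by (rule group_cocycle_extension[OF G s])
  define c where "c = cocycle_embedding G s 1"
  have c: "c \<in> carrier ?E" by (simp add: c_def cocycle_embedding_def)
  have c_pow: "c [^]\<^bsub>?E\<^esub> j = cocycle_embedding G s j" for j :: int
    unfolding c_def by (rule cocycle_embedding_int_pow[OF G s])
  have central: "c [^]\<^bsub>?E\<^esub> j \<otimes>\<^bsub>?E\<^esub> x = x \<otimes>\<^bsub>?E\<^esub> c [^]\<^bsub>?E\<^esub> j" if "x \<in> carrier ?E" for j :: int and x
    unfolding c_pow using central_extension_cocycle_extension[OF G s] that unfolding central_extension_def by blast
  have "\<exists>k. k > n \<and> (\<forall>j::int. c [^]\<^bsub>?E\<^esub> j \<in> N n \<longrightarrow> int k dvd j)" for n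
    by (rule least_power_in_subgroup[OF E.is_group N(1)[of n] N(2)[of n] c, of n])
      (use N(3) in \<open>auto simp: c_pow\<close>)
  then obtain k where k: "\<And>n. k n > n" "\<And>n j. c [^]\<^bsub>?E\<^esub> (j::int) \<in> N n \<Longrightarrow> int (k n) dvd j" by metis
  have k_pos: "k n > 0" for n using k(1)[of n] by simp
  have "\<exists>d \<pi>. d \<ge> 1 \<and> \<pi> \<in> hom ?E (unitary_group d) \<and>
    (\<forall>j::int. \<forall>e\<in>carrier ?E. \<pi> (c [^]\<^bsub>?E\<^esub> j \<otimes>\<^bsub>?E\<^esub> e) = root_of_unity (k n) j \<cdot>\<^sub>m \<pi> e)" for n
    by (rule central_scalar_representation[OF E.is_group N(1)[of n] N(2)[of n] c central])
      (use k(2) k_pos in blast)+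
  then obtain d \<pi> where d: "\<And>n. d n \<ge> (1::nat)" and \<pi>: "\<And>n. \<pi> n \<in> hom ?E (unitary_group (d n))"
    and \<pi>_c: "\<And>n j e. e \<in> carrier ?E \<Longrightarrow> \<pi> n (c [^]\<^bsub>?E\<^esub> (j::int) \<otimes>\<^bsub>?E\<^esub> e) = root_of_unity (k n) j \<cdot>\<^sub>m \<pi> n e"
    by metis
  define \<rho> where "\<rho> n g = \<pi> n (g, 0)" for n g
  have \<rho>U: "\<rho> n g \<in> carrier (unitary_group (d n))" if "g \<in> carrier G" for n g
    unfolding \<rho>_def using hom_in_carrier[OF \<pi>] that by simp
  have \<rho>_mult: "\<rho> n g * \<rho> n h = root_of_unity (k n) (s (g, h)) \<cdot>\<^sub>m \<rho> n (g \<otimes>\<^bsub>G\<^esub> h)"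
    if gh: "g \<in> carrier G" "h \<in> carrier G" for n g h
  proof -
    have "\<rho> n g * \<rho> n h = \<pi> n ((g, 0) \<otimes>\<^bsub>?E\<^esub> (h, 0))"
      using hom_mult[OF \<pi>, of "(g, 0)" "(h, 0)" n] gh by (simp add: \<rho>_def unitary_group_def)
    also have "(g, 0) \<otimes>\<^bsub>?E\<^esub> (h, 0) = c [^]\<^bsub>?E\<^esub> s (g, h) \<otimes>\<^bsub>?E\<^esub> (g \<otimes>\<^bsub>G\<^esub> h, 0)"
      using gh by (simp add: c_pow cocycle_embedding_mult[OF G s])
    finally show ?thesis using \<pi>_c[of "(g \<otimes>\<^bsub>G\<^esub> h, 0)"] gh by (simp add: \<rho>_def)
  qed
  have asym: "(\<lambda>n. op_norm_mat (\<rho> n (g \<otimes>\<^bsub>G\<^esub> h) - \<rho> n g * \<rho> n h)) \<longlonglongrightarrow> 0"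
    if gh: "g \<in> carrier G" "h \<in> carrier G" for g h
  proof (rule tendsto_sandwich[of "\<lambda>_. 0"])
    let ?e = "\<lambda>n. root_of_unity (k n) (s (g, h))"
    have U: "\<rho> n (g \<otimes>\<^bsub>G\<^esub> h) \<in> carrier (unitary_group (d n))" for n using \<rho>U gh by simp
    have eq: "\<rho> n (g \<otimes>\<^bsub>G\<^esub> h) - \<rho> n g * \<rho> n h = (1 - ?e n) \<cdot>\<^sub>m \<rho> n (g \<otimes>\<^bsub>G\<^esub> h)" for n
      unfolding \<rho>_mult[OF gh] using unitary_groupD(1)[OF U] by (intro eq_matI) (auto simp: algebra_simps)
    have "op_bound (d n) (cmod (1 - ?e n) * 1) (\<rho> n (g \<otimes>\<^bsub>G\<^esub> h) - \<rho> n g * \<rho> n h)" for n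
      unfolding eq by (intro op_bound_smult op_bound_unitary U)
    note b = this op_boundD(1)[OF this]
    show "\<forall>\<^sub>F n in sequentially. 0 \<le> op_norm_mat (\<rho> n (g \<otimes>\<^bsub>G\<^esub> h) - \<rho> n g * \<rho> n h)"
      using op_norm_mat_nonneg[OF b(2)] by simp
    show "\<forall>\<^sub>F n in sequentially. op_norm_mat (\<rho> n (g \<otimes>\<^bsub>G\<^esub> h) - \<rho> n g * \<rho> n h) \<le> cmod (1 - ?e n)"
      using op_norm_mat_le[OF b(1)] by simp
    have "(\<lambda>n. cmod (1 - ?e n)) \<longlonglongrightarrow> cmod (1 - 1)"
      by (intro tendsto_intros root_of_unity_tendsto k)
    then show "(\<lambda>n. cmod (1 - ?e n)) \<longlonglongrightarrow> 0" by simp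
  qed simp
  have "\<rho> n \<in> carrier G \<rightarrow> carrier (unitary_group (d n))" for n using \<rho>U by blast
  then obtain \<rho>' where \<rho>': "\<And>n. \<rho>' n \<in> hom G (unitary_group (d n))"
    and close: "\<And>g. g \<in> carrier G \<Longrightarrow> (\<lambda>n. op_norm_mat (\<rho> n g - \<rho>' n g)) \<longlonglongrightarrow> 0"
    using stable[unfolded matricially_stable_def, rule_format, of d \<rho>] d asym by blast
  let ?K = "Poly_Mapping.keys z"
  have K: "g \<in> carrier G \<and> h \<in> carrier G" if "(g, h) \<in> ?K" for g h
    using z(1) that by (auto simp: cycles2_def)
  \<comment> \<open>The elements at which logarithms are required: each pair (g, h) in the support
    of z contributes the three terms of its boundary, g, h and their product.\<close>
  define F where "F = fst ` ?K \<union> snd ` ?K \<union> (\<lambda>(g, h). g \<otimes>\<^bsub>G\<^esub> h) ` ?K"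
  have F: "finite F" "F \<subseteq> carrier G" using K by (auto simp: F_def)
  \<comment> \<open>The three eventual conditions match the hypotheses of
    \<open>det_log_projective\<close>: closeness to the representation, closeness of the multiplier
    to 1, and an angle within the principal branch.\<close>
  have ev1: "\<forall>\<^sub>F n in sequentially. \<forall>g\<in>F. op_norm_mat (\<rho> n g - \<rho>' n g) < 1/4"
  proof (rule eventually_ball_finite[OF F(1)], rule ballI)
    fix g assume "g \<in> F"
    then have "g \<in> carrier G" using F(2) by blast
    from order_tendstoD(2)[OF close[OF this], of "1/4"]
    show "\<forall>\<^sub>F n in sequentially. op_norm_mat (\<rho> n g - \<rho>' n g) < 1/4" by simp
  qed
  have ev2: "\<forall>\<^sub>F n in sequentially. \<forall>p\<in>?K. cmod (root_of_unity (k n) (s p) - 1) < 1/4"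
  proof (rule eventually_ball_finite, simp, rule ballI)
    fix p
    have "(\<lambda>n. cmod (root_of_unity (k n) (s p) - 1)) \<longlonglongrightarrow> cmod (1 - 1)"
      by (intro tendsto_intros root_of_unity_tendsto k)
    from order_tendstoD(2)[OF this, of "1/4"]
    show "\<forall>\<^sub>F n in sequentially. cmod (root_of_unity (k n) (s p) - 1) < 1/4" by simp
  qed
  have ev3: "\<forall>\<^sub>F n in sequentially. \<forall>p\<in>?K. \<bar>2 * pi * real_of_int (s p) / real (k n)\<bar> < pi"
  proof (rule eventually_ball_finite, simp, rule ballI)
    fix p
    have "(\<lambda>n. \<bar>2 * pi * real_of_int (s p) / real (k n)\<bar>) \<longlonglongrightarrow> \<bar>0\<bar>"
      by (intro tendsto_rabs root_of_unity_tendsto k)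
    from order_tendstoD(2)[OF this, of pi]
    show "\<forall>\<^sub>F n in sequentially. \<bar>2 * pi * real_of_int (s p) / real (k n)\<bar> < pi" by simp
  qed
  obtain n where n: "\<forall>g\<in>F. op_norm_mat (\<rho> n g - \<rho>' n g) < 1/4"
      "\<forall>p\<in>?K. cmod (root_of_unity (k n) (s p) - 1) < 1/4"
      "\<forall>p\<in>?K. \<bar>2 * pi * real_of_int (s p) / real (k n)\<bar> < pi"
    using eventually_happens[OF eventually_conj[OF ev1 eventually_conj[OF ev2 ev3]]] by auto
  have \<rho>'U: "\<rho>' n g \<in> carrier (unitary_group (d n))" if "g \<in> carrier G" for g
    using hom_in_carrier[OF \<rho>'] that by blast
  have bound: "op_bound (d n) (1/4) (\<rho> n g - \<rho>' n g)" if g: "g \<in> F" for g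
  proof -
    have gc: "g \<in> carrier G" using F(2) g by blast
    have "\<rho> n g - \<rho>' n g \<in> carrier_mat (d n) (d n)"
      by (rule minus_carrier_mat[OF unitary_groupD(1)[OF \<rho>'U[OF gc]]])
    then show ?thesis using n(1) g by (intro op_bound_mono[OF op_bound_op_norm_mat]) auto
  qed
  have "\<exists>x. det_log (d n) (\<rho> n g * mat_adjoint (\<rho>' n g) - 1\<^sub>m (d n)) x" if g: "g \<in> F" for g
  proof -
    have gc: "g \<in> carrier G" using F(2) g by blast
    have "op_bound (d n) (1/4) (\<rho> n g * mat_adjoint (\<rho>' n g) - 1\<^sub>m (d n))"
      by (rule op_bound_unitary_quotient[OF \<rho>U[OF gc] \<rho>'U[OF gc] bound[OF g]]) simp
    then show ?thesis by (rule det_log_exists) auto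
  qed
  then obtain b where b: "\<And>g. g \<in> F \<Longrightarrow> det_log (d n) (\<rho> n g * mat_adjoint (\<rho>' n g) - 1\<^sub>m (d n)) (b g)"
    by metis
  \<comment> \<open>The logarithm of the determinant of the scalar by which the central generator
    acts, that is, the contribution of one unit of s.\<close>
  define \<kappa> where "\<kappa> = of_nat (d n) * (\<i> * of_real (2 * pi / real (k n)))"
  have "\<kappa> * of_int (s (g, h)) = b h - b (g \<otimes>\<^bsub>G\<^esub> h) + b g" if gh: "(g, h) \<in> ?K" for g h
  proof -
    have gc: "g \<in> carrier G" "h \<in> carrier G" "g \<otimes>\<^bsub>G\<^esub> h \<in> carrier G" using K[OF gh] by auto
    have gF: "g \<in> F" "h \<in> F" "g \<otimes>\<^bsub>G\<^esub> h \<in> F" using gh unfolding F_def by force+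
    have mult': "\<rho>' n (g \<otimes>\<^bsub>G\<^esub> h) = \<rho>' n g * \<rho>' n h"
      using hom_mult[OF \<rho>' gc(1,2)] by (simp add: unitary_group_def)
    let ?\<theta> = "2 * pi * real_of_int (s (g, h)) / real (k n)"
    have "b g + b h = of_nat (d n) * (\<i> * of_real ?\<theta>) + b (g \<otimes>\<^bsub>G\<^esub> h)"
    proof (rule det_log_projective[OF \<rho>U[OF gc(1)] \<rho>U[OF gc(2)] \<rho>U[OF gc(3)] \<rho>'U[OF gc(1)] \<rho>'U[OF gc(2)]])
      show "\<rho>' n g * \<rho>' n h \<in> carrier (unitary_group (d n))" using \<rho>'U[OF gc(3)] by (simp add: mult')
      show "op_bound (d n) (1/4) (\<rho> n g - \<rho>' n g)" "op_bound (d n) (1/4) (\<rho> n h - \<rho>' n h)"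
        by (intro bound gF)+
      show "op_bound (d n) (1/4) (\<rho> n (g \<otimes>\<^bsub>G\<^esub> h) - \<rho>' n g * \<rho>' n h)"
        using bound[OF gF(3)] by (simp add: mult')
      show "\<rho> n g * \<rho> n h = exp (\<i> * of_real ?\<theta>) \<cdot>\<^sub>m \<rho> n (g \<otimes>\<^bsub>G\<^esub> h)"
        using \<rho>_mult[OF gc(1,2)] by (simp add: root_of_unity_def)
      show "\<bar>?\<theta>\<bar> < pi" using n(3) gh by blast
      show "cmod (exp (\<i> * of_real ?\<theta>) - 1) \<le> 1/4" using n(2) gh unfolding root_of_unity_def by fastforce
      show "det_log (d n) (\<rho> n g * mat_adjoint (\<rho>' n g) - 1\<^sub>m (d n)) (b g)" by (rule b[OF gF(1)])
      show "det_log (d n) (\<rho> n h * mat_adjoint (\<rho>' n h) - 1\<^sub>m (d n)) (b h)" by (rule b[OF gF(2)])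
      show "det_log (d n) (\<rho> n (g \<otimes>\<^bsub>G\<^esub> h) * mat_adjoint (\<rho>' n g * \<rho>' n h) - 1\<^sub>m (d n)) (b (g \<otimes>\<^bsub>G\<^esub> h))"
        using b[OF gF(3)] by (simp add: mult')
    qed
    moreover have "of_nat (d n) * (\<i> * of_real ?\<theta>) = \<kappa> * of_int (s (g, h))" by (simp add: \<kappa>_def)
    ultimately show ?thesis by (simp add: algebra_simps)
  qed
  then have "\<kappa> * of_int (cochain_eval s z) = 0" by (rule cycle_pairing_zero[OF z(1)])
  moreover have "\<kappa> \<noteq> 0" using d[of n] k(1)[of n] by (simp add: \<kappa>_def)
  ultimately show False using z(2) by simp
qed

section \<open>The separating extension and the failure of stability\<close>

theorem corollary3p23:
  fixes G :: "'a monoid"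
  assumes "group G"
    and "virtually_polycyclic G"
    and "\<not> torsion_group (cohomology2 G)"
  shows "(\<exists>x\<in>carrier (cohomology2 G).
            \<exists>(E :: ('a \<times> int) monoid) (i :: int \<Rightarrow> 'a \<times> int) (q :: 'a \<times> int \<Rightarrow> 'a).
              central_extension G E i q \<and>
              extension_represents G E i q x \<and>
              x \<notin> kernel (cohomology2 G) (hom_group (homology2 G) integer_group) (kronecker_map G) \<and>
              (\<exists>N :: nat \<Rightarrow> ('a \<times> int) set.
                 (\<forall>n. finite_index_subgroup (N n) E) \<and>
                 range i \<inter> (\<Inter>n. N n) = {\<one>\<^bsub>E\<^esub>}))
         \<and> \<not> matricially_stable G"
proof -
  interpret G: group G by fact
  note G = assms(1)
  obtain H where H: "subgroup H G" "finite (rcosets\<^bsub>G\<^esub> H)" "polycyclic (G\<lparr>carrier := H\<rparr>)"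
    using assms(2) unfolding virtually_polycyclic_def finite_index_subgroup_def by blast
  have pH: "G.polyc H" by (rule G.polyc_of_polycyclic[OF H(1,3)])
  have covH: "G.covered_by (carrier G) H" using G.finite_rcosets_iff_covered_by[OF H(1)] H(2) by blast
  obtain X where X: "finite X" "X \<subseteq> carrier G" "generate G X = carrier G"
    by (rule G.polyc_covered_finitely_generated[OF pH covH])
  obtain s where s: "s \<in> cocycles2 G"
    and nt: "\<forall>n>0. \<forall>b. \<exists>g\<in>carrier G. \<exists>h\<in>carrier G. int n * s (g, h) \<noteq> b h - b (g \<otimes>\<^bsub>G\<^esub> h) + b g"
    using non_torsion_cohomology2_cocycle[OF G assms(3)] by (elim bexE)
  have "\<exists>z\<in>cycles2 G. cochain_eval s z \<noteq> 0"
  proof (rule ccontr)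
    assume no: "\<not> ?thesis"
    then have "\<exists>n>0. \<exists>b. \<forall>g\<in>carrier G. \<forall>h\<in>carrier G. int n * s (g, h) = b h - b (g \<otimes>\<^bsub>G\<^esub> h) + b g"
      by (intro annihilates_cycles_imp_torsion[OF G X]) blast
    with nt show False by blast
  qed
  then obtain z where z: "z \<in> cycles2 G" "cochain_eval s z \<noteq> 0" by blast
  let ?E = "cocycle_extension G s"
  let ?i = "cocycle_embedding G s"
  interpret E: group ?E by (rule group_cocycle_extension[OF G s])
  have ce: "central_extension G ?E ?i fst" by (rule central_extension_cocycle_extension[OF G s])
  define x where "x = coboundaries2 G #>\<^bsub>cochain_group2 G\<^esub> s"
  have x: "x \<in> carrier (cohomology2 G)"
    using s by (auto simp: x_def cohomology2_def FactGroup_def RCOSETS_def r_coset_def)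
  have rep: "extension_represents G ?E ?i fst x"
    unfolding x_def by (rule extension_represents_cocycle_extension[OF G s])
  have sx: "s \<in> x"
  proof -
    interpret C: comm_group "cochain_group2 G" by (rule comm_group_cochain_group2)
    have "subgroup (coboundaries2 G) (cochain_group2 G)"
      using C.incl_subgroup[OF subgroup_cocycles2[OF G] subgroup_coboundaries2[OF G]] .
    moreover have "s \<in> carrier (cochain_group2 G)" using s by (simp add: cocycles2_def)
    ultimately show ?thesis unfolding x_def by (intro C.rcos_self)
  qed
  have ker: "x \<notin> kernel (cohomology2 G) (hom_group (homology2 G) integer_group) (kronecker_map G)"
  proof
    assume "x \<in> kernel (cohomology2 G) (hom_group (homology2 G) integer_group) (kronecker_map G)"
    then have zero: "kronecker_map G x = \<one>\<^bsub>hom_group (homology2 G) integer_group\<^esub>" by (simp add: kernel_def)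
    let ?Z = "(free_Abelian_group (carrier G \<times> carrier G))\<lparr>carrier := cycles2 G\<rparr>"
    define y where "y = boundaries2 G #>\<^bsub>?Z\<^esub> z"
    have y: "y \<in> carrier (homology2 G)"
      using z(1) by (auto simp: y_def homology2_def FactGroup_def RCOSETS_def)
    have zy: "z \<in> y"
      unfolding y_def
      by (rule group.rcos_self[OF comm_group.axioms(2)[OF comm_group_cycle_group2] _ subgroup_boundaries2[OF G]])
        (use z(1) in simp)
    have "kronecker_map G x y = cochain_eval s z" by (rule kronecker_map_coset[OF G x y sx zy])
    moreover have "kronecker_map G x y = 0"
      unfolding zero using y by (simp add: hom_group_def)
    ultimately show False using z(2) by simp
  qed
  define E' where "E' = {e \<in> carrier ?E. fst e \<in> H}"
  have fst: "fst \<in> hom ?E G" "fst ` carrier ?E = carrier G" by (auto simp: hom_def)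
  have i_pow: "?i 1 [^]\<^bsub>?E\<^esub> j = ?i j" for j :: int by (rule cocycle_embedding_int_pow[OF G s])
  have i_carrier: "?i j \<in> carrier ?E" for j by (simp add: cocycle_embedding_def)
  have "kernel ?E G fst = range (\<lambda>j::int. ?i 1 [^]\<^bsub>?E\<^esub> j)"
    using ce unfolding central_extension_def i_pow by simp
  then have pE': "E.polyc E'" unfolding E'_def by (intro polyc_vimage[OF E.is_group G fst i_carrier] pH)
  have covE': "E.covered_by (carrier ?E) E'"
    unfolding E'_def by (rule covered_by_vimage[OF E.is_group G fst H(1) covH])
  have subE': "subgroup E' ?E" by (rule E.polyc_subgroup[OF pE'])
  have i_nz: "?i j \<in> E' - {\<one>\<^bsub>?E\<^esub>}" if "j \<noteq> 0" for j
    using that subgroup.one_closed[OF H(1)] by (simp add: E'_def cocycle_embedding_def)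
  \<comment> \<open>The window 1, ..., n grows with n for two purposes: every nonzero central
    element is excluded from some N n, and the order of the scalar by which the central generator
    acts is forced past n.\<close>
  have "\<exists>m>0. E.powers_subgroup m E' \<inter> ?i ` {1..int n} = {}" for n
  proof (rule E.polyc_powers_avoid_finite[OF pE'])
    show "?i ` {1..int n} \<subseteq> E' - {\<one>\<^bsub>?E\<^esub>}" by (rule image_subsetI, rule i_nz) simp
  qed simp
  then obtain m where m: "\<And>n. m n > 0" "\<And>n. E.powers_subgroup (m n) E' \<inter> ?i ` {1..int n} = {}" by metis
  define N where "N n = E.powers_subgroup (m n) E'" for n
  have subN: "subgroup (N n) ?E" for n
    unfolding N_def by (rule E.subgroup_powers[OF subgroup.subset[OF subE']])
  have covN: "E.covered_by (carrier ?E) (N n)" for n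
    unfolding N_def
    by (rule E.covered_by_trans[OF covE' E.polyc_powers_finite_index[OF pE' m(1)]
          subgroup.subset[OF subN[unfolded N_def]]])
  have avoid: "?i j \<notin> N n" if "j \<in> {1..int n}" for n j using m(2)[of n] that unfolding N_def by blast
  have "finite_index_subgroup (N n) ?E" for n
    unfolding finite_index_subgroup_def using subN covN E.finite_rcosets_iff_covered_by by blast
  moreover have "range ?i \<inter> (\<Inter>n. N n) = {\<one>\<^bsub>?E\<^esub>}"
  proof
    show "range ?i \<inter> (\<Inter>n. N n) \<subseteq> {\<one>\<^bsub>?E\<^esub>}"
    proof
      fix y assume "y \<in> range ?i \<inter> (\<Inter>n. N n)"
      then obtain j where j: "y = ?i j" "\<And>n. ?i j \<in> N n" by auto
      \<comment> \<open>The windows contain positive integers only; a negative j is excluded through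
        its inverse.\<close>
      have "inv\<^bsub>?E\<^esub> (?i j) = ?i (- j)"
        using E.int_pow_neg[OF i_carrier, of 1 j] by (simp add: i_pow)
      then have neg: "?i (- j) \<in> N n" for n using subgroup.m_inv_closed[OF subN j(2)] by metis
      have "j = 0"
      proof (rule ccontr)
        assume "j \<noteq> 0"
        then have "j \<in> {1..int (nat \<bar>j\<bar>)} \<or> - j \<in> {1..int (nat \<bar>j\<bar>)}" by auto
        then show False using avoid j(2) neg by blast
      qed
      then show "y \<in> {\<one>\<^bsub>?E\<^esub>}" using j(1) by (simp add: cocycle_embedding_def)
    qed
    have "\<one>\<^bsub>?E\<^esub> = ?i 0" by (simp add: cocycle_embedding_def)
    then show "{\<one>\<^bsub>?E\<^esub>} \<subseteq> range ?i \<inter> (\<Inter>n. N n)" using subgroup.one_closed[OF subN] by blast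
  qed
  moreover have "\<not> matricially_stable G"
    by (rule not_matricially_stable_if_separated[OF G s z subN covN avoid])
  ultimately show ?thesis using x ce rep ker by blast
qed

end
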